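(* Let $\mathcal{B}=\{B_t\}_{t\in G}$ be a Fell bundle over a discrete group $G$ with total space $B$. If the reduced cross-sectional C*-algebra $C^*_\lambda(\mathcal{B})$ is MF (respectively QD), then the bundle $\mathcal{B}$ is MF (respectively QD).
   Context: All groups are discrete with neutral element $e$. $M_d$ is the algebra of complex $d\times d$ matrices. A Fell bundle over $G$ is a collection of Banach spaces $\mathcal{B}=\{B_t\}_{t\in G}$ whose disjoint union $B=\bigsqcup_t B_t$ (total space) has a multiplication and an involution such that for all $s,t\in G$, $a,b\in B$: $B_sB_t\subseteq B_{st}$; multiplication is bilinear $B_s\times B_t\to B_{st}$ and associative; $B_t^*\subseteq B_{t^{-1}}$; involution is conjugate-linear $B_t\to B_{t^{-1}}$; $(ab)^*=b^*a^*$; $a^{**}=a$; $\|ab\|\le\|a\|\|b\|$; $\|a^*\|=\|a\|$; $\|a^*a\|=\|a\|^2$; $a^*a\ge0$ in the C*-algebra $B_e$. $C_c(\mathcal{B})$ is the $*$-algebra of finitely supported sections ($x(t)\in B_t$) with $(xy)(s)=\sum_t x(t)y(t^{-1}s)$, $x^*(s)=x(s^{-1})^*$. $\ell_2(\mathcal{B})$ is the Hilbert $B_e$-module obtained by completing $C_c(\mathcal{B})$ with $(\xi\cdot b)(s)=\xi(s)b$, $\langle\xi,\eta\rangle=\sum_t\xi(t)^*\eta(t)$. For $b\in B_s$, $\lambda_s(b)$ is the adjointable operator $(\lambda_s(b)\xi)(t)=b\,\xi(s^{-1}t)$ on $\ell_2(\mathcal{B})$. $C^*_\lambda(\mathcal{B})$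 is the completion of $C_c(\mathcal{B})$ in the norm $\|x\|_\lambda=\|\sum_t\lambda_t(x(t))\|$. A C*-algebra $A$ is MF if for every finite $\mathcal{F}\subseteq A$ and $\varepsilon>0$ there are $d\in\mathbb{N}$ and a linear map $\varphi:A\to M_d$ such that for all $x,y\in\mathcal{F}$: $\|\varphi(x)^*-\varphi(x^* )\|<\varepsilon$, $\|\varphi(xy)-\varphi(x)\varphi(y)\|<\varepsilon$, $|\|\varphi(x)\|-\|x\||<\varepsilon$. It is QD if in addition $\varphi$ can always be taken completely positive and contractive (c.p.c.). A Fell bundle $\mathcal{B}$ is MF if for every $\varepsilon>0$ and finite $\Omega\subseteq B$ there are $d\in\mathbb{N}$ and linear maps $\varphi_t:B_t\to M_d$ ($t\in G$) such that: $\|\varphi_t(b)^*-\varphi_{t^{-1}}(b^* )\|<\varepsilon$ for all $b\in\Omega\cap B_t$; $\|\varphi_s(a)\varphi_t(b)-\varphi_{st}(ab)\|<\varepsilon$ for all $a\in\Omega\cap B_s$, $b\in\Omega\cap B_t$; $|\|\varphi_t(b)\|-\|b\||<\varepsilon$ for all $b\in\Omega\cap B_t$ (for all $s,t\in G$). It is QD if in addition $\varphi_e:B_e\to M_d$ can always be taken c.p.c. *)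

theory Defs
  imports "Jordan_Normal_Form.Schur_Decomposition"
begin

(* Normed spaces and star-algebras extend the module record of HOL-Algebra; scalars are the
   complex numbers, i.e. the ring "class_ring :: complex ring". As in HOL-Algebra's modules, the
   field "mult" carries no information for a mere vector space, and "one" is never used:
   the algebras below need not be unital. *)

record 'a cnormed = "(complex, 'a) module" +
  nrm :: "'a \<Rightarrow> real"

record 'a star_alg = "'a cnormed" +
  star :: "'a \<Rightarrow> 'a"

locale complex_banach_space = Module.module "class_ring :: complex ring" V
  for V :: "('a, 'm) cnormed_scheme" (structure) +
  assumes nrm_nonneg: "x \<in> carrier V \<Longrightarrow> 0 \<le> nrm V x"
    and nrm_eq_0_iff: "x \<in> carrier V \<Longrightarrow> nrm V x = 0 \<longleftrightarrow> x = \<zero>"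
    and nrm_triangle: "\<lbrakk>x \<in> carrier V; y \<in> carrier V\<rbrakk> \<Longrightarrow> nrm V (x \<oplus> y) \<le> nrm V x + nrm V y"
    and nrm_smult: "x \<in> carrier V \<Longrightarrow> nrm V (c \<odot>\<^bsub>V\<^esub> x) = cmod c * nrm V x"
    and complete:
      "\<lbrakk>\<And>n. X n \<in> carrier V;
        \<forall>\<epsilon>>0. \<exists>N. \<forall>m\<ge>N. \<forall>n\<ge>N. nrm V (X m \<ominus> X n) < \<epsilon>\<rbrakk>
       \<Longrightarrow> \<exists>x\<in>carrier V. (\<lambda>n. nrm V (X n \<ominus> x)) \<longlonglongrightarrow> 0"


section \<open>Completions\<close>

(* The completion of a normed space: Cauchy sequences modulo null sequences. *)

definition cauchy_seqs :: "('a, 'm) cnormed_scheme \<Rightarrow> (nat \<Rightarrow> 'a) set" where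
  "cauchy_seqs V = {X. (\<forall>n. X n \<in> carrier V) \<and>
     (\<forall>\<epsilon>>0. \<exists>N. \<forall>m\<ge>N. \<forall>n\<ge>N. nrm V (X m \<ominus>\<^bsub>V\<^esub> X n) < \<epsilon>)}"

definition null_rel :: "('a, 'm) cnormed_scheme \<Rightarrow> ((nat \<Rightarrow> 'a) \<times> (nat \<Rightarrow> 'a)) set" where
  "null_rel V = {(X, Y). X \<in> cauchy_seqs V \<and> Y \<in> cauchy_seqs V \<and>
     (\<lambda>n. nrm V (X n \<ominus>\<^bsub>V\<^esub> Y n)) \<longlonglongrightarrow> 0}"

definition cclass :: "('a, 'm) cnormed_scheme \<Rightarrow> (nat \<Rightarrow> 'a) \<Rightarrow> (nat \<Rightarrow> 'a) set" where
  "cclass V X = null_rel V `` {X}"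

definition rep :: "(nat \<Rightarrow> 'a) set \<Rightarrow> nat \<Rightarrow> 'a" where
  "rep P = (SOME X. X \<in> P)"

(* Extension of a map (of one or two arguments) to the completion, computed on representatives; it is
   the continuous extension whenever the map is (multi)linear and bounded. *)

definition lift1 :: "('a, 'm) cnormed_scheme \<Rightarrow> ('a \<Rightarrow> 'a) \<Rightarrow> (nat \<Rightarrow> 'a) set \<Rightarrow> (nat \<Rightarrow> 'a) set" where
  "lift1 V f P = cclass V (\<lambda>n. f (rep P n))"

definition lift2 ::
  "('a, 'm) cnormed_scheme \<Rightarrow> ('a \<Rightarrow> 'a \<Rightarrow> 'a)
    \<Rightarrow> (nat \<Rightarrow> 'a) set \<Rightarrow> (nat \<Rightarrow> 'a) set \<Rightarrow> (nat \<Rightarrow> 'a) set" where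
  "lift2 V f P Q = cclass V (\<lambda>n. f (rep P n) (rep Q n))"

definition completion :: "('a, 'm) cnormed_scheme \<Rightarrow> (nat \<Rightarrow> 'a) set cnormed" where
  "completion V =
    \<lparr>carrier = cauchy_seqs V // null_rel V,
     monoid.mult = undefined,
     one = undefined,
     zero = cclass V (\<lambda>n. \<zero>\<^bsub>V\<^esub>),
     add = lift2 V (add V),
     module.smult = (\<lambda>c. lift1 V (\<lambda>x. c \<odot>\<^bsub>V\<^esub> x)),
     nrm = (\<lambda>P. lim (\<lambda>n. nrm V (rep P n)))\<rparr>"

definition star_completion :: "('a, 'm) star_alg_scheme \<Rightarrow> (nat \<Rightarrow> 'a) set star_alg" where
  "star_completion A =
    cnormed.extend ((completion A)\<lparr>monoid.mult := lift2 A (monoid.mult A)\<rparr>) (star_alg.fields (lift1 A (star A)))"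

definition operator_norm :: "('a, 'm) cnormed_scheme \<Rightarrow> ('a \<Rightarrow> 'a) \<Rightarrow> real" where
  "operator_norm V T = Sup {nrm V (T \<xi>) | \<xi>. \<xi> \<in> carrier V \<and> nrm V \<xi> \<le> 1}"


section \<open>Matrix algebras and completely positive maps\<close>

definition vec_norm2 :: "complex vec \<Rightarrow> real" where
  "vec_norm2 v = sqrt (\<Sum>i<dim_vec v. (cmod (v $ i))\<^sup>2)"

definition mat_norm :: "complex mat \<Rightarrow> real" where
  "mat_norm M = Sup {vec_norm2 (M *\<^sub>v v) | v. v \<in> carrier_vec (dim_col M) \<and> vec_norm2 v \<le> 1}"

definition matrix_algebra :: "nat \<Rightarrow> complex mat star_alg" where
  "matrix_algebra d =
    \<lparr>carrier = carrier_mat d d, monoid.mult = (*), one = 1\<^sub>m d, zero = 0\<^sub>m d d, add = (+),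
     module.smult = (\<cdot>\<^sub>m), nrm = mat_norm, star = mat_adjoint\<rparr>"

definition positive :: "('a, 'm) star_alg_scheme \<Rightarrow> 'a \<Rightarrow> bool" where
  "positive A a \<longleftrightarrow> (\<exists>c\<in>carrier A. a = star A c \<otimes>\<^bsub>A\<^esub> c)"

(* The same notion in the algebra of n-by-n matrices over A: X is of the form C* C, where
   (C* C) i j is the sum over k of (C k i)* (C k j). Matrices are functions of their indices i, j < n. *)

definition matrix_positive ::
  "('a, 'm) star_alg_scheme \<Rightarrow> nat \<Rightarrow> (nat \<Rightarrow> nat \<Rightarrow> 'a) \<Rightarrow> bool" where
  "matrix_positive A n X \<longleftrightarrow>
    (\<exists>C. (\<forall>i<n. \<forall>j<n. C i j \<in> carrier A) \<and>
         (\<forall>i<n. \<forall>j<n. X i j = (\<Oplus>\<^bsub>A\<^esub>k\<in>{..<n}. star A (C k i) \<otimes>\<^bsub>A\<^esub> C k j)))"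

definition completely_positive ::
  "('a, 'm) star_alg_scheme \<Rightarrow> nat \<Rightarrow> ('a \<Rightarrow> complex mat) \<Rightarrow> bool" where
  "completely_positive A d \<phi> \<longleftrightarrow>
    (\<forall>n X. matrix_positive A n X \<longrightarrow> matrix_positive (matrix_algebra d) n (\<lambda>i j. \<phi> (X i j)))"

definition contractive :: "('a, 'm) cnormed_scheme \<Rightarrow> ('a \<Rightarrow> complex mat) \<Rightarrow> bool" where
  "contractive V \<phi> \<longleftrightarrow> (\<forall>x\<in>carrier V. mat_norm (\<phi> x) \<le> nrm V x)"

definition linear_to_mat :: "('a, 'm) cnormed_scheme \<Rightarrow> nat \<Rightarrow> ('a \<Rightarrow> complex mat) \<Rightarrow> bool" where
  "linear_to_mat V d \<phi> \<longleftrightarrow>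
    (\<forall>x\<in>carrier V. \<phi> x \<in> carrier_mat d d) \<and>
    (\<forall>x\<in>carrier V. \<forall>y\<in>carrier V. \<phi> (x \<oplus>\<^bsub>V\<^esub> y) = \<phi> x + \<phi> y) \<and>
    (\<forall>c. \<forall>x\<in>carrier V. \<phi> (c \<odot>\<^bsub>V\<^esub> x) = c \<cdot>\<^sub>m \<phi> x)"


section \<open>MF and QD algebras\<close>

definition alg_approx ::
  "('a, 'm) star_alg_scheme \<Rightarrow> 'a set \<Rightarrow> real \<Rightarrow> nat \<Rightarrow> ('a \<Rightarrow> complex mat) \<Rightarrow> bool" where
  "alg_approx A F \<epsilon> d \<phi> \<longleftrightarrow>
    linear_to_mat A d \<phi> \<and>
    (\<forall>x\<in>F. mat_norm (mat_adjoint (\<phi> x) - \<phi> (star A x)) < \<epsilon>) \<and>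
    (\<forall>x\<in>F. \<forall>y\<in>F. mat_norm (\<phi> (x \<otimes>\<^bsub>A\<^esub> y) - \<phi> x * \<phi> y) < \<epsilon>) \<and>
    (\<forall>x\<in>F. \<bar>mat_norm (\<phi> x) - nrm A x\<bar> < \<epsilon>)"

definition MF_algebra :: "('a, 'm) star_alg_scheme \<Rightarrow> bool" where
  "MF_algebra A \<longleftrightarrow>
    (\<forall>F \<epsilon>. finite F \<and> F \<subseteq> carrier A \<and> 0 < \<epsilon> \<longrightarrow> (\<exists>d\<ge>1. \<exists>\<phi>. alg_approx A F \<epsilon> d \<phi>))"

definition QD_algebra :: "('a, 'm) star_alg_scheme \<Rightarrow> bool" where
  "QD_algebra A \<longleftrightarrow>
    (\<forall>F \<epsilon>. finite F \<and> F \<subseteq> carrier A \<and> 0 < \<epsilon> \<longrightarrow>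
      (\<exists>d\<ge>1. \<exists>\<phi>. alg_approx A F \<epsilon> d \<phi> \<and> completely_positive A d \<phi> \<and> contractive A \<phi>))"


section \<open>Fell bundles\<close>

(* The group is a type of class group_add, Isabelle's class of (not necessarily commutative)
   groups. It is written additively: s + t, - t and 0 stand for st, the inverse of t and e.

   The type 'b contains the total space: the carriers of the fibres are disjoint subsets of it,
   and multiplication and involution act on it. *)

record ('g, 'b) bundle_data =
  fibre :: "'g \<Rightarrow> 'b cnormed"
  bmult :: "'b \<Rightarrow> 'b \<Rightarrow> 'b"
  bstar :: "'b \<Rightarrow> 'b"

definition total_space :: "('g, 'b) bundle_data \<Rightarrow> 'b set" where
  "total_space B = (\<Union>t. carrier (fibre B t))"

definition unit_fibre :: "('g :: group_add, 'b) bundle_data \<Rightarrow> 'b star_alg" where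
  "unit_fibre B = cnormed.extend ((fibre B 0)\<lparr>monoid.mult := bmult B\<rparr>) (star_alg.fields (bstar B))"

locale fell_bundle =
  fixes B :: "('g :: group_add, 'b) bundle_data"
  assumes fibre_banach: "complex_banach_space (fibre B t)"
    and fibres_disjoint: "s \<noteq> t \<Longrightarrow> carrier (fibre B s) \<inter> carrier (fibre B t) = {}"
    and mult_closed:
      "\<lbrakk>a \<in> carrier (fibre B s); b \<in> carrier (fibre B t)\<rbrakk> \<Longrightarrow> bmult B a b \<in> carrier (fibre B (s + t))"
    and mult_add_left:
      "\<lbrakk>a \<in> carrier (fibre B s); a' \<in> carrier (fibre B s); b \<in> carrier (fibre B t)\<rbrakk>
       \<Longrightarrow> bmult B (a \<oplus>\<^bsub>fibre B s\<^esub> a') b = bmult B a b \<oplus>\<^bsub>fibre B (s + t)\<^esub> bmult B a' b"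
    and mult_add_right:
      "\<lbrakk>a \<in> carrier (fibre B s); b \<in> carrier (fibre B t); b' \<in> carrier (fibre B t)\<rbrakk>
       \<Longrightarrow> bmult B a (b \<oplus>\<^bsub>fibre B t\<^esub> b') = bmult B a b \<oplus>\<^bsub>fibre B (s + t)\<^esub> bmult B a b'"
    and mult_smult_left:
      "\<lbrakk>a \<in> carrier (fibre B s); b \<in> carrier (fibre B t)\<rbrakk>
       \<Longrightarrow> bmult B (z \<odot>\<^bsub>fibre B s\<^esub> a) b = z \<odot>\<^bsub>fibre B (s + t)\<^esub> bmult B a b"
    and mult_smult_right:
      "\<lbrakk>a \<in> carrier (fibre B s); b \<in> carrier (fibre B t)\<rbrakk>
       \<Longrightarrow> bmult B a (z \<odot>\<^bsub>fibre B t\<^esub> b) = z \<odot>\<^bsub>fibre B (s + t)\<^esub> bmult B a b"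
    and mult_assoc:
      "\<lbrakk>a \<in> total_space B; b \<in> total_space B; c \<in> total_space B\<rbrakk>
       \<Longrightarrow> bmult B (bmult B a b) c = bmult B a (bmult B b c)"
    and star_closed: "a \<in> carrier (fibre B t) \<Longrightarrow> bstar B a \<in> carrier (fibre B (- t))"
    and star_add:
      "\<lbrakk>a \<in> carrier (fibre B t); b \<in> carrier (fibre B t)\<rbrakk>
       \<Longrightarrow> bstar B (a \<oplus>\<^bsub>fibre B t\<^esub> b) = bstar B a \<oplus>\<^bsub>fibre B (- t)\<^esub> bstar B b"
    and star_smult:
      "a \<in> carrier (fibre B t) \<Longrightarrow> bstar B (z \<odot>\<^bsub>fibre B t\<^esub> a) = cnj z \<odot>\<^bsub>fibre B (- t)\<^esub> bstar B a"
    and star_mult: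
      "\<lbrakk>a \<in> total_space B; b \<in> total_space B\<rbrakk> \<Longrightarrow> bstar B (bmult B a b) = bmult B (bstar B b) (bstar B a)"
    and star_star: "a \<in> total_space B \<Longrightarrow> bstar B (bstar B a) = a"
    and norm_mult:
      "\<lbrakk>a \<in> carrier (fibre B s); b \<in> carrier (fibre B t)\<rbrakk>
       \<Longrightarrow> nrm (fibre B (s + t)) (bmult B a b) \<le> nrm (fibre B s) a * nrm (fibre B t) b"
    and norm_star: "a \<in> carrier (fibre B t) \<Longrightarrow> nrm (fibre B (- t)) (bstar B a) = nrm (fibre B t) a"
    and norm_star_mult:
      "a \<in> carrier (fibre B t) \<Longrightarrow> nrm (fibre B 0) (bmult B (bstar B a) a) = (nrm (fibre B t) a)\<^sup>2"
    and star_mult_positive: "a \<in> total_space B \<Longrightarrow> positive (unit_fibre B) (bmult B (bstar B a) a)"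


section \<open>The reduced cross-sectional algebra\<close>

definition supp :: "('g, 'b) bundle_data \<Rightarrow> ('g \<Rightarrow> 'b) \<Rightarrow> 'g set" where
  "supp B x = {t. x t \<noteq> \<zero>\<^bsub>fibre B t\<^esub>}"

(* The star-algebra of finitely supported sections, equipped with a given norm N. *)

definition sections ::
  "('g :: group_add, 'b) bundle_data \<Rightarrow> (('g \<Rightarrow> 'b) \<Rightarrow> real) \<Rightarrow> ('g \<Rightarrow> 'b) star_alg" where
  "sections B N =
    \<lparr>carrier = {x. (\<forall>t. x t \<in> carrier (fibre B t)) \<and> finite (supp B x)},
     monoid.mult = (\<lambda>x y s. \<Oplus>\<^bsub>fibre B s\<^esub>t\<in>supp B x. bmult B (x t) (y (- t + s))),
     one = undefined,
     zero = (\<lambda>t. \<zero>\<^bsub>fibre B t\<^esub>),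
     add = (\<lambda>x y t. x t \<oplus>\<^bsub>fibre B t\<^esub> y t),
     module.smult = (\<lambda>c x t. c \<odot>\<^bsub>fibre B t\<^esub> x t),
     nrm = N,
     star = (\<lambda>x s. bstar B (x (- s)))\<rparr>"

definition section_inner :: "('g :: group_add, 'b) bundle_data \<Rightarrow> ('g \<Rightarrow> 'b) \<Rightarrow> ('g \<Rightarrow> 'b) \<Rightarrow> 'b" where
  "section_inner B \<xi> \<eta> = (\<Oplus>\<^bsub>fibre B 0\<^esub>t\<in>supp B \<xi>. bmult B (bstar B (\<xi> t)) (\<eta> t))"

definition pre_l2 :: "('g :: group_add, 'b) bundle_data \<Rightarrow> ('g \<Rightarrow> 'b) star_alg" where
  "pre_l2 B = sections B (\<lambda>\<xi>. sqrt (nrm (fibre B 0) (section_inner B \<xi> \<xi>)))"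

(* The Hilbert module l_2(B), as a Banach space; its inner product enters through the norm only. *)

definition l2 :: "('g :: group_add, 'b) bundle_data \<Rightarrow> (nat \<Rightarrow> 'g \<Rightarrow> 'b) set cnormed" where
  "l2 B = completion (pre_l2 B)"

definition lam ::
  "('g :: group_add, 'b) bundle_data \<Rightarrow> 'g \<Rightarrow> 'b \<Rightarrow> (nat \<Rightarrow> 'g \<Rightarrow> 'b) set \<Rightarrow> (nat \<Rightarrow> 'g \<Rightarrow> 'b) set" where
  "lam B s b = lift1 (pre_l2 B) (\<lambda>\<xi> t. bmult B b (\<xi> (- s + t)))"

definition reduced_norm :: "('g :: group_add, 'b) bundle_data \<Rightarrow> ('g \<Rightarrow> 'b) \<Rightarrow> real" where
  "reduced_norm B x = operator_norm (l2 B) (\<lambda>\<xi>. \<Oplus>\<^bsub>l2 B\<^esub>t\<in>supp B x. lam B t (x t) \<xi>)"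

definition reduced_algebra :: "('g :: group_add, 'b) bundle_data \<Rightarrow> (nat \<Rightarrow> 'g \<Rightarrow> 'b) set star_alg" where
  "reduced_algebra B = star_completion (sections B (reduced_norm B))"


section \<open>MF and QD Fell bundles\<close>

definition bundle_approx ::
  "('g :: group_add, 'b) bundle_data \<Rightarrow> 'b set \<Rightarrow> real \<Rightarrow> nat \<Rightarrow> ('g \<Rightarrow> 'b \<Rightarrow> complex mat) \<Rightarrow> bool" where
  "bundle_approx B \<Omega> \<epsilon> d \<phi> \<longleftrightarrow>
    (\<forall>t. linear_to_mat (fibre B t) d (\<phi> t)) \<and>
    (\<forall>t. \<forall>b \<in> \<Omega> \<inter> carrier (fibre B t).
       mat_norm (mat_adjoint (\<phi> t b) - \<phi> (- t) (bstar B b)) < \<epsilon>) \<and>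
    (\<forall>s t. \<forall>a \<in> \<Omega> \<inter> carrier (fibre B s). \<forall>b \<in> \<Omega> \<inter> carrier (fibre B t).
       mat_norm (\<phi> s a * \<phi> t b - \<phi> (s + t) (bmult B a b)) < \<epsilon>) \<and>
    (\<forall>t. \<forall>b \<in> \<Omega> \<inter> carrier (fibre B t). \<bar>mat_norm (\<phi> t b) - nrm (fibre B t) b\<bar> < \<epsilon>)"

definition MF_bundle :: "('g :: group_add, 'b) bundle_data \<Rightarrow> bool" where
  "MF_bundle B \<longleftrightarrow>
    (\<forall>\<epsilon> \<Omega>. 0 < \<epsilon> \<and> finite \<Omega> \<and> \<Omega> \<subseteq> total_space B \<longrightarrow> (\<exists>d\<ge>1. \<exists>\<phi>. bundle_approx B \<Omega> \<epsilon> d \<phi>))"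

definition QD_bundle :: "('g :: group_add, 'b) bundle_data \<Rightarrow> bool" where
  "QD_bundle B \<longleftrightarrow>
    (\<forall>\<epsilon> \<Omega>. 0 < \<epsilon> \<and> finite \<Omega> \<and> \<Omega> \<subseteq> total_space B \<longrightarrow>
      (\<exists>d\<ge>1. \<exists>\<phi>. bundle_approx B \<Omega> \<epsilon> d \<phi> \<and>
        completely_positive (unit_fibre B) d (\<phi> 0) \<and> contractive (unit_fibre B) (\<phi> 0)))"

end

theory Submission
  imports Defs
begin

text \<open>
  The fibre \<open>B\<^sub>t\<close> embeds into \<open>C\<^sup>*\<^sub>\<lambda>(\<B>)\<close> by \<open>b \<mapsto> \<delta>\<^sub>tb\<close>. These embeddings are linear and isometric and
  respect products and adjoints, so the maps \<open>\<phi>\<^sub>t(b) = \<phi>(\<delta>\<^sub>tb)\<close> inherit all estimates from an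
  approximation \<open>\<phi>\<close> of \<open>C\<^sup>*\<^sub>\<lambda>(\<B>)\<close>, and \<open>\<phi>\<^sub>e\<close> inherits complete positivity because \<open>b \<mapsto> \<delta>\<^sub>eb\<close> is a
  *-homomorphism.

  That the operations of the reduced algebra are well defined rests on the Cauchy-Schwarz inequality in
  \<open>\<ell>\<^sub>2(\<B>)\<close>, on \<open>\<parallel>\<lambda>\<^sub>s(b)\<parallel> \<le> \<parallel>b\<parallel>\<close> and hence on the positivity of sums \<open>\<Sum>\<^sub>t \<xi>(t)\<^sup>*\<xi>(t)\<close>. For this no
  spectral theory is used: a self-adjoint \<open>a\<close> is called positive if \<open>\<parallel>t - a\<parallel> \<le> t\<close> for some \<open>t \<ge> 0\<close>, where
  elements act on the fibres by left multiplication. Square roots are replaced by polynomials that come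
  from the iteration \<open>v \<leadsto> (p + v\<^sup>2)/2\<close>, which approximates \<open>1 - \<surd>(1 - p)\<close>.
\<close>

section \<open>Seminorms on real polynomials with the C*-property\<close>

text \<open>The obstacle is order. The axiom \<open>star_mult_positive\<close> only yields b*b = c*c
  with c in the unit fibre, and a sum of such elements is not visibly of this form. Positivity is
  therefore given by an estimate whose witnesses t add up; the price is Kaplansky's theorem, which
  shows that c*c is positive in this sense. The unit fibre need not have a unit, so 1 - a exists
  only as an operator. It acts on all fibres at once, because the estimate for lambda_s(b) applies
  polynomials of b*b to the values x(t), which lie in different fibres. As only approximate square
  roots are at hand, inequalities are shown first for strict contractions and up to an error; the
  error then tends to 0 and rescaling gives the general case. Finally, completions compute with
  representatives chosen by \<open>SOME\<close> and norms are suprema of sets of reals: the former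
  become usable through Lipschitz estimates, the latter through bounds on these sets.\<close>

text \<open>The model is N p = ||p(a)|| for a self-adjoint a. \<open>square_add\<close> packs the
  C*-identity and the monotonicity of the norm on positive elements into one inequality, from which
  the order properties of squares are drawn.\<close>

locale poly_seminorm =
  fixes N :: "real poly \<Rightarrow> real"
  assumes triangle: "N (p + q) \<le> N p + N q"
    and smult: "N (smult c p) = \<bar>c\<bar> * N p"
    and mult: "N (p * q) \<le> N p * N q"
    and one: "N 1 \<le> 1"
    and square_add: "(N p)\<^sup>2 \<le> N (p * p + q * q)"
begin

lemma zero [simp]: "N 0 = 0"
  using smult[of 0 0] by simp

lemma uminus [simp]: "N (- p) = N p"
  using smult[of "-1" p] by simp

lemma nonneg [simp]: "0 \<le> N p"
  using triangle[of p "- p"] by simp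

lemma triangle_diff: "N (p - q) \<le> N p + N q"
  using triangle[of p "- q"] by simp

lemma square_le: "N p * N p \<le> N (p * p)"
  using square_add[of p 0] by (simp add: power2_eq_square)

lemma const_le: "N [:c:] \<le> \<bar>c\<bar>"
proof -
  have "N [:c:] = \<bar>c\<bar> * N 1" using smult[of c 1] by simp
  also have "\<dots> \<le> \<bar>c\<bar> * 1" by (intro mult_left_mono one) auto
  finally show ?thesis by simp
qed

text \<open>A fixed point v of v = (p + v^2)/2 satisfies (1 - v)^2 = 1 - p. Polynomials carry no
  completeness, so the iteration is stopped at a suitable n and w = 1 - v_n is taken.\<close>

lemma approx_sqrt_one_minus:
  assumes "N p < 1" "0 < \<epsilon>"
  shows "\<exists>w. N (1 - p - w * w) < \<epsilon>"
proof -
  define r where "r = N p"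
  \<comment> \<open>The fixed point of the same iteration for the scalar r = N p. It bounds every
    iterate and, being below 1, is also the contraction factor.\<close>
  define \<rho> where "\<rho> = 1 - sqrt (1 - r)"
  have r: "0 \<le> r" "r < 1" using assms by (auto simp: r_def)
  have \<rho>: "0 \<le> \<rho>" "\<rho> < 1" using r by (auto simp: \<rho>_def)
  have fixpoint: "(r + \<rho> * \<rho>) / 2 = \<rho>"
  proof -
    have "sqrt (1 - r) * sqrt (1 - r) = 1 - r" using r by simp
    then have "(1 - sqrt (1 - r)) * (1 - sqrt (1 - r)) = 1 - 2 * sqrt (1 - r) + (1 - r)"
      by (simp add: algebra_simps)
    then show ?thesis unfolding \<rho>_def by argo
  qed
  define v where "v = rec_nat 0 (\<lambda>_ u. smult (1/2) (p + u * u))"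
  have v0: "v 0 = 0" and vS: "v (Suc n) = smult (1/2) (p + v n * v n)" for n
    by (simp_all add: v_def)
  have vb: "N (v n) \<le> \<rho>" for n
  proof (induction n)
    case 0
    then show ?case using \<rho> by (simp add: v0)
  next
    case (Suc n)
    have "N (v n * v n) \<le> \<rho> * \<rho>"
      using mult[of "v n" "v n"] mult_mono[OF Suc Suc \<rho>(1) nonneg] by linarith
    then have "N (p + v n * v n) \<le> r + \<rho> * \<rho>"
      using triangle[of p "v n * v n"] by (simp add: r_def)
    then show ?case using fixpoint by (simp add: vS smult)
  qed
  have step: "N (v (Suc n) - v n) \<le> \<rho> ^ n * r" for n
  proof (induction n)
    case 0
    then show ?case by (simp add: v0 vS smult r_def)
  next
    case (Suc n)
    have "v (Suc (Suc n)) - v (Suc n) = smult (1/2) ((v (Suc n) - v n) * (v (Suc n) + v n))"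
    proof (intro poly_eq_poly_eq_iff[THEN iffD1] ext)
      fix x
      have "2 * poly (v (Suc n)) x = poly p x + poly (v n) x * poly (v n) x"
        "2 * poly (v (Suc (Suc n))) x = poly p x + poly (v (Suc n)) x * poly (v (Suc n)) x"
        by (simp_all add: vS)
      then show "poly (v (Suc (Suc n)) - v (Suc n)) x
          = poly (smult (1/2) ((v (Suc n) - v n) * (v (Suc n) + v n))) x"
        by (simp add: algebra_simps)
    qed
    then have "N (v (Suc (Suc n)) - v (Suc n)) = N ((v (Suc n) - v n) * (v (Suc n) + v n)) / 2"
      by (simp add: smult)
    also have "\<dots> \<le> (N (v (Suc n) - v n) * N (v (Suc n) + v n)) / 2"
      using mult by (simp add: divide_right_mono)
    also have "\<dots> \<le> (\<rho> ^ n * r * (2 * \<rho>)) / 2"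
      using triangle[of "v (Suc n)" "v n"] vb[of n] vb[of "Suc n"] r \<rho>
      by (intro divide_right_mono mult_mono Suc) auto
    finally show ?case by (simp add: algebra_simps)
  qed
  have "(\<lambda>n. 2 * (\<rho> ^ n * r)) \<longlonglongrightarrow> 2 * (0 * r)"
    using \<rho> by (intro tendsto_intros LIMSEQ_power_zero) auto
  then have "eventually (\<lambda>n. 2 * (\<rho> ^ n * r) < \<epsilon>) sequentially"
    using assms(2) by (intro order_tendstoD(2)) auto
  then obtain n where n: "2 * (\<rho> ^ n * r) < \<epsilon>"
    by (auto simp: eventually_sequentially)
  \<comment> \<open>The defect of the square root is a multiple of the next increment, so the
    geometric decay of the increments suffices and no limit is formed.\<close>
  have "1 - p - (1 - v n) * (1 - v n) = smult (- 2) (v (Suc n) - v n)"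
    by (intro poly_eq_poly_eq_iff[THEN iffD1] ext) (simp add: vS field_simps)
  then have "N (1 - p - (1 - v n) * (1 - v n)) = 2 * N (v (Suc n) - v n)"
    by (simp add: smult)
  then show ?thesis using step[of n] n by (intro exI[of _ "1 - v n"]) linarith
qed

text \<open>For a real function, |t - p| <= t everywhere means 0 <= p <= 2t. This form of
  nonnegativity needs no spectrum.\<close>

definition psd :: "real poly \<Rightarrow> bool" where
  "psd p \<longleftrightarrow> (\<exists>t\<ge>0. N ([:t:] - p) \<le> t)"

lemma psd_approx_square:
  assumes "psd p" "0 < \<epsilon>"
  shows "\<exists>w. N (p - w * w) < \<epsilon>"
proof -
  obtain t where t: "0 \<le> t" "N ([:t:] - p) \<le> t" using assms by (auto simp: psd_def)
  \<comment> \<open>Enlarging t makes (t - p)/s a strict contraction, as the square root iteration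
    requires. The price is the constant \<epsilon>/2, which leaves \<epsilon>/(2s) for the accuracy
    of w.\<close>
  define s where "s = t + \<epsilon> / 2"
  have s: "0 < s" "t < s" using t assms by (auto simp: s_def)
  define q where "q = smult (1 / s) ([:t:] - p)"
  have "N q = N ([:t:] - p) / s" using s by (simp add: q_def smult)
  also have "\<dots> < 1" using t s by simp
  finally have "N q < 1" .
  moreover have "0 < \<epsilon> / (2 * s)" using assms s by simp
  ultimately obtain w where w: "N (1 - q - w * w) < \<epsilon> / (2 * s)"
    using approx_sqrt_one_minus by blast
  define u where "u = smult (sqrt s) w"
  have "p - u * u = smult s (1 - q - w * w) - [:\<epsilon> / 2:]"
    using s by (intro poly_eq_poly_eq_iff[THEN iffD1] ext)
      (simp add: u_def q_def field_simps s_def)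
  then have "N (p - u * u) \<le> s * N (1 - q - w * w) + \<epsilon> / 2"
    using triangle_diff[of "smult s (1 - q - w * w)" "[:\<epsilon> / 2:]"] const_le[of "\<epsilon> / 2"] s assms
    by (simp add: smult)
  also have "\<dots> < s * (\<epsilon> / (2 * s)) + \<epsilon> / 2"
    using w s by (intro add_strict_right_mono mult_strict_left_mono) auto
  also have "\<dots> = \<epsilon>" using s by (simp add: field_simps)
  finally show ?thesis by blast
qed

text \<open>With g = h / sqrt s and w^2 close to 1 - g^2, the sum w^2 + g^2 is close to 1, and
  \<open>square_add\<close> bounds (N w)^2 by its seminorm. Hence N (1 - g^2) exceeds 1 by
  arbitrarily little. The case s > t comes first because the square root needs N (g^2) < 1.\<close>

lemma square_bound:
  assumes "N (h * h) \<le> t"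
  shows "N ([:t:] - h * h) \<le> t"
proof -
  have strict: "N ([:s:] - h * h) \<le> s" if s: "t < s" for s
  proof (rule field_le_epsilon)
    fix e :: real assume e: "0 < e"
    have s0: "0 < s" using assms s nonneg[of "h * h"] by linarith
    define q where "q = smult (1 / s) (h * h)"
    have "N q < 1" using assms s s0 by (simp add: q_def smult)
    then obtain w where w: "N (1 - q - w * w) < e / (2 * s)"
      using approx_sqrt_one_minus[of q "e / (2 * s)"] e s0 by auto
    define g where "g = smult (1 / sqrt s) h"
    have gg: "g * g = q" using s0 by (simp add: g_def q_def)
    have "N (w * w) \<le> (N w)\<^sup>2" using mult[of w w] by (simp add: power2_eq_square)
    also have "\<dots> \<le> N (w * w + g * g)" by (rule square_add)
    also have "w * w + g * g = 1 - (1 - q - w * w)" by (simp add: gg)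
    also have "N \<dots> \<le> 1 + N (1 - q - w * w)"
      using triangle_diff[of 1 "1 - q - w * w"] one by linarith
    finally have "N (w * w) \<le> 1 + N (1 - q - w * w)" .
    moreover have "N (1 - q) \<le> N (1 - q - w * w) + N (w * w)"
      using triangle[of "1 - q - w * w" "w * w"] by simp
    ultimately have *: "N (1 - q) \<le> 1 + e / s" using w by (simp add: field_simps)
    have "[:s:] - h * h = smult s (1 - q)"
      using s0 by (intro poly_eq_poly_eq_iff[THEN iffD1] ext) (simp add: q_def field_simps)
    then have "N ([:s:] - h * h) = s * N (1 - q)" using s0 by (simp add: smult)
    also have "\<dots> \<le> s * (1 + e / s)" using * s0 by (intro mult_left_mono) auto
    also have "\<dots> = s + e" using s0 by (simp add: field_simps)
    finally show "N ([:s:] - h * h) \<le> s + e" .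
  qed
  show ?thesis
  proof (rule field_le_epsilon)
    fix e :: real assume e: "0 < e"
    have "[:t:] - h * h = ([:t + e / 2:] - h * h) - [:e / 2:]" by simp
    then have "N ([:t:] - h * h) \<le> N ([:t + e / 2:] - h * h) + N [:e / 2:]"
      using triangle_diff by metis
    then show "N ([:t:] - h * h) \<le> t + e"
      using strict[of "t + e / 2"] const_le[of "e / 2"] e by simp
  qed
qed

lemma psd_square: "psd (h * h)"
  unfolding psd_def using square_bound[OF order_refl] nonneg by blast

lemma psd_add:
  assumes "psd p" "psd q"
  shows "psd (p + q)"
proof -
  obtain s t where st: "0 \<le> s" "N ([:s:] - p) \<le> s" "0 \<le> t" "N ([:t:] - q) \<le> t"
    using assms by (auto simp: psd_def)
  have "[:s + t:] - (p + q) = ([:s:] - p) + ([:t:] - q)"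
    by (intro poly_eq_poly_eq_iff[THEN iffD1] ext) simp
  then have "N ([:s + t:] - (p + q)) \<le> s + t"
    using triangle[of "[:s:] - p" "[:t:] - q"] st by (smt (verit))
  then show ?thesis using st unfolding psd_def by (intro exI[of _ "s + t"]) simp
qed

lemma psd_0: "psd 0"
  using psd_square[of 0] by simp

lemma psd_sum: "(\<And>i. i \<in> I \<Longrightarrow> psd (f i)) \<Longrightarrow> psd (\<Sum>i\<in>I. f i)"
  by (induction I rule: infinite_finite_induct) (auto intro: psd_add psd_0)

text \<open>Reduces to squares: p is close to some w^2, and g^2 w^2 = (g w)^2.\<close>

lemma psd_square_mult:
  assumes "psd p"
  shows "psd (g * g * p)"
proof -
  define c where "c = N (g * g)"
  \<comment> \<open>One witness for all accuracies e: N (w^2) <= N p + 1 as soon as the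
    approximation error is at most 1, so t does not depend on e and survives the limit.\<close>
  define t where "t = c * (N p + 1)"
  have c: "0 \<le> c" by (simp add: c_def)
  have "N ([:t:] - g * g * p) \<le> t + e" if e: "0 < e" for e
  proof -
    define d where "d = min 1 (e / (c + 1))"
    have "d \<le> e / (c + 1)" by (simp add: d_def)
    then have d2: "d * (c + 1) \<le> e" using c by (simp add: pos_le_divide_eq)
    have d: "0 < d" "d \<le> 1" using e c by (auto simp: d_def)
    obtain w where w: "N (p - w * w) < d" using psd_approx_square[OF assms d(1)] by auto
    have "N (w * w) \<le> N p + 1"
      using triangle_diff[of p "p - w * w"] w d by simp
    then have "N (g * g * (w * w)) \<le> t"
      using mult[of "g * g" "w * w"] mult_left_mono[of "N (w * w)" "N p + 1" c] c
      by (simp add: c_def t_def)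
    moreover have gw: "(g * w) * (g * w) = g * g * (w * w)" by (simp add: algebra_simps)
    ultimately have "N ([:t:] - (g * w) * (g * w)) \<le> t"
      by (intro square_bound) (simp only: gw)
    moreover have "[:t:] - g * g * p = ([:t:] - (g * w) * (g * w)) - (g * g) * (p - w * w)"
      by (simp add: algebra_simps)
    moreover have "N ((g * g) * (p - w * w)) \<le> c * d"
      using mult[of "g * g" "p - w * w"] mult_left_mono[of "N (p - w * w)" d c] c w
      by (simp add: c_def)
    moreover have "c * d \<le> e" using d d2 by (simp add: algebra_simps)
    ultimately show ?thesis
      using triangle_diff[of "[:t:] - (g * w) * (g * w)" "(g * g) * (p - w * w)"] by (smt (verit))
  qed
  then have "N ([:t:] - g * g * p) \<le> t" by (rule field_le_epsilon)
  then show ?thesis unfolding psd_def using c by (intro exI[of _ t]) (simp add: t_def)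
qed

text \<open>Let h^2 and w^2 approximate p and s - p. Up to errors, N p <= (N h)^2 <= N (h^2 + w^2)
  <= s, where the middle step is \<open>square_add\<close>.\<close>

lemma psd_le:
  assumes "psd p" "psd ([:s:] - p)" "0 \<le> s"
  shows "N p \<le> s"
proof (rule field_le_epsilon)
  fix e :: real assume e: "0 < e"
  obtain h where h: "N (p - h * h) < e / 3" using psd_approx_square[OF assms(1), of "e / 3"] e by auto
  obtain w where w: "N ([:s:] - p - w * w) < e / 3" using psd_approx_square[OF assms(2), of "e / 3"] e by auto
  have "N p \<le> N h * N h + e / 3"
    using triangle[of "p - h * h" "h * h"] mult[of h h] h by simp
  also have "N h * N h \<le> N (h * h + w * w)"
    using square_add[of h w] by (simp add: power2_eq_square)
  also have "h * h + w * w = [:s:] - ((p - h * h) + ([:s:] - p - w * w))"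
    by (intro poly_eq_poly_eq_iff[THEN iffD1] ext) simp
  also have "N \<dots> \<le> s + (e / 3 + e / 3)"
    using triangle_diff[of "[:s:]" "(p - h * h) + ([:s:] - p - w * w)"]
      triangle[of "p - h * h" "[:s:] - p - w * w"] const_le[of s] h w assms(3) by simp
  finally show "N p \<le> s + e" by simp
qed

text \<open>Repeated squaring gives the lower bound only for exponents 2^j. A general n is completed
  to 2^n, and the surplus factor N z ^ k, being positive, is cancelled.\<close>

lemma power_eq:
  assumes "0 < N z" "0 < n"
  shows "N (z ^ n) = N z ^ n"
proof (rule antisym)
  have le: "N (z ^ k) \<le> N z ^ k" for k
  proof (induction k)
    case (Suc k)
    then show ?case using mult[of z "z ^ k"] mult_left_mono[OF Suc nonneg[of z]] by simp
  qed (use one in simp)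
  then show "N (z ^ n) \<le> N z ^ n" .
  have ge: "N z ^ (2 ^ j) \<le> N (z ^ (2 ^ j))" for j
  proof (induction j)
    case (Suc j)
    have "N z ^ (2 ^ Suc j) = N z ^ (2 ^ j) * N z ^ (2 ^ j)" by (simp add: mult_2 power_add)
    also have "\<dots> \<le> N (z ^ (2 ^ j)) * N (z ^ (2 ^ j))" by (intro mult_mono Suc) auto
    also have "\<dots> \<le> N (z ^ (2 ^ Suc j))"
      using square_le[of "z ^ (2 ^ j)"] by (simp add: mult_2 power_add)
    finally show ?case .
  qed simp
  define k where "k = 2 ^ n - n"
  have k: "2 ^ n = n + k" using less_exp[of n] by (simp add: k_def)
  have "N z ^ n * N z ^ k \<le> N (z ^ n * z ^ k)"
    using ge[of n] unfolding k by (simp add: power_add)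
  also have "\<dots> \<le> N (z ^ n) * N z ^ k"
    using mult[of "z ^ n" "z ^ k"] mult_left_mono[OF le[of k] nonneg[of "z ^ n"]] by linarith
  finally show "N z ^ n \<le> N (z ^ n)" using assms by simp
qed

text \<open>The polynomial equals (z - 1)(z^n - 1) + z, and the product is the sum of (z - 1)^2 z^i
  over i < n. For z = 1 - X it says X (1 - X)^n <= 1, the upper bound needed in Kaplansky's
  theorem.\<close>

lemma psd_power:
  assumes "psd z"
  shows "psd (1 - z ^ n + z ^ Suc n)"
proof -
  \<comment> \<open>Induction in steps of two, absorbing z^2 into g^2, so g must vary. The exponent
    1 is where z >= 0 enters.\<close>
  have "psd (g * g * z ^ i)" for g i
  proof (induction i arbitrary: g rule: nat_less_induct)
    case (1 i)
    consider "i = 0" | "i = 1" | j where "i = Suc (Suc j)"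
      by (metis One_nat_def old.nat.exhaust)
    then show ?case
    proof cases
      case 3
      then have "g * g * z ^ i = (g * z) * (g * z) * z ^ j" by (simp add: algebra_simps)
      then show ?thesis using 1 3 by (metis less_Suc_eq)
    qed (use psd_square psd_square_mult[OF assms] in auto)
  qed
  then have "psd ((\<Sum>i<n. (z - 1) * (z - 1) * z ^ i) + z)"
    by (intro psd_add psd_sum assms)
  moreover have "(\<Sum>i<n. (z - 1) * (z - 1) * z ^ i) = (z - 1) * (z ^ n - 1)"
    by (simp add: power_diff_1_eq mult.assoc flip: sum_distrib_left)
  moreover have "(z - 1) * (z ^ n - 1) + z = 1 - z ^ n + z ^ Suc n"
    by (simp add: algebra_simps)
  ultimately show ?thesis by simp
qed

end

section \<open>The C*-algebra of a Fell bundle\<close>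

lemma class_ring_simps':
  "carrier class_ring = UNIV" "add (class_ring :: complex ring) = (+)"
  "monoid.mult (class_ring :: complex ring) = (*)" "one (class_ring :: complex ring) = 1"
  "zero (class_ring :: complex ring) = 0"
  by (simp_all add: class_ring_simps)

text \<open>Covers the fibres as well as the finitely supported sections under the l_2 norm and
  under the reduced norm, so completions are treated once for both section norms.\<close>

locale seminormed_module = Module.module "class_ring :: complex ring" V
  for V :: "('a, 'm) cnormed_scheme" (structure) +
  assumes seminorm_nonneg: "x \<in> carrier V \<Longrightarrow> 0 \<le> nrm V x"
    and seminorm_triangle:
      "\<lbrakk>x \<in> carrier V; y \<in> carrier V\<rbrakk> \<Longrightarrow> nrm V (x \<oplus> y) \<le> nrm V x + nrm V y"
    and seminorm_smult: "x \<in> carrier V \<Longrightarrow> nrm V (c \<odot>\<^bsub>V\<^esub> x) = cmod c * nrm V x"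
begin

lemma scale_closed [simp]: "x \<in> carrier V \<Longrightarrow> c \<odot>\<^bsub>V\<^esub> x \<in> carrier V"
  using smult_closed by (simp add: class_ring_simps')

lemma scale_left_distrib:
  "x \<in> carrier V \<Longrightarrow> (c + d) \<odot>\<^bsub>V\<^esub> x = c \<odot>\<^bsub>V\<^esub> x \<oplus> d \<odot>\<^bsub>V\<^esub> x"
  using smult_l_distr[of c d x] by (simp add: class_ring_simps')

lemma scale_right_distrib:
  "\<lbrakk>x \<in> carrier V; y \<in> carrier V\<rbrakk> \<Longrightarrow> c \<odot>\<^bsub>V\<^esub> (x \<oplus> y) = c \<odot>\<^bsub>V\<^esub> x \<oplus> c \<odot>\<^bsub>V\<^esub> y"
  using smult_r_distr[of c x y] by (simp add: class_ring_simps')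

lemma scale_scale: "x \<in> carrier V \<Longrightarrow> c \<odot>\<^bsub>V\<^esub> (d \<odot>\<^bsub>V\<^esub> x) = (c * d) \<odot>\<^bsub>V\<^esub> x"
  using smult_assoc1[of c d x] by (simp add: class_ring_simps')

lemma scale_one [simp]: "x \<in> carrier V \<Longrightarrow> 1 \<odot>\<^bsub>V\<^esub> x = x"
  using smult_one[of x] by (simp add: class_ring_simps')

lemma scale_zero_left [simp]: "x \<in> carrier V \<Longrightarrow> 0 \<odot>\<^bsub>V\<^esub> x = \<zero>"
  using smult_l_null[of x] by (simp add: class_ring_simps')

lemma scale_zero_right [simp]: "c \<odot>\<^bsub>V\<^esub> \<zero> = \<zero>"
  using smult_r_null[of c] by (simp add: class_ring_simps')

lemma nrm_zero [simp]: "nrm V \<zero> = 0"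
  using seminorm_smult[of \<zero> 0] by simp

lemma minus_eq_scale: "x \<in> carrier V \<Longrightarrow> \<ominus> x = (-1) \<odot>\<^bsub>V\<^esub> x"
proof -
  assume x: "x \<in> carrier V"
  have "(-1) \<odot>\<^bsub>V\<^esub> x \<oplus> x = \<zero>"
    using scale_left_distrib[OF x, of "-1" 1] x by simp
  then show ?thesis using x minus_equality by simp
qed

lemma diff_eq_scale: "\<lbrakk>x \<in> carrier V; y \<in> carrier V\<rbrakk> \<Longrightarrow> x \<ominus> y = x \<oplus> (-1) \<odot>\<^bsub>V\<^esub> y"
  by (simp add: a_minus_def minus_eq_scale)

text \<open>Differences are written as sums with (-1)-multiples so that AC rewriting applies. It
  cannot cancel; this rule removes one pair at a time from a sum arranged in this shape.\<close>

lemma cancel_scale: "\<lbrakk>x \<in> carrier V; y \<in> carrier V\<rbrakk> \<Longrightarrow> x \<oplus> ((-1) \<odot>\<^bsub>V\<^esub> x \<oplus> y) = y"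
  using minus_eq_scale r_neg2 by metis

end

sublocale complex_banach_space \<subseteq> seminormed_module
  by unfold_locales (rule nrm_nonneg nrm_triangle nrm_smult; assumption)+

context fell_bundle
begin

abbreviation F where "F \<equiv> fibre B"
abbreviation mul (infixl \<open>\<diamondop>\<close> 70) where "a \<diamondop> b \<equiv> bmult B a b"
abbreviation adj where "adj \<equiv> bstar B"

sublocale fb: complex_banach_space "fibre B t" for t
  by (rule fibre_banach)

lemmas fb_ac = fb.a_assoc fb.a_comm fb.a_lcomm

lemma total_spaceI [intro]: "a \<in> carrier (F t) \<Longrightarrow> a \<in> total_space B"
  by (auto simp: total_space_def)

lemma mult_closed' [simp]:
  "\<lbrakk>a \<in> carrier (F s); b \<in> carrier (F t); r = s + t\<rbrakk> \<Longrightarrow> a \<diamondop> b \<in> carrier (F r)"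
  using mult_closed by simp

lemma mult_closed0 [simp]:
  "\<lbrakk>a \<in> carrier (F 0); b \<in> carrier (F t)\<rbrakk> \<Longrightarrow> a \<diamondop> b \<in> carrier (F t)"
  by (rule mult_closed'[of a 0 b t]) auto

lemma star_closed' [simp]: "\<lbrakk>a \<in> carrier (F s); r = - s\<rbrakk> \<Longrightarrow> adj a \<in> carrier (F r)"
  using star_closed by simp

lemma star_closed0 [simp]: "a \<in> carrier (F 0) \<Longrightarrow> adj a \<in> carrier (F 0)"
  by (rule star_closed'[of a 0]) auto

lemma star_star' [simp]: "a \<in> carrier (F t) \<Longrightarrow> adj (adj a) = a"
  by (rule star_star) auto

lemma star_mult':
  "\<lbrakk>a \<in> carrier (F s); b \<in> carrier (F t)\<rbrakk> \<Longrightarrow> adj (a \<diamondop> b) = adj b \<diamondop> adj a"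
  by (rule star_mult) auto

lemma assoc:
  "\<lbrakk>a \<in> carrier (F r); b \<in> carrier (F s); c \<in> carrier (F t)\<rbrakk> \<Longrightarrow> a \<diamondop> b \<diamondop> c = a \<diamondop> (b \<diamondop> c)"
  by (rule mult_assoc) auto

lemma mult_zero_right [simp]: "\<lbrakk>a \<in> carrier (F s)\<rbrakk> \<Longrightarrow> a \<diamondop> \<zero>\<^bsub>F t\<^esub> = \<zero>\<^bsub>F (s + t)\<^esub>"
  using mult_smult_right[of a s "\<zero>\<^bsub>F t\<^esub>" t 0] mult_closed[of a s "\<zero>\<^bsub>F t\<^esub>" t] by simp

lemma mult_zero_left [simp]: "\<lbrakk>a \<in> carrier (F s)\<rbrakk> \<Longrightarrow> \<zero>\<^bsub>F t\<^esub> \<diamondop> a = \<zero>\<^bsub>F (t + s)\<^esub>"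
  using mult_smult_left[of "\<zero>\<^bsub>F t\<^esub>" t a s 0] mult_closed[of "\<zero>\<^bsub>F t\<^esub>" t a s] by simp

lemma star_zero [simp]: "adj \<zero>\<^bsub>F t\<^esub> = \<zero>\<^bsub>F (- t)\<^esub>"
  using star_smult[of "\<zero>\<^bsub>F t\<^esub>" t 0] star_closed[of "\<zero>\<^bsub>F t\<^esub>" t] by simp

lemma nrm_mult0:
  "\<lbrakk>a \<in> carrier (F 0); b \<in> carrier (F t)\<rbrakk> \<Longrightarrow> nrm (F t) (a \<diamondop> b) \<le> nrm (F 0) a * nrm (F t) b"
  using norm_mult[of a 0 b t] by simp

lemma mult0_add_right:
  "\<lbrakk>a \<in> carrier (F 0); b \<in> carrier (F t); c \<in> carrier (F t)\<rbrakk>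
    \<Longrightarrow> a \<diamondop> (b \<oplus>\<^bsub>F t\<^esub> c) = a \<diamondop> b \<oplus>\<^bsub>F t\<^esub> a \<diamondop> c"
  using mult_add_right[of a 0 b t c] by simp

lemma mult0_add_left:
  "\<lbrakk>a \<in> carrier (F 0); c \<in> carrier (F 0); b \<in> carrier (F t)\<rbrakk>
    \<Longrightarrow> (a \<oplus>\<^bsub>F 0\<^esub> c) \<diamondop> b = a \<diamondop> b \<oplus>\<^bsub>F t\<^esub> c \<diamondop> b"
  using mult_add_left[of a 0 c b t] by simp

lemma mult0_scale_right:
  "\<lbrakk>a \<in> carrier (F 0); b \<in> carrier (F t)\<rbrakk> \<Longrightarrow> a \<diamondop> (z \<odot>\<^bsub>F t\<^esub> b) = z \<odot>\<^bsub>F t\<^esub> (a \<diamondop> b)"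
  using mult_smult_right[of a 0 b t z] by simp

lemma mult0_scale_left:
  "\<lbrakk>a \<in> carrier (F 0); b \<in> carrier (F t)\<rbrakk> \<Longrightarrow> (z \<odot>\<^bsub>F 0\<^esub> a) \<diamondop> b = z \<odot>\<^bsub>F t\<^esub> (a \<diamondop> b)"
  using mult_smult_left[of a 0 b t z] by simp

lemmas mult0_simps = mult0_add_right mult0_add_left mult0_scale_right mult0_scale_left


subsection \<open>Polynomials of an element of the unit fibre\<close>

text \<open>Horner's scheme for p(a) x with x in the fibre over t. Applying p(a) to a vector gives
  the constant term a meaning although the unit fibre need not have a unit.\<close>

definition ev :: "'g \<Rightarrow> 'b \<Rightarrow> real poly \<Rightarrow> 'b \<Rightarrow> 'b" where
  "ev t a p x = fold_coeffs (\<lambda>r v. of_real r \<odot>\<^bsub>F t\<^esub> x \<oplus>\<^bsub>F t\<^esub> a \<diamondop> v) p \<zero>\<^bsub>F t\<^esub>"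

context
  fixes a
  assumes a: "a \<in> carrier (F 0)"
begin

lemma ev_0 [simp]: "ev t a 0 x = \<zero>\<^bsub>F t\<^esub>"
  by (simp add: ev_def)

lemma ev_pCons:
  assumes "x \<in> carrier (F t)"
  shows "ev t a (pCons r p) x = of_real r \<odot>\<^bsub>F t\<^esub> x \<oplus>\<^bsub>F t\<^esub> a \<diamondop> ev t a p x"
  using assms a by (cases "p = 0 \<and> r = 0") (auto simp: ev_def fold_coeffs_def)

lemma ev_closed [simp]:
  assumes "x \<in> carrier (F t)"
  shows "ev t a p x \<in> carrier (F t)"
  by (induction p) (use a assms in \<open>auto simp: ev_pCons\<close>)

lemma ev_const: "x \<in> carrier (F t) \<Longrightarrow> ev t a [:r:] x = of_real r \<odot>\<^bsub>F t\<^esub> x"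
  using a by (simp add: ev_pCons)

lemma ev_linear:
  "x \<in> carrier (F t) \<Longrightarrow> ev t a [:r, s:] x = of_real r \<odot>\<^bsub>F t\<^esub> x \<oplus>\<^bsub>F t\<^esub> of_real s \<odot>\<^bsub>F t\<^esub> (a \<diamondop> x)"
  using a by (simp add: ev_pCons mult0_simps)

lemma ev_1 [simp]: "x \<in> carrier (F t) \<Longrightarrow> ev t a 1 x = x"
  using ev_const[of x t 1] by (simp add: pCons_one)

lemma ev_X [simp]: "x \<in> carrier (F t) \<Longrightarrow> ev t a [:0, 1:] x = a \<diamondop> x"
  using ev_linear[of x t 0 1] a by simp

lemma ev_add:
  assumes "x \<in> carrier (F t)"
  shows "ev t a (p + q) x = ev t a p x \<oplus>\<^bsub>F t\<^esub> ev t a q x"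
  by (induction p q rule: poly_induct2)
    (use a assms in \<open>auto simp: ev_pCons mult0_simps fb.scale_left_distrib fb_ac\<close>)

lemma ev_smult:
  assumes "x \<in> carrier (F t)"
  shows "ev t a (smult c p) x = of_real c \<odot>\<^bsub>F t\<^esub> ev t a p x"
  by (induction p)
    (use a assms in \<open>auto simp: ev_pCons mult0_simps fb.scale_right_distrib fb.scale_scale\<close>)

lemma ev_diff:
  assumes "x \<in> carrier (F t)"
  shows "ev t a (p - q) x = ev t a p x \<oplus>\<^bsub>F t\<^esub> (-1) \<odot>\<^bsub>F t\<^esub> ev t a q x"
  using ev_add[OF assms, of p "smult (-1) q"] ev_smult[OF assms, of "-1" q] by simp

lemma ev_scale_arg:
  assumes "x \<in> carrier (F t)"
  shows "ev t a p (c \<odot>\<^bsub>F t\<^esub> x) = c \<odot>\<^bsub>F t\<^esub> ev t a p x"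
  by (induction p)
    (use a assms in \<open>auto simp: ev_pCons mult0_simps fb.scale_right_distrib fb.scale_scale mult.commute\<close>)

lemma ev_mult:
  assumes "x \<in> carrier (F t)"
  shows "ev t a (p * q) x = ev t a p (ev t a q x)"
  by (induction p)
    (use a assms in \<open>auto simp: ev_pCons ev_add ev_smult\<close>)

lemma ev_commute:
  assumes "x \<in> carrier (F t)"
  shows "a \<diamondop> ev t a p x = ev t a p (a \<diamondop> x)"
  using ev_mult[OF assms, of "[:0, 1:]" p] ev_mult[OF assms, of p "[:0, 1:]"] assms a
  by (simp add: mult.commute)

lemma ev_mult_right:
  assumes "x \<in> carrier (F s)" "y \<in> carrier (F t)"
  shows "ev s a p x \<diamondop> y = ev (s + t) a p (x \<diamondop> y)"
proof (induction p)
  case (pCons r p)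
  then show ?case
    using a assms
    by (simp add: ev_pCons mult_add_left[of _ s _ _ t] mult_smult_left[of _ s _ t] assoc[of a 0 _ s _ t])
qed (use assms in auto)

end

text \<open>Used with c* in the role of c, to turn polynomials of cc* into polynomials of
  c*c.\<close>

lemma ev_intertwine:
  assumes "a \<in> carrier (F 0)" "b \<in> carrier (F 0)" "c \<in> carrier (F 0)" "c \<diamondop> a = b \<diamondop> c"
    and x: "x \<in> carrier (F t)"
  shows "c \<diamondop> ev t a p x = ev t b p (c \<diamondop> x)"
proof (induction p)
  case (pCons r p)
  have "c \<diamondop> (a \<diamondop> ev t a p x) = b \<diamondop> (c \<diamondop> ev t a p x)"
    using assms by (simp flip: assoc[of _ 0 _ 0 _ t])
  then show ?case using assms pCons by (simp add: ev_pCons mult0_simps)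
qed (use assms in auto)

text \<open>p(a) is self-adjoint because its coefficients are real. It need not be an element of the
  unit fibre, so the fact is stated for vectors. In the induction y must vary, as each factor a
  moves over to it.\<close>

lemma ev_star:
  assumes a: "a \<in> carrier (F 0)" "adj a = a" and x: "x \<in> carrier (F s)" and y: "y \<in> carrier (F t)"
  shows "adj (ev s a p x) \<diamondop> y = adj x \<diamondop> ev t a p y"
  using y
proof (induction p arbitrary: y)
  case 0
  show ?case
    unfolding ev_0[OF a(1)] star_zero mult_zero_left[OF 0] mult_zero_right[OF star_closed[OF x]] ..
next
  case (pCons r p)
  let ?v = "ev s a p x"
  have v: "?v \<in> carrier (F s)" "adj ?v \<in> carrier (F (- s))" "adj x \<in> carrier (F (- s))"
    "adj x \<diamondop> y \<in> carrier (F (- s + t))"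
    using x a pCons.prems by (auto intro: star_closed mult_closed)
  have "adj (ev s a (pCons r p) x) \<diamondop> y
      = (of_real r \<odot>\<^bsub>F (- s)\<^esub> adj x \<oplus>\<^bsub>F (- s)\<^esub> adj ?v \<diamondop> a) \<diamondop> y"
    using x a v by (simp add: ev_pCons star_add[of _ s] star_smult[of _ s] star_mult'[of a 0 _ s])
  also have "\<dots> = of_real r \<odot>\<^bsub>F (- s + t)\<^esub> (adj x \<diamondop> y) \<oplus>\<^bsub>F (- s + t)\<^esub> adj ?v \<diamondop> (a \<diamondop> y)"
    using x a v pCons.prems
    by (simp add: mult_add_left[of _ "- s" _ _ t] mult_smult_left[of _ "- s" _ t] assoc[of _ "- s" _ 0 _ t])
  also have "adj ?v \<diamondop> (a \<diamondop> y) = adj x \<diamondop> (a \<diamondop> ev t a p y)"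
    using pCons.IH[of "a \<diamondop> y"] pCons.prems a by (simp add: ev_commute)
  also have "of_real r \<odot>\<^bsub>F (- s + t)\<^esub> (adj x \<diamondop> y) \<oplus>\<^bsub>F (- s + t)\<^esub> adj x \<diamondop> (a \<diamondop> ev t a p y)
      = adj x \<diamondop> ev t a (pCons r p) y"
    using x a v pCons.prems
    by (simp add: ev_pCons mult_add_right[of _ "- s" _ t] mult_smult_right[of _ "- s" _ t])
  finally show ?case .
qed


lemma ev_star_ev:
  assumes "a \<in> carrier (F 0)" "adj a = a" "x \<in> carrier (F t)"
  shows "adj (ev t a p x) \<diamondop> ev t a q x = adj x \<diamondop> ev t a (p * q) x"
  using assms by (simp add: ev_star[of a x t _ t] ev_mult)

lemma ev_bounded:
  assumes "a \<in> carrier (F 0)"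
  shows "\<exists>C\<ge>0. \<forall>t. \<forall>x \<in> carrier (F t). nrm (F t) (ev t a p x) \<le> C * nrm (F t) x"
proof (induction p)
  case 0
  then show ?case by (intro exI[of _ 0]) (use assms in auto)
next
  case (pCons r p)
  then obtain C where C: "0 \<le> C" "\<And>t x. x \<in> carrier (F t) \<Longrightarrow> nrm (F t) (ev t a p x) \<le> C * nrm (F t) x"
    by auto
  show ?case
  proof (intro exI[of _ "\<bar>r\<bar> + nrm (F 0) a * C"] conjI allI ballI)
    show "0 \<le> \<bar>r\<bar> + nrm (F 0) a * C" using C fb.nrm_nonneg assms by simp
    fix t x assume x: "x \<in> carrier (F t)"
    have "nrm (F t) (ev t a (pCons r p) x)
        \<le> nrm (F t) (of_real r \<odot>\<^bsub>F t\<^esub> x) + nrm (F t) (a \<diamondop> ev t a p x)"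
      using x assms by (simp add: ev_pCons fb.nrm_triangle)
    also have "\<dots> \<le> \<bar>r\<bar> * nrm (F t) x + nrm (F 0) a * (C * nrm (F t) x)"
      using C(2)[OF x] nrm_mult0[of a "ev t a p x" t] mult_left_mono[OF C(2)[OF x], of "nrm (F 0) a"]
        fb.nrm_nonneg[of a 0] x assms
      by (simp add: fb.nrm_smult)
    finally show "nrm (F t) (ev t a (pCons r p) x) \<le> (\<bar>r\<bar> + nrm (F 0) a * C) * nrm (F t) x"
      by (simp add: algebra_simps)
  qed
qed

text \<open>The operator norm of p(a) on all fibres simultaneously, which makes it applicable to
  every value of a section. At X it is the norm of a, for self-adjoint a, by
  \<open>nrm_le_opn\<close> and \<open>opn_le_nrm\<close>.\<close>

definition opn :: "'b \<Rightarrow> real poly \<Rightarrow> real" where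
  "opn a p = Inf {C. 0 \<le> C \<and> (\<forall>t. \<forall>x \<in> carrier (F t). nrm (F t) (ev t a p x) \<le> C * nrm (F t) x)}"

lemma opn_le:
  assumes "0 \<le> C" "\<And>t x. x \<in> carrier (F t) \<Longrightarrow> nrm (F t) (ev t a p x) \<le> C * nrm (F t) x"
  shows "opn a p \<le> C"
  unfolding opn_def using assms by (intro cInf_lower) (auto intro!: bdd_belowI[of _ 0])

lemma opn_nonneg:
  assumes "a \<in> carrier (F 0)"
  shows "0 \<le> opn a p"
  unfolding opn_def using ev_bounded[OF assms, of p] by (intro cInf_greatest) auto

lemma ev_opn:
  assumes "a \<in> carrier (F 0)" "x \<in> carrier (F t)"
  shows "nrm (F t) (ev t a p x) \<le> opn a p * nrm (F t) x"
proof (cases "nrm (F t) x = 0")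
  case True
  then have "nrm (F t) (ev t a p x) \<le> 0" using ev_bounded[OF assms(1), of p] assms(2) by fastforce
  then show ?thesis using True by simp
next
  case False
  then have x: "0 < nrm (F t) x" using fb.nrm_nonneg[OF assms(2)] by simp
  have "nrm (F t) (ev t a p x) / nrm (F t) x \<le> opn a p"
    unfolding opn_def
    using ev_bounded[OF assms(1), of p] x assms(2) by (intro cInf_greatest) (auto simp: field_simps)
  then show ?thesis using x by (simp add: field_simps)
qed

text \<open>The point is \<open>square_add\<close>. Let P = p(a) and Q = q(a). They commute and are
  self-adjoint, so for u = (P + iQ)x and for u = (P - iQ)x alike, u*u = x*(P^2 + Q^2)x. This bounds
  both operators by the root of the seminorm of p^2 + q^2, and 2P is their sum. No order is used, so
  nothing is circular.\<close>

lemma opn_seminorm: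
  assumes a: "a \<in> carrier (F 0)" "adj a = a"
  shows "poly_seminorm (opn a)"
proof
  have nn: "0 \<le> opn a p" for p using opn_nonneg a by blast
  have scale_le: "opn a (smult c p) \<le> \<bar>c\<bar> * opn a p" for c p
    using ev_opn[OF a(1), of _ _ p] nn
    by (intro opn_le) (auto simp: ev_smult a fb.nrm_smult mult.assoc intro!: mult_left_mono)
  fix p q c
  show "opn a (p + q) \<le> opn a p + opn a q"
  proof (rule opn_le)
    fix t x assume x: "x \<in> carrier (F t)"
    show "nrm (F t) (ev t a (p + q) x) \<le> (opn a p + opn a q) * nrm (F t) x"
      using ev_opn[OF a(1) x, of p] ev_opn[OF a(1) x, of q] x a
        fb.nrm_triangle[of "ev t a p x" t "ev t a q x"]
      by (simp add: ev_add algebra_simps)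
  qed (use nn in auto)
  show "opn a (smult c p) = \<bar>c\<bar> * opn a p"
  proof (cases "c = 0")
    case True
    then show ?thesis using scale_le[of 0 p] nn[of 0] by simp
  next
    case False
    have "opn a (smult (1 / c) (smult c p)) \<le> \<bar>1 / c\<bar> * opn a (smult c p)" by (rule scale_le)
    then have "\<bar>c\<bar> * opn a p \<le> opn a (smult c p)" using False by (simp add: field_simps)
    then show ?thesis using scale_le[of c p] by simp
  qed
  show "opn a (p * q) \<le> opn a p * opn a q"
  proof (rule opn_le)
    fix t x assume x: "x \<in> carrier (F t)"
    have "nrm (F t) (ev t a (p * q) x) \<le> opn a p * nrm (F t) (ev t a q x)"
      using ev_opn[OF a(1), of "ev t a q x" t p] x a by (simp add: ev_mult)
    also have "\<dots> \<le> opn a p * (opn a q * nrm (F t) x)"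
      by (intro mult_left_mono ev_opn a x nn)
    finally show "nrm (F t) (ev t a (p * q) x) \<le> opn a p * opn a q * nrm (F t) x"
      by (simp add: mult.assoc)
  qed (use nn in auto)
  show "opn a 1 \<le> 1" using a by (intro opn_le) auto
  show "(opn a p)\<^sup>2 \<le> opn a (p * p + q * q)"
  proof -
    define C where "C = sqrt (opn a (p * p + q * q))"
    have C: "0 \<le> C" "C * C = opn a (p * p + q * q)" using nn by (auto simp: C_def)
    have "opn a p \<le> C"
    proof (rule opn_le)
      fix t x assume x: "x \<in> carrier (F t)"
      let ?P = "ev t a p x" and ?Q = "ev t a q x"
      have PQ: "?P \<in> carrier (F t)" "?Q \<in> carrier (F t)" using x a by auto
      have unitary: "nrm (F t) (?P \<oplus>\<^bsub>F t\<^esub> z \<odot>\<^bsub>F t\<^esub> ?Q) \<le> C * nrm (F t) x"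
        if z: "cnj z = - z" "z * z = -1" for z
      proof -
        let ?u = "?P \<oplus>\<^bsub>F t\<^esub> z \<odot>\<^bsub>F t\<^esub> ?Q"
        have m: "adj y \<diamondop> w \<in> carrier (F 0)" if "y \<in> carrier (F t)" "w \<in> carrier (F t)" for y w
          using that by (intro mult_closed'[of _ "- t" _ t]) auto
        have "adj ?u = adj ?P \<oplus>\<^bsub>F (- t)\<^esub> (- z) \<odot>\<^bsub>F (- t)\<^esub> adj ?Q"
          using PQ z by (simp add: star_add[of _ t] star_smult[of _ t])
        then have "adj ?u \<diamondop> ?u = (adj ?P \<diamondop> ?P \<oplus>\<^bsub>F 0\<^esub> z \<odot>\<^bsub>F 0\<^esub> (adj ?P \<diamondop> ?Q)) \<oplus>\<^bsub>F 0\<^esub>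
            ((- z) \<odot>\<^bsub>F 0\<^esub> (adj ?Q \<diamondop> ?P) \<oplus>\<^bsub>F 0\<^esub> adj ?Q \<diamondop> ?Q)"
          using PQ m z
          by (simp add: mult_add_left[of _ "- t" _ _ t] mult_add_right[of _ "- t" _ t]
            mult_smult_left[of _ "- t" _ t] mult_smult_right[of _ "- t" _ t]
            fb.scale_right_distrib fb.scale_scale fb_ac)
        also have "adj ?Q \<diamondop> ?P = adj ?P \<diamondop> ?Q"
          using a x by (simp add: ev_star_ev mult.commute)
        also have "(adj ?P \<diamondop> ?P \<oplus>\<^bsub>F 0\<^esub> z \<odot>\<^bsub>F 0\<^esub> (adj ?P \<diamondop> ?Q)) \<oplus>\<^bsub>F 0\<^esub>
            ((- z) \<odot>\<^bsub>F 0\<^esub> (adj ?P \<diamondop> ?Q) \<oplus>\<^bsub>F 0\<^esub> adj ?Q \<diamondop> ?Q)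
            = adj ?P \<diamondop> ?P \<oplus>\<^bsub>F 0\<^esub> adj ?Q \<diamondop> ?Q"
          using m PQ fb.cancel_scale[of "z \<odot>\<^bsub>F 0\<^esub> (adj ?P \<diamondop> ?Q)" 0 "adj ?Q \<diamondop> ?Q"]
          by (simp add: fb.scale_scale fb_ac)
        also have "\<dots> = adj x \<diamondop> ev t a (p * p + q * q) x"
          using a x m by (simp add: ev_star_ev ev_add mult_add_right[of _ "- t" _ t])
        finally have u: "adj ?u \<diamondop> ?u = adj x \<diamondop> ev t a (p * p + q * q) x" .
        have "(nrm (F t) ?u)\<^sup>2 = nrm (F 0) (adj x \<diamondop> ev t a (p * p + q * q) x)"
          using norm_star_mult[of ?u t] PQ by (simp add: u)
        also have "\<dots> \<le> nrm (F t) x * nrm (F t) (ev t a (p * p + q * q) x)"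
          using norm_mult[of "adj x" "- t" "ev t a (p * p + q * q) x" t] x a norm_star[OF x] by simp
        also have "\<dots> \<le> nrm (F t) x * (C * C * nrm (F t) x)"
          using ev_opn[OF a(1) x, of "p * p + q * q"] C fb.nrm_nonneg[OF x]
          by (intro mult_left_mono) auto
        also have "\<dots> = (C * nrm (F t) x)\<^sup>2" by (simp add: power2_eq_square)
        finally show ?thesis using C fb.nrm_nonneg[OF x] by (auto intro: power2_le_imp_le)
      qed
      have "2 \<odot>\<^bsub>F t\<^esub> ?P = (?P \<oplus>\<^bsub>F t\<^esub> \<i> \<odot>\<^bsub>F t\<^esub> ?Q) \<oplus>\<^bsub>F t\<^esub> (?P \<oplus>\<^bsub>F t\<^esub> (- \<i>) \<odot>\<^bsub>F t\<^esub> ?Q)"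
        using PQ fb.cancel_scale[of "\<i> \<odot>\<^bsub>F t\<^esub> ?Q" t ?P] fb.scale_left_distrib[of ?P t 1 1]
        by (simp add: fb.scale_scale fb_ac)
      then have "2 * nrm (F t) ?P \<le> nrm (F t) (?P \<oplus>\<^bsub>F t\<^esub> \<i> \<odot>\<^bsub>F t\<^esub> ?Q) + nrm (F t) (?P \<oplus>\<^bsub>F t\<^esub> (- \<i>) \<odot>\<^bsub>F t\<^esub> ?Q)"
        using fb.nrm_triangle[of "?P \<oplus>\<^bsub>F t\<^esub> \<i> \<odot>\<^bsub>F t\<^esub> ?Q" t "?P \<oplus>\<^bsub>F t\<^esub> (- \<i>) \<odot>\<^bsub>F t\<^esub> ?Q"] PQ
          fb.nrm_smult[of ?P t 2] by simp
      then show "nrm (F t) ?P \<le> C * nrm (F t) x"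
        using unitary[of \<i>] unitary[of "- \<i>"] by simp
    qed (rule C)
    then have "(opn a p)\<^sup>2 \<le> C\<^sup>2" using nn by (intro power_mono) auto
    then show ?thesis using C by (simp add: power2_eq_square)
  qed
qed


subsection \<open>Positive elements of the unit fibre\<close>

definition pos :: "'b \<Rightarrow> bool" where
  "pos a \<longleftrightarrow> a \<in> carrier (F 0) \<and> adj a = a \<and> poly_seminorm.psd (opn a) [:0, 1:]"

text \<open>\<open>psd\<close> refers to the seminorm of one fixed element, so different elements
  cannot be added inside it. The norm estimate on the fibres, free of polynomials, can be combined
  across elements.\<close>

lemma psd_linear_iff:
  assumes a: "a \<in> carrier (F 0)" "adj a = a"
  shows "poly_seminorm.psd (opn a) [:r, s:] \<longleftrightarrow>
    (\<exists>t\<ge>0. \<forall>u. \<forall>x \<in> carrier (F u).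
       nrm (F u) (of_real (t - r) \<odot>\<^bsub>F u\<^esub> x \<oplus>\<^bsub>F u\<^esub> of_real (- s) \<odot>\<^bsub>F u\<^esub> (a \<diamondop> x)) \<le> t * nrm (F u) x)"
proof -
  have "opn a [:t - r, - s:] \<le> t \<longleftrightarrow>
     (\<forall>u. \<forall>x \<in> carrier (F u).
       nrm (F u) (of_real (t - r) \<odot>\<^bsub>F u\<^esub> x \<oplus>\<^bsub>F u\<^esub> of_real (- s) \<odot>\<^bsub>F u\<^esub> (a \<diamondop> x)) \<le> t * nrm (F u) x)"
    if t: "0 \<le> t" for t
  proof safe
    fix u x assume le: "opn a [:t - r, - s:] \<le> t" and x: "x \<in> carrier (F u)"
    have "nrm (F u) (ev u a [:t - r, - s:] x) \<le> t * nrm (F u) x"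
      using ev_opn[OF a(1) x, of "[:t - r, - s:]"] mult_right_mono[OF le fb.nrm_nonneg[OF x]] by linarith
    then show "nrm (F u) (of_real (t - r) \<odot>\<^bsub>F u\<^esub> x \<oplus>\<^bsub>F u\<^esub> of_real (- s) \<odot>\<^bsub>F u\<^esub> (a \<diamondop> x)) \<le> t * nrm (F u) x"
      unfolding ev_linear[OF a(1) x] .
  next
    assume "\<forall>u. \<forall>x \<in> carrier (F u).
       nrm (F u) (of_real (t - r) \<odot>\<^bsub>F u\<^esub> x \<oplus>\<^bsub>F u\<^esub> of_real (- s) \<odot>\<^bsub>F u\<^esub> (a \<diamondop> x)) \<le> t * nrm (F u) x"
    then show "opn a [:t - r, - s:] \<le> t"
      using t by (intro opn_le) (auto simp only: ev_linear[OF a(1)])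
  qed
  then show ?thesis unfolding poly_seminorm.psd_def[OF opn_seminorm[OF a]] by auto
qed

lemma pos_iff:
  "pos a \<longleftrightarrow> a \<in> carrier (F 0) \<and> adj a = a \<and>
    (\<exists>t\<ge>0. \<forall>u. \<forall>x \<in> carrier (F u).
       nrm (F u) (of_real t \<odot>\<^bsub>F u\<^esub> x \<oplus>\<^bsub>F u\<^esub> (-1) \<odot>\<^bsub>F u\<^esub> (a \<diamondop> x)) \<le> t * nrm (F u) x)"
  using psd_linear_iff[of a 0 1] by (auto simp: pos_def)

lemma pos_closed [simp]: "pos a \<Longrightarrow> a \<in> carrier (F 0)"
  by (simp add: pos_def)

lemma pos_adj: "pos a \<Longrightarrow> adj a = a"
  by (simp add: pos_def)

lemma pos_0: "pos \<zero>\<^bsub>F 0\<^esub>"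
  using mult_zero_left[of _ _ 0] star_zero[of 0] by (auto simp: pos_iff intro!: exI[of _ 0])

lemma add_sum_split:
  assumes "x \<in> carrier (F u)" "y \<in> carrier (F u)" "z \<in> carrier (F u)"
  shows "(c + d) \<odot>\<^bsub>F u\<^esub> x \<oplus>\<^bsub>F u\<^esub> k \<odot>\<^bsub>F u\<^esub> (y \<oplus>\<^bsub>F u\<^esub> z) =
    (c \<odot>\<^bsub>F u\<^esub> x \<oplus>\<^bsub>F u\<^esub> k \<odot>\<^bsub>F u\<^esub> y) \<oplus>\<^bsub>F u\<^esub> (d \<odot>\<^bsub>F u\<^esub> x \<oplus>\<^bsub>F u\<^esub> k \<odot>\<^bsub>F u\<^esub> z)"
  using assms by (simp add: fb.scale_left_distrib fb.scale_right_distrib fb_ac)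

lemma pos_add:
  assumes "pos a" "pos b"
  shows "pos (a \<oplus>\<^bsub>F 0\<^esub> b)"
proof -
  obtain s where s: "0 \<le> s" "\<And>u x. x \<in> carrier (F u) \<Longrightarrow>
      nrm (F u) (of_real s \<odot>\<^bsub>F u\<^esub> x \<oplus>\<^bsub>F u\<^esub> (-1) \<odot>\<^bsub>F u\<^esub> (a \<diamondop> x)) \<le> s * nrm (F u) x"
    using assms(1) by (auto simp: pos_iff)
  obtain t where t: "0 \<le> t" "\<And>u x. x \<in> carrier (F u) \<Longrightarrow>
      nrm (F u) (of_real t \<odot>\<^bsub>F u\<^esub> x \<oplus>\<^bsub>F u\<^esub> (-1) \<odot>\<^bsub>F u\<^esub> (b \<diamondop> x)) \<le> t * nrm (F u) x"
    using assms(2) by (auto simp: pos_iff)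
  have ab: "a \<in> carrier (F 0)" "b \<in> carrier (F 0)" using assms by auto
  have "nrm (F u) (of_real (s + t) \<odot>\<^bsub>F u\<^esub> x \<oplus>\<^bsub>F u\<^esub> (-1) \<odot>\<^bsub>F u\<^esub> ((a \<oplus>\<^bsub>F 0\<^esub> b) \<diamondop> x)) \<le> (s + t) * nrm (F u) x"
    if x: "x \<in> carrier (F u)" for u x
  proof -
    have "nrm (F u) (of_real (s + t) \<odot>\<^bsub>F u\<^esub> x \<oplus>\<^bsub>F u\<^esub> (-1) \<odot>\<^bsub>F u\<^esub> ((a \<oplus>\<^bsub>F 0\<^esub> b) \<diamondop> x))
      \<le> nrm (F u) (of_real s \<odot>\<^bsub>F u\<^esub> x \<oplus>\<^bsub>F u\<^esub> (-1) \<odot>\<^bsub>F u\<^esub> (a \<diamondop> x))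
       + nrm (F u) (of_real t \<odot>\<^bsub>F u\<^esub> x \<oplus>\<^bsub>F u\<^esub> (-1) \<odot>\<^bsub>F u\<^esub> (b \<diamondop> x))"
      unfolding of_real_add mult0_add_left[OF ab x] using x ab
      by (subst add_sum_split) (auto intro!: fb.nrm_triangle)
    then show ?thesis using s(2)[OF x] t(2)[OF x] by (simp add: algebra_simps)
  qed
  then show ?thesis
    using s t assms ab unfolding pos_iff
    by (intro conjI exI[of _ "s + t"]) (auto simp: star_add[of _ 0] pos_adj)
qed

lemma pos_scale:
  assumes "pos a" "0 \<le> r"
  shows "pos (of_real r \<odot>\<^bsub>F 0\<^esub> a)"
proof -
  obtain s where s: "0 \<le> s" "\<And>u x. x \<in> carrier (F u) \<Longrightarrow>
      nrm (F u) (of_real s \<odot>\<^bsub>F u\<^esub> x \<oplus>\<^bsub>F u\<^esub> (-1) \<odot>\<^bsub>F u\<^esub> (a \<diamondop> x)) \<le> s * nrm (F u) x"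
    using assms(1) by (auto simp: pos_iff)
  have a: "a \<in> carrier (F 0)" using assms by auto
  have "nrm (F u) (of_real (r * s) \<odot>\<^bsub>F u\<^esub> x \<oplus>\<^bsub>F u\<^esub> (-1) \<odot>\<^bsub>F u\<^esub> ((of_real r \<odot>\<^bsub>F 0\<^esub> a) \<diamondop> x)) \<le> (r * s) * nrm (F u) x"
    if x: "x \<in> carrier (F u)" for u x
  proof -
    have "of_real (r * s) \<odot>\<^bsub>F u\<^esub> x \<oplus>\<^bsub>F u\<^esub> (-1) \<odot>\<^bsub>F u\<^esub> ((of_real r \<odot>\<^bsub>F 0\<^esub> a) \<diamondop> x)
       = of_real r \<odot>\<^bsub>F u\<^esub> (of_real s \<odot>\<^bsub>F u\<^esub> x \<oplus>\<^bsub>F u\<^esub> (-1) \<odot>\<^bsub>F u\<^esub> (a \<diamondop> x))"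
      using x a by (simp add: mult0_simps fb.scale_right_distrib fb.scale_scale)
    then show ?thesis using s(2)[OF x] assms(2) x a
      by (simp add: fb.nrm_smult mult.assoc mult_left_mono)
  qed
  then show ?thesis
    using s assms a unfolding pos_iff
    by (intro conjI exI[of _ "r * s"]) (auto simp: star_smult[of _ 0] pos_adj)
qed

lemma nrm_le_opn:
  assumes "a \<in> carrier (F 0)" "adj a = a"
  shows "nrm (F 0) a \<le> opn a [:0, 1:]"
proof (cases "nrm (F 0) a = 0")
  case True
  then show ?thesis using opn_nonneg assms by simp
next
  case False
  have "nrm (F 0) a * nrm (F 0) a = nrm (F 0) (a \<diamondop> a)"
    using norm_star_mult[OF assms(1)] assms by (simp add: power2_eq_square)
  also have "\<dots> \<le> opn a [:0, 1:] * nrm (F 0) a"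
    using ev_opn[OF assms(1) assms(1), of "[:0, 1:]"] assms by simp
  finally show ?thesis using False fb.nrm_nonneg[OF assms(1)] by simp
qed

lemma opn_le_nrm: "a \<in> carrier (F 0) \<Longrightarrow> opn a [:0, 1:] \<le> nrm (F 0) a"
  using nrm_mult0 by (intro opn_le) (auto simp: fb.nrm_nonneg)

text \<open>With s = ||a + b||, the bounds 0 <= a <= s are verified in the seminorm of a alone; b
  enters only through the witness of its positivity.\<close>

lemma pos_nrm_mono:
  assumes "pos a" "pos b"
  shows "nrm (F 0) a \<le> nrm (F 0) (a \<oplus>\<^bsub>F 0\<^esub> b)"
proof -
  define c where "c = a \<oplus>\<^bsub>F 0\<^esub> b"
  define s where "s = nrm (F 0) c"
  have ab: "a \<in> carrier (F 0)" "adj a = a" "b \<in> carrier (F 0)" "c \<in> carrier (F 0)"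
    using assms by (auto simp: pos_adj c_def)
  obtain t where t: "0 \<le> t" "\<And>u x. x \<in> carrier (F u) \<Longrightarrow>
      nrm (F u) (of_real t \<odot>\<^bsub>F u\<^esub> x \<oplus>\<^bsub>F u\<^esub> (-1) \<odot>\<^bsub>F u\<^esub> (b \<diamondop> x)) \<le> t * nrm (F u) x"
    using assms(2) by (auto simp: pos_iff)
  have s: "0 \<le> s" using ab fb.nrm_nonneg by (simp add: s_def)
  have "nrm (F u) (of_real t \<odot>\<^bsub>F u\<^esub> x \<oplus>\<^bsub>F u\<^esub> a \<diamondop> x) \<le> (t + s) * nrm (F u) x"
    if x: "x \<in> carrier (F u)" for u x
  proof -
    \<comment> \<open>As t + a = (t - b) + (a + b), with t the witness for b, the number t + s is a
      witness for s - a >= 0.\<close>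
    have "of_real t \<odot>\<^bsub>F u\<^esub> x \<oplus>\<^bsub>F u\<^esub> a \<diamondop> x
       = (of_real t \<odot>\<^bsub>F u\<^esub> x \<oplus>\<^bsub>F u\<^esub> (-1) \<odot>\<^bsub>F u\<^esub> (b \<diamondop> x)) \<oplus>\<^bsub>F u\<^esub> c \<diamondop> x"
      using x ab fb.cancel_scale[of "b \<diamondop> x" u "a \<diamondop> x"] by (simp add: c_def mult0_simps fb_ac)
    then have "nrm (F u) (of_real t \<odot>\<^bsub>F u\<^esub> x \<oplus>\<^bsub>F u\<^esub> a \<diamondop> x)
       \<le> t * nrm (F u) x + s * nrm (F u) x"
      using fb.nrm_triangle[of "of_real t \<odot>\<^bsub>F u\<^esub> x \<oplus>\<^bsub>F u\<^esub> (-1) \<odot>\<^bsub>F u\<^esub> (b \<diamondop> x)" u "c \<diamondop> x"] x ab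
        t(2)[OF x] nrm_mult0[of c x u] by (simp add: s_def)
    then show ?thesis by (simp add: algebra_simps)
  qed
  then have "poly_seminorm.psd (opn a) [:s, -1:]"
    using s t ab by (subst psd_linear_iff) (auto intro!: exI[of _ "t + s"])
  then have "opn a [:0, 1:] \<le> s"
    using poly_seminorm.psd_le[OF opn_seminorm[OF ab(1,2)], of "[:0, 1:]" s] assms(1) s
    by (simp add: pos_def)
  then show ?thesis using nrm_le_opn[OF ab(1,2)] by (simp add: s_def c_def)
qed

lemma pos_square:
  assumes h: "h \<in> carrier (F 0)" "adj h = h"
  shows "pos (h \<diamondop> h)"
proof -
  obtain t where t: "0 \<le> t" "opn h ([:t:] - [:0, 1:] * [:0, 1:]) \<le> t"
    using poly_seminorm.psd_square[OF opn_seminorm[OF h], of "[:0, 1:]"]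
    unfolding poly_seminorm.psd_def[OF opn_seminorm[OF h]] by blast
  have "nrm (F u) (of_real t \<odot>\<^bsub>F u\<^esub> x \<oplus>\<^bsub>F u\<^esub> (-1) \<odot>\<^bsub>F u\<^esub> (h \<diamondop> h \<diamondop> x)) \<le> t * nrm (F u) x"
    if x: "x \<in> carrier (F u)" for u x
  proof -
    have "ev u h ([:t:] - [:0, 1:] * [:0, 1:]) x
       = of_real t \<odot>\<^bsub>F u\<^esub> x \<oplus>\<^bsub>F u\<^esub> (-1) \<odot>\<^bsub>F u\<^esub> (h \<diamondop> h \<diamondop> x)"
      unfolding ev_diff[OF h(1) x] ev_mult[OF h(1) x] using x h by (simp add: ev_const assoc[of _ 0 _ 0 _ u])
    then show ?thesis
      using ev_opn[OF h(1) x, of "[:t:] - [:0, 1:] * [:0, 1:]"]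
        mult_right_mono[OF t(2) fb.nrm_nonneg[OF x]] by simp
  qed
  then show ?thesis using t h star_mult'[of h 0 h 0] unfolding pos_iff by auto
qed


text \<open>Half the sum of the squares of the self-adjoint elements x + x* and i(x - x* ); the
  squares of x and of x* cancel.\<close>

lemma pos_star_mult_add:
  assumes x: "x \<in> carrier (F 0)"
  shows "pos (adj x \<diamondop> x \<oplus>\<^bsub>F 0\<^esub> x \<diamondop> adj x)"
proof -
  let ?H = "x \<oplus>\<^bsub>F 0\<^esub> adj x"
  let ?K = "\<i> \<odot>\<^bsub>F 0\<^esub> x \<oplus>\<^bsub>F 0\<^esub> (- \<i>) \<odot>\<^bsub>F 0\<^esub> adj x"
  let ?S = "adj x \<diamondop> x" and ?T = "x \<diamondop> adj x" and ?Q = "x \<diamondop> x" and ?R = "adj x \<diamondop> adj x"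
  have c: "?H \<in> carrier (F 0)" "?K \<in> carrier (F 0)" "adj x \<in> carrier (F 0)"
    "?S \<in> carrier (F 0)" "?T \<in> carrier (F 0)" "?Q \<in> carrier (F 0)" "?R \<in> carrier (F 0)"
    using x by auto
  have "adj ?H = ?H" "adj ?K = ?K"
    using x by (auto simp: star_add[of _ 0] star_smult[of _ 0] fb_ac)
  then have "pos (?H \<diamondop> ?H \<oplus>\<^bsub>F 0\<^esub> ?K \<diamondop> ?K)"
    by (intro pos_add pos_square c)
  then have "pos (of_real (1/2) \<odot>\<^bsub>F 0\<^esub> (?H \<diamondop> ?H \<oplus>\<^bsub>F 0\<^esub> ?K \<diamondop> ?K))"
    by (rule pos_scale) simp
  moreover have "?K \<diamondop> ?K = (-1) \<odot>\<^bsub>F 0\<^esub> ?Q \<oplus>\<^bsub>F 0\<^esub> (-1) \<odot>\<^bsub>F 0\<^esub> ?R \<oplus>\<^bsub>F 0\<^esub> (?S \<oplus>\<^bsub>F 0\<^esub> ?T)"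
    using x c by (simp add: mult0_add_right[of _ _ 0] mult0_add_left[of _ _ _ 0] mult0_scale_right[of _ _ 0]
      mult0_scale_left[of _ _ 0] fb.scale_right_distrib fb.scale_scale fb_ac)
  moreover have "?H \<diamondop> ?H = ?Q \<oplus>\<^bsub>F 0\<^esub> (?R \<oplus>\<^bsub>F 0\<^esub> (?S \<oplus>\<^bsub>F 0\<^esub> ?T))"
    using x c by (simp add: mult0_add_right[of _ _ 0] mult0_add_left[of _ _ _ 0] fb_ac)
  moreover have "?Q \<oplus>\<^bsub>F 0\<^esub> (?R \<oplus>\<^bsub>F 0\<^esub> (?S \<oplus>\<^bsub>F 0\<^esub> ?T)) \<oplus>\<^bsub>F 0\<^esub>
      ((-1) \<odot>\<^bsub>F 0\<^esub> ?Q \<oplus>\<^bsub>F 0\<^esub> (-1) \<odot>\<^bsub>F 0\<^esub> ?R \<oplus>\<^bsub>F 0\<^esub> (?S \<oplus>\<^bsub>F 0\<^esub> ?T))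
     = (?S \<oplus>\<^bsub>F 0\<^esub> ?T) \<oplus>\<^bsub>F 0\<^esub> (?S \<oplus>\<^bsub>F 0\<^esub> ?T)"
  proof -
    have "?Q \<oplus>\<^bsub>F 0\<^esub> (?R \<oplus>\<^bsub>F 0\<^esub> (?S \<oplus>\<^bsub>F 0\<^esub> ?T)) \<oplus>\<^bsub>F 0\<^esub>
      ((-1) \<odot>\<^bsub>F 0\<^esub> ?Q \<oplus>\<^bsub>F 0\<^esub> (-1) \<odot>\<^bsub>F 0\<^esub> ?R \<oplus>\<^bsub>F 0\<^esub> (?S \<oplus>\<^bsub>F 0\<^esub> ?T))
      = ?Q \<oplus>\<^bsub>F 0\<^esub> ((-1) \<odot>\<^bsub>F 0\<^esub> ?Q \<oplus>\<^bsub>F 0\<^esub> (?R \<oplus>\<^bsub>F 0\<^esub> ((-1) \<odot>\<^bsub>F 0\<^esub> ?R \<oplus>\<^bsub>F 0\<^esub>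
        ((?S \<oplus>\<^bsub>F 0\<^esub> ?T) \<oplus>\<^bsub>F 0\<^esub> (?S \<oplus>\<^bsub>F 0\<^esub> ?T)))))"
      using c by (simp add: fb_ac)
    then show ?thesis
      by (simp only: fb.cancel_scale[OF c(6)] fb.cancel_scale[OF c(7)] fb.a_closed fb.scale_closed c)
  qed
  moreover have "of_real (1/2) \<odot>\<^bsub>F 0\<^esub> (y \<oplus>\<^bsub>F 0\<^esub> y) = y" if "y \<in> carrier (F 0)" for y
  proof -
    have "y \<oplus>\<^bsub>F 0\<^esub> y = 2 \<odot>\<^bsub>F 0\<^esub> y" using that fb.scale_left_distrib[of y 0 1 1] by simp
    then show ?thesis using that by (simp add: fb.scale_scale)
  qed
  ultimately show ?thesis using c by simp
qed

text \<open>
  Kaplansky's theorem. With \<open>a = c\<^sup>*c\<close>, \<open>b = cc\<^sup>*\<close> and \<open>z = 1 - X\<close>, suppose \<open>m = \<parallel>1 - a\<parallel> > 1\<close>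
  and put \<open>x = (1 - b)\<^sup>nc\<close>. Then \<open>x\<^sup>*x = a(1 - a)\<^bsup>2n\<^esup> \<le> 1\<close> and \<open>xx\<^sup>* = b(1 - b)\<^bsup>2n\<^esup> \<le> 1\<close>, whereas
  \<open>x\<^sup>*x + xx\<^sup>* \<ge> 0\<close>; so \<open>x\<^sup>*x\<close> lies between \<open>-1\<close> and \<open>1\<close>, although its norm is at least
  \<open>m\<^bsup>2n\<^esup>(m - 1)\<close>.
\<close>

lemma pos_star_mult_contraction:
  assumes c: "c \<in> carrier (F 0)" "nrm (F 0) c \<le> 1"
  shows "pos (adj c \<diamondop> c)"
proof -
  define z :: "real poly" where "z = [:1, -1:]"
  define a where "a = adj c \<diamondop> c"
  define b where "b = c \<diamondop> adj c"
  have ab: "a \<in> carrier (F 0)" "adj a = a" "b \<in> carrier (F 0)" "adj b = b"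
    using c by (auto simp: a_def b_def star_mult'[of _ 0 _ 0])
  interpret A: poly_seminorm "opn a" by (rule opn_seminorm ab)+
  interpret Bq: poly_seminorm "opn b" by (rule opn_seminorm ab)+
  have "nrm (F 0) a \<le> 1" "nrm (F 0) b \<le> 1"
    using norm_star_mult[of c 0] norm_star_mult[of "adj c" 0] norm_star[of c 0] c
      power_le_one[OF fb.nrm_nonneg[OF c(1)] c(2)] by (auto simp: a_def b_def)
  then have X1: "opn a [:0, 1:] \<le> 1" "opn b [:0, 1:] \<le> 1"
    using opn_le_nrm ab by (meson order_trans)+
  \<comment> \<open>The contraction hypothesis at work: 1 - z = X has seminorm at most 1, so t = 1
    witnesses z >= 0 for a and for b.\<close>
  have psd_z: "A.psd z" "Bq.psd z"
    using X1 by (auto simp: A.psd_def Bq.psd_def z_def intro!: exI[of _ 1])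
  define m where "m = opn a z"
  \<comment> \<open>The constant is crude: 0 <= 1 + x*x <= 2 gives a norm of at most 2, and removing
    the 1 gives 3. What matters is that it does not depend on n.\<close>
  have bound: "opn a (z ^ (2 * n) * [:0, 1:]) \<le> 3" for n
  proof -
    define x where "x = ev 0 b (z ^ n) c"
    have x: "x \<in> carrier (F 0)" "adj x \<in> carrier (F 0)" using c ab by (auto simp: x_def)
    let ?q = "z ^ (2 * n) * [:0, 1:]"
    have q: "[:1:] - ?q = 1 - z ^ (2 * n) + z ^ Suc (2 * n)"
      by (intro poly_eq_poly_eq_iff[THEN iffD1] ext) (simp add: z_def algebra_simps)
    have left: "adj x \<diamondop> x \<diamondop> w = ev u a ?q w"
      and right: "x \<diamondop> adj x \<diamondop> w = ev u b ?q w" if w: "w \<in> carrier (F u)" for u w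
    proof -
      have xw: "x \<diamondop> v = ev u b (z ^ n) (c \<diamondop> v)" if "v \<in> carrier (F u)" for v
        using ev_mult_right[OF ab(3) c(1) that] by (simp add: x_def)
      have xsw: "adj x \<diamondop> v = adj c \<diamondop> ev u b (z ^ n) v" if "v \<in> carrier (F u)" for v
        using ev_star[OF ab(3,4) c(1) that] by (simp add: x_def)
      have "adj x \<diamondop> x \<diamondop> w = adj c \<diamondop> ev u b (z ^ n) (ev u b (z ^ n) (c \<diamondop> w))"
        using w x c ab by (simp add: assoc[of _ 0 _ 0 _ u] xw xsw)
      also have "\<dots> = adj c \<diamondop> ev u b (z ^ (2 * n)) (c \<diamondop> w)"
        using w c ab by (simp add: mult_2 power_add ev_mult)
      \<comment> \<open>Since c*b = ac*, the polynomial in b passes through c* and becomes the same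
        polynomial in a.\<close>
      also have "\<dots> = ev u a (z ^ (2 * n)) (adj c \<diamondop> (c \<diamondop> w))"
        using w c ab by (intro ev_intertwine) (auto simp: a_def b_def assoc[of _ 0 _ 0 _ 0])
      also have "adj c \<diamondop> (c \<diamondop> w) = ev u a [:0, 1:] w"
        using w c ab by (simp add: a_def assoc[of _ 0 _ 0 _ u])
      finally show "adj x \<diamondop> x \<diamondop> w = ev u a ?q w" by (simp only: ev_mult[OF ab(1) w])
      have "x \<diamondop> adj x \<diamondop> w = ev u b (z ^ n) (c \<diamondop> (adj c \<diamondop> ev u b (z ^ n) w))"
        using w x c ab by (simp add: assoc[of _ 0 _ 0 _ u] xw xsw)
      also have "c \<diamondop> (adj c \<diamondop> ev u b (z ^ n) w) = ev u b [:0, 1:] (ev u b (z ^ n) w)"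
        using w c ab by (simp add: b_def assoc[of _ 0 _ 0 _ u])
      also have "ev u b (z ^ n) (ev u b [:0, 1:] (ev u b (z ^ n) w)) = ev u b (z ^ n * ([:0, 1:] * z ^ n)) w"
        using w ab by (simp only: ev_mult[OF ab(3)] ev_closed[OF ab(3)])
      also have "z ^ n * ([:0, 1:] * z ^ n) = ?q"
        by (simp only: mult_2[of n] power_add[of z n n] mult.assoc mult.commute[of "[:0, 1:]"])
      finally show "x \<diamondop> adj x \<diamondop> w = ev u b ?q w" .
    qed
    define e where "e = adj x \<diamondop> x"
    define f where "f = x \<diamondop> adj x"
    have ef: "e \<in> carrier (F 0)" "adj e = e" "f \<in> carrier (F 0)" "adj f = f"
      using x by (auto simp: e_def f_def star_mult'[of _ 0 _ 0])
    interpret E: poly_seminorm "opn e" by (rule opn_seminorm ef)+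
    \<comment> \<open>One argument for two pairs: x*x is ?q evaluated at a, and xx* is ?q evaluated
      at b. In both cases \<open>psd_power\<close> gives 1 - y >= 0, restated for the action of
      y.\<close>
    have upper: "\<exists>t\<ge>0. \<forall>u. \<forall>w \<in> carrier (F u).
        nrm (F u) (of_real (t - 1) \<odot>\<^bsub>F u\<^esub> w \<oplus>\<^bsub>F u\<^esub> y \<diamondop> w) \<le> t * nrm (F u) w"
      if d: "d \<in> carrier (F 0)" "adj d = d" and psd: "poly_seminorm.psd (opn d) z"
        and y: "\<And>u w. w \<in> carrier (F u) \<Longrightarrow> y \<diamondop> w = ev u d ?q w" for d y
    proof -
      have "poly_seminorm.psd (opn d) ([:1:] - ?q)"
        unfolding q using poly_seminorm.psd_power[OF opn_seminorm[OF d] psd] .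
      then obtain t where t: "0 \<le> t" "opn d ([:t:] - ([:1:] - ?q)) \<le> t"
        unfolding poly_seminorm.psd_def[OF opn_seminorm[OF d]] by blast
      have "nrm (F u) (of_real (t - 1) \<odot>\<^bsub>F u\<^esub> w \<oplus>\<^bsub>F u\<^esub> y \<diamondop> w) \<le> t * nrm (F u) w"
        if w: "w \<in> carrier (F u)" for u w
      proof -
        have "[:t:] - ([:1:] - ?q) = [:t - 1:] + ?q"
          by (intro poly_eq_poly_eq_iff[THEN iffD1] ext) simp
        then have "ev u d ([:t:] - ([:1:] - ?q)) w = of_real (t - 1) \<odot>\<^bsub>F u\<^esub> w \<oplus>\<^bsub>F u\<^esub> y \<diamondop> w"
          by (simp only: y[OF w] ev_add[OF d(1) w] ev_const[OF d(1) w])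
        then show ?thesis
          using ev_opn[OF d(1) w, of "[:t:] - ([:1:] - ?q)"]
            mult_right_mono[OF t(2) fb.nrm_nonneg[OF w]] by simp
      qed
      then show ?thesis using t by blast
    qed
    have psd_e: "E.psd [:1, -1:]"
    proof -
      obtain t where t: "0 \<le> t" "\<And>u w. w \<in> carrier (F u) \<Longrightarrow>
          nrm (F u) (of_real (t - 1) \<odot>\<^bsub>F u\<^esub> w \<oplus>\<^bsub>F u\<^esub> e \<diamondop> w) \<le> t * nrm (F u) w"
        using upper[OF ab(1,2) psd_z(1), of e] left unfolding e_def by blast
      then show ?thesis using ef by (subst psd_linear_iff) (auto intro!: exI[of _ t])
    qed
    obtain t where t: "0 \<le> t" "\<And>u w. w \<in> carrier (F u) \<Longrightarrow>
        nrm (F u) (of_real (t - 1) \<odot>\<^bsub>F u\<^esub> w \<oplus>\<^bsub>F u\<^esub> f \<diamondop> w) \<le> t * nrm (F u) w"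
      using upper[OF ab(3,4) psd_z(2), of f] right unfolding f_def by blast
    obtain s where s: "0 \<le> s" "\<And>u w. w \<in> carrier (F u) \<Longrightarrow>
        nrm (F u) (of_real s \<odot>\<^bsub>F u\<^esub> w \<oplus>\<^bsub>F u\<^esub> (-1) \<odot>\<^bsub>F u\<^esub> ((e \<oplus>\<^bsub>F 0\<^esub> f) \<diamondop> w)) \<le> s * nrm (F u) w"
      using pos_star_mult_add[OF x(1)] unfolding pos_iff e_def f_def by blast
    \<comment> \<open>1 + e = (1 - f) + (e + f) is a sum of two positive operators, with witnesses t
      and s.\<close>
    have psd_e': "E.psd [:1, 1:]"
    proof (subst psd_linear_iff; (rule ef)?)
      have "nrm (F u) (of_real (t + s - 1) \<odot>\<^bsub>F u\<^esub> w \<oplus>\<^bsub>F u\<^esub> of_real (- 1) \<odot>\<^bsub>F u\<^esub> (e \<diamondop> w)) \<le> (t + s) * nrm (F u) w"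
        if w: "w \<in> carrier (F u)" for u w
      proof -
        let ?e = "e \<diamondop> w" and ?f = "f \<diamondop> w"
        have efw: "?e \<in> carrier (F u)" "?f \<in> carrier (F u)" using ef w by auto
        have "of_real (t + s - 1) \<odot>\<^bsub>F u\<^esub> w = of_real (t - 1) \<odot>\<^bsub>F u\<^esub> w \<oplus>\<^bsub>F u\<^esub> of_real s \<odot>\<^bsub>F u\<^esub> w"
          using fb.scale_left_distrib[OF w, of "of_real (t - 1)" "of_real s"] by (simp add: algebra_simps)
        then have "of_real (t + s - 1) \<odot>\<^bsub>F u\<^esub> w \<oplus>\<^bsub>F u\<^esub> of_real (- 1) \<odot>\<^bsub>F u\<^esub> ?e
          = (of_real (t - 1) \<odot>\<^bsub>F u\<^esub> w \<oplus>\<^bsub>F u\<^esub> ?f) \<oplus>\<^bsub>F u\<^esub>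
            (of_real s \<odot>\<^bsub>F u\<^esub> w \<oplus>\<^bsub>F u\<^esub> (-1) \<odot>\<^bsub>F u\<^esub> ((e \<oplus>\<^bsub>F 0\<^esub> f) \<diamondop> w))"
          using ef w efw fb.cancel_scale[of ?f u "of_real (t - 1) \<odot>\<^bsub>F u\<^esub> w \<oplus>\<^bsub>F u\<^esub>
              (of_real s \<odot>\<^bsub>F u\<^esub> w \<oplus>\<^bsub>F u\<^esub> (-1) \<odot>\<^bsub>F u\<^esub> ?e)"]
          by (simp add: mult0_add_left fb.scale_right_distrib fb_ac)
        then show ?thesis
          using t(2)[OF w] s(2)[OF w] w ef efw
            fb.nrm_triangle[of "of_real (t - 1) \<odot>\<^bsub>F u\<^esub> w \<oplus>\<^bsub>F u\<^esub> ?f" u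
              "of_real s \<odot>\<^bsub>F u\<^esub> w \<oplus>\<^bsub>F u\<^esub> (-1) \<odot>\<^bsub>F u\<^esub> ((e \<oplus>\<^bsub>F 0\<^esub> f) \<diamondop> w)"]
          by (simp add: algebra_simps)
      qed
      then show "\<exists>t\<ge>0. \<forall>u. \<forall>x \<in> carrier (F u).
        nrm (F u) (of_real (t - 1) \<odot>\<^bsub>F u\<^esub> x \<oplus>\<^bsub>F u\<^esub> of_real (- 1) \<odot>\<^bsub>F u\<^esub> (e \<diamondop> x)) \<le> t * nrm (F u) x"
        using t s by (intro exI[of _ "t + s"]) auto
    qed
    have "[:2:] - [:1, 1:] = [:1, -1::real:]" by simp
    then have "opn e [:1, 1:] \<le> 2" using E.psd_le[OF psd_e', of 2] psd_e by simp
    moreover have "[:0, 1:] = [:1, 1:] - [:1::real:]" by simp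
    ultimately have e3: "opn e [:0, 1:] \<le> 3"
      using E.triangle_diff[of "[:1, 1:]" "[:1:]"] E.const_le[of 1] by (smt (verit))
    show ?thesis
    proof (rule opn_le)
      fix u w assume w: "w \<in> carrier (F u)"
      show "nrm (F u) (ev u a ?q w) \<le> 3 * nrm (F u) w"
        unfolding left[OF w, symmetric]
        using ev_opn[OF ef(1) w, of "[:0, 1:]"] mult_right_mono[OF e3 fb.nrm_nonneg[OF w]] w ef
        by (simp add: e_def)
    qed simp
  qed
  \<comment> \<open>\<open>power_eq\<close> and z^(2n+1) = z^(2n) - z^(2n) X give m^(2n) (m - 1) <=
    3 for all n > 0, impossible if m > 1. Conversely, m <= 1 is positivity of a with witness
    1.\<close>
  have "m \<le> 1"
  proof (rule ccontr)
    assume "\<not> m \<le> 1"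
    then have m: "1 < m" by simp
    have "m ^ (2 * n) * (m - 1) \<le> 3" if n: "0 < n" for n
    proof -
      have "z ^ Suc (2 * n) = z ^ (2 * n) - z ^ (2 * n) * [:0, 1:]"
        by (intro poly_eq_poly_eq_iff[THEN iffD1] ext) (simp add: z_def algebra_simps)
      then have "opn a (z ^ Suc (2 * n)) \<le> opn a (z ^ (2 * n)) + 3"
        using A.triangle_diff[of "z ^ (2 * n)" "z ^ (2 * n) * [:0, 1:]"] bound[of n] by simp
      then show ?thesis
        using A.power_eq[of z "2 * n"] A.power_eq[of z "Suc (2 * n)"] m n
        by (simp add: m_def algebra_simps)
    qed
    moreover obtain n where n: "3 / (m - 1) < m ^ n"
      using real_arch_pow[OF m] by blast
    moreover have "m ^ n \<le> m ^ (2 * Suc n)" using m by (intro power_increasing) auto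
    ultimately have "3 / (m - 1) < m ^ (2 * Suc n)" "m ^ (2 * Suc n) * (m - 1) \<le> 3" by force+
    then show False using m by (simp add: field_simps)
  qed
  then have "A.psd [:0, 1:]"
    by (auto simp: A.psd_def m_def z_def intro!: exI[of _ 1])
  then show ?thesis using ab by (simp add: pos_def a_def)
qed

text \<open>The axiom \<open>star_mult_positive\<close> moves b*b into the unit fibre as c*c.
  Dividing c by ||c|| + 1, which cannot vanish, gives the contraction that Kaplansky's theorem was
  proved for.\<close>

theorem pos_star_mult:
  assumes b: "b \<in> carrier (F t)"
  shows "pos (adj b \<diamondop> b)"
proof -
  obtain c where c: "c \<in> carrier (F 0)" "adj b \<diamondop> b = adj c \<diamondop> c"
    using star_mult_positive[of b] b
    by (auto simp: positive_def unit_fibre_def cnormed.extend_def star_alg.fields_def)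
  define r where "r = nrm (F 0) c + 1"
  have r: "0 < r" using fb.nrm_nonneg[OF c(1)] by (simp add: r_def)
  define d where "d = of_real (1 / r) \<odot>\<^bsub>F 0\<^esub> c"
  have "nrm (F 0) d = nrm (F 0) c / r" using c r by (simp add: d_def fb.nrm_smult norm_divide)
  also have "\<dots> \<le> 1" using r by (simp add: r_def)
  finally have d: "d \<in> carrier (F 0)" "nrm (F 0) d \<le> 1" using c by (auto simp: d_def)
  have "of_real (r * r) \<odot>\<^bsub>F 0\<^esub> (adj d \<diamondop> d) = adj c \<diamondop> c"
    using c r by (simp add: d_def star_smult[of _ 0] mult0_simps fb.scale_scale)
  then show ?thesis
    using pos_scale[OF pos_star_mult_contraction[OF d], of "r * r"] r c by simp
qed

end

section \<open>Sections of a Fell bundle\<close>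

lemma finsum_hom:
  assumes "abelian_monoid G" "abelian_monoid H"
    and "\<And>x. x \<in> carrier G \<Longrightarrow> h x \<in> carrier H"
    and "\<And>x y. \<lbrakk>x \<in> carrier G; y \<in> carrier G\<rbrakk> \<Longrightarrow> h (x \<oplus>\<^bsub>G\<^esub> y) = h x \<oplus>\<^bsub>H\<^esub> h y"
    and "h \<zero>\<^bsub>G\<^esub> = \<zero>\<^bsub>H\<^esub>"
    and "finite A" "\<And>i. i \<in> A \<Longrightarrow> f i \<in> carrier G"
  shows "h (finsum G f A) = finsum H (\<lambda>i. h (f i)) A"
proof -
  interpret G: abelian_monoid G by fact
  interpret H: abelian_monoid H by fact
  show ?thesis
    using assms(6,7)
  proof (induction A rule: finite_induct)
    case (insert i A)
    then have "f \<in> A \<rightarrow> carrier G" "f i \<in> carrier G" "(\<lambda>i. h (f i)) \<in> A \<rightarrow> carrier H" "h (f i) \<in> carrier H"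
      using assms(3) by auto
    then show ?case
      using insert assms(4) G.finsum_closed[of f A] by (simp add: G.finsum_insert H.finsum_insert)
  qed (use assms(5) in simp)
qed

lemma (in complex_banach_space) nrm_finsum_le:
  "(\<And>i. i \<in> A \<Longrightarrow> f i \<in> carrier V) \<Longrightarrow> nrm V (finsum V f A) \<le> (\<Sum>i\<in>A. nrm V (f i))"
proof (induction A rule: infinite_finite_induct)
  case (insert i A)
  then have f: "f \<in> A \<rightarrow> carrier V" "f i \<in> carrier V" by auto
  then have "nrm V (finsum V f (insert i A)) \<le> nrm V (f i) + nrm V (finsum V f A)"
    using insert nrm_triangle[of "f i" "finsum V f A"] by (simp add: M.finsum_insert M.finsum_closed)
  also have "\<dots> \<le> nrm V (f i) + (\<Sum>i\<in>A. nrm V (f i))" using insert by simp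
  finally show ?case using insert by simp
qed (auto simp: M.finsum_infinite)

context fell_bundle
begin

subsection \<open>The star-algebra of finitely supported sections\<close>

definition sec :: "('g \<Rightarrow> 'b) set" where
  "sec = {x. (\<forall>t. x t \<in> carrier (F t)) \<and> finite (supp B x)}"

definition splus :: "('g \<Rightarrow> 'b) \<Rightarrow> ('g \<Rightarrow> 'b) \<Rightarrow> 'g \<Rightarrow> 'b" where
  "splus x y t = x t \<oplus>\<^bsub>F t\<^esub> y t"

definition szero :: "'g \<Rightarrow> 'b" where
  "szero t = \<zero>\<^bsub>F t\<^esub>"

definition sscale :: "complex \<Rightarrow> ('g \<Rightarrow> 'b) \<Rightarrow> 'g \<Rightarrow> 'b" where
  "sscale c x t = c \<odot>\<^bsub>F t\<^esub> x t"

definition sstar :: "('g \<Rightarrow> 'b) \<Rightarrow> 'g \<Rightarrow> 'b" where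
  "sstar x s = adj (x (- s))"

definition conv :: "('g \<Rightarrow> 'b) \<Rightarrow> ('g \<Rightarrow> 'b) \<Rightarrow> 'g \<Rightarrow> 'b" where
  "conv x y s = (\<Oplus>\<^bsub>F s\<^esub>t\<in>supp B x. x t \<diamondop> y (- t + s))"

definition single :: "'g \<Rightarrow> 'b \<Rightarrow> 'g \<Rightarrow> 'b" where
  "single t b s = (if s = t then b else \<zero>\<^bsub>F s\<^esub>)"

text \<open>The names on the right do not mention N, so every algebraic fact about sections serves
  both the l_2 norm and the reduced norm.\<close>

lemma sections_simps:
  "carrier (sections B N) = sec" "zero (sections B N) = szero" "add (sections B N) = splus"
  "module.smult (sections B N) = sscale" "monoid.mult (sections B N) = conv"
  "star (sections B N) = sstar" "nrm (sections B N) = N"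
  by (auto simp: sections_def sec_def szero_def splus_def sscale_def conv_def sstar_def fun_eq_iff)

lemma sec_closed: "x \<in> sec \<Longrightarrow> x t \<in> carrier (F t)"
  by (simp add: sec_def)

lemma sec_finite [simp]: "x \<in> sec \<Longrightarrow> finite (supp B x)"
  by (simp add: sec_def)

lemma secI: "\<lbrakk>\<And>t. x t \<in> carrier (F t); finite (supp B x)\<rbrakk> \<Longrightarrow> x \<in> sec"
  unfolding sec_def by blast

lemma not_supp: "t \<notin> supp B x \<Longrightarrow> x t = \<zero>\<^bsub>F t\<^esub>"
  by (simp add: supp_def)

lemma szero_closed [simp]: "szero \<in> sec"
  by (simp add: sec_def szero_def supp_def)

lemma splus_closed [simp]: "\<lbrakk>x \<in> sec; y \<in> sec\<rbrakk> \<Longrightarrow> splus x y \<in> sec"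
  by (auto simp: sec_def splus_def supp_def intro: rev_finite_subset[of "supp B x \<union> supp B y"])

lemma sscale_closed [simp]: "x \<in> sec \<Longrightarrow> sscale c x \<in> sec"
  by (auto simp: sec_def sscale_def supp_def elim!: rev_finite_subset)

lemma supp_sstar: "supp B (sstar x) \<subseteq> uminus ` supp B x"
proof
  fix t assume "t \<in> supp B (sstar x)"
  then have "x (- t) \<noteq> \<zero>\<^bsub>F (- t)\<^esub>"
    using star_zero[of "- t"] by (auto simp: supp_def sstar_def)
  then show "t \<in> uminus ` supp B x" by (auto simp: supp_def intro!: image_eqI[of _ _ "- t"])
qed

lemma sstar_closed [simp]:
  assumes "x \<in> sec"
  shows "sstar x \<in> sec"
proof -
  have "sstar x t \<in> carrier (F t)" for t
    using star_closed[OF sec_closed[OF assms], of "- t"] by (simp add: sstar_def)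
  moreover have "finite (supp B (sstar x))"
    using finite_subset[OF supp_sstar[of x]] assms by simp
  ultimately show ?thesis by (rule secI)
qed

lemma supp_single: "supp B (single t b) \<subseteq> {t}"
  by (auto simp: supp_def single_def)

lemma single_closed [simp]: "b \<in> carrier (F t) \<Longrightarrow> single t b \<in> sec"
  using finite_subset[OF supp_single[of t b]] by (intro secI) (auto simp: single_def)

lemma sscale_neg_splus:
  assumes "x \<in> sec"
  shows "splus (sscale (-1) x) x = szero"
proof
  fix t
  show "splus (sscale (-1) x) x t = szero t"
    using sec_closed[OF assms, of t] fb.M.l_neg[of "x t" t]
    by (simp add: splus_def sscale_def szero_def fb.minus_eq_scale)
qed

lemma splus_assoc:
  assumes "x \<in> sec" "y \<in> sec" "z \<in> sec"
  shows "splus (splus x y) z = splus x (splus y z)"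
  using fb.M.a_assoc[OF sec_closed[OF assms(1)] sec_closed[OF assms(2)] sec_closed[OF assms(3)]]
  by (simp add: splus_def fun_eq_iff)

lemma splus_commute:
  assumes "x \<in> sec" "y \<in> sec"
  shows "splus x y = splus y x"
  using fb.M.a_comm[OF sec_closed[OF assms(1)] sec_closed[OF assms(2)]]
  by (simp add: splus_def fun_eq_iff)

lemma splus_szero_left [simp]:
  assumes "x \<in> sec"
  shows "splus szero x = x"
  using fb.M.l_zero[OF sec_closed[OF assms]] by (simp add: splus_def szero_def fun_eq_iff)

lemma sections_module: "Module.module (class_ring :: complex ring) (sections B N)"
proof (rule moduleI)
  show "cring (class_ring :: complex ring)"
    by (rule Module.module.axioms(1)[OF complex_banach_space.axioms(1)[OF fibre_banach]])
  have "\<exists>y\<in>sec. splus y x = szero" if "x \<in> sec" for x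
    using sscale_neg_splus[OF that] sscale_closed[OF that] by blast
  then show "abelian_group (sections B N)"
    by (intro abelian_groupI; unfold sections_simps)
      (assumption | rule splus_closed szero_closed splus_assoc splus_szero_left splus_commute | blast)+
  fix c d :: complex and x y
  assume "x \<in> carrier (sections B N)"
  then have x: "x \<in> sec" by (simp only: sections_simps)
  note cx = sec_closed[OF x]
  show "c \<odot>\<^bsub>sections B N\<^esub> x \<in> carrier (sections B N)"
    using x by (simp only: sections_simps sscale_closed)
  show "(c \<oplus>\<^bsub>class_ring\<^esub> d) \<odot>\<^bsub>sections B N\<^esub> x
      = c \<odot>\<^bsub>sections B N\<^esub> x \<oplus>\<^bsub>sections B N\<^esub> d \<odot>\<^bsub>sections B N\<^esub> x"
    unfolding sections_simps class_ring_simps'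
    using fb.scale_left_distrib[OF cx] by (simp add: fun_eq_iff splus_def sscale_def)
  show "(c \<otimes>\<^bsub>class_ring\<^esub> d) \<odot>\<^bsub>sections B N\<^esub> x = c \<odot>\<^bsub>sections B N\<^esub> (d \<odot>\<^bsub>sections B N\<^esub> x)"
    unfolding sections_simps class_ring_simps'
    using fb.scale_scale[OF cx] by (simp add: fun_eq_iff sscale_def)
  show "\<one>\<^bsub>class_ring\<^esub> \<odot>\<^bsub>sections B N\<^esub> x = x"
    unfolding sections_simps class_ring_simps'
    using fb.scale_one[OF cx] by (simp add: fun_eq_iff sscale_def)
  assume "y \<in> carrier (sections B N)"
  then have "y \<in> sec" by (simp only: sections_simps)
  then show "c \<odot>\<^bsub>sections B N\<^esub> (x \<oplus>\<^bsub>sections B N\<^esub> y)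
      = c \<odot>\<^bsub>sections B N\<^esub> x \<oplus>\<^bsub>sections B N\<^esub> c \<odot>\<^bsub>sections B N\<^esub> y"
    unfolding sections_simps
    using fb.scale_right_distrib[OF cx sec_closed] by (simp add: fun_eq_iff splus_def sscale_def)
qed

lemma a_minus_sections: 
  assumes "x \<in> sec" "y \<in> sec"
  shows "x \<ominus>\<^bsub>sections B N\<^esub> y = splus x (sscale (-1) y)"
proof -
  interpret m: Module.module "class_ring :: complex ring" "sections B N" by (rule sections_module)
  have "\<ominus>\<^bsub>sections B N\<^esub> y = sscale (-1) y"
    by (rule m.M.minus_equality) (use assms sscale_neg_splus in \<open>auto simp: sections_simps\<close>)
  then show ?thesis by (simp only: a_minus_def sections_simps)
qed

lemma sec_eq_single_splus:
  assumes "x \<in> sec"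
  shows "x = splus (single t (x t)) (x(t := \<zero>\<^bsub>F t\<^esub>))"
  using sec_closed[OF assms] by (auto simp: fun_eq_iff splus_def single_def)

text \<open>Removing one point of the support at a time. Additive identities thereby reduce to
  one-point sections, on which convolution is the product of the bundle.\<close>

lemma sec_induct [consumes 1, case_names zero add]:
  assumes "x \<in> sec"
    and "P szero"
    and "\<And>t b x. \<lbrakk>b \<in> carrier (F t); x \<in> sec; P x\<rbrakk> \<Longrightarrow> P (splus (single t b) x)"
  shows "P x"
  using assms(1)
proof (induction "card (supp B x)" arbitrary: x rule: less_induct)
  case less
  show ?case
  proof (cases "supp B x = {}")
    case True
    then have "x = szero" by (auto simp: fun_eq_iff szero_def supp_def)
    then show ?thesis using assms(2) by simp
  next
    case False
    then obtain t where t: "t \<in> supp B x" by auto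
    let ?y = "x(t := \<zero>\<^bsub>F t\<^esub>)"
    have supp: "supp B ?y = supp B x - {t}" by (auto simp: supp_def)
    then have y: "?y \<in> sec" using less.prems by (intro secI) (auto intro: sec_closed)
    have "card (supp B ?y) < card (supp B x)"
      using t less.prems unfolding supp by (intro card_Diff1_less) auto
    then have "P ?y" using less.hyps y by blast
    then have "P (splus (single t (x t)) ?y)" using less.prems y by (intro assms(3)) (auto intro: sec_closed)
    then show ?thesis using sec_eq_single_splus[OF less.prems, of t] by simp
  qed
qed

lemma conv_summand [simp]:
  "\<lbrakk>x \<in> sec; y \<in> sec\<rbrakk> \<Longrightarrow> x t \<diamondop> y (- t + s) \<in> carrier (F s)"
  by (rule mult_closed'[of _ t _ "- t + s"]) (auto intro: sec_closed)

text \<open>The defining sum runs over the support of x, which changes under addition; a common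
  index set allows sums for different sections to be compared.\<close>

lemma conv_superset:
  assumes "x \<in> sec" "y \<in> sec" "finite A" "supp B x \<subseteq> A"
  shows "conv x y s = (\<Oplus>\<^bsub>F s\<^esub>t\<in>A. x t \<diamondop> y (- t + s))"
  unfolding conv_def
proof (rule fb.M.add.finprod_mono_neutral_cong_left)
  fix t assume "t \<in> A - supp B x"
  then have "x t = \<zero>\<^bsub>F t\<^esub>" using not_supp by blast
  then show "x t \<diamondop> y (- t + s) = \<zero>\<^bsub>F s\<^esub>"
    using mult_zero_left[of "y (- t + s)" "- t + s" t] sec_closed[OF assms(2)] by simp
qed (use assms in auto)

lemma conv_value_closed [simp]: "\<lbrakk>x \<in> sec; y \<in> sec\<rbrakk> \<Longrightarrow> conv x y s \<in> carrier (F s)"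
  unfolding conv_def by (rule fb.M.finsum_closed) auto

lemma conv_splus_left:
  assumes "x \<in> sec" "y \<in> sec" "z \<in> sec"
  shows "conv (splus x y) z = splus (conv x z) (conv y z)"
proof
  fix s
  let ?A = "supp B x \<union> supp B y"
  have sub: "supp B (splus x y) \<subseteq> ?A" by (auto simp: supp_def splus_def)
  have dist: "splus x y t \<diamondop> z (- t + s) = x t \<diamondop> z (- t + s) \<oplus>\<^bsub>F s\<^esub> y t \<diamondop> z (- t + s)" for t
    using mult_add_left[OF sec_closed[OF assms(1)] sec_closed[OF assms(2)] sec_closed[OF assms(3)], of t "- t + s"]
    by (simp add: splus_def)
  have "conv (splus x y) z s = (\<Oplus>\<^bsub>F s\<^esub>t\<in>?A. x t \<diamondop> z (- t + s) \<oplus>\<^bsub>F s\<^esub> y t \<diamondop> z (- t + s))"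
    using conv_superset[OF splus_closed[OF assms(1,2)] assms(3) _ sub] assms by (simp add: dist)
  also have "\<dots> = (\<Oplus>\<^bsub>F s\<^esub>t\<in>?A. x t \<diamondop> z (- t + s)) \<oplus>\<^bsub>F s\<^esub> (\<Oplus>\<^bsub>F s\<^esub>t\<in>?A. y t \<diamondop> z (- t + s))"
    by (rule fb.M.finsum_addf) (use assms in auto)
  also have "\<dots> = conv x z s \<oplus>\<^bsub>F s\<^esub> conv y z s"
    using conv_superset[OF assms(1,3), of ?A] conv_superset[OF assms(2,3), of ?A] assms by simp
  finally show "conv (splus x y) z s = splus (conv x z) (conv y z) s" by (simp add: splus_def)
qed

lemma conv_splus_right:
  assumes "x \<in> sec" "y \<in> sec" "z \<in> sec"
  shows "conv x (splus y z) = splus (conv x y) (conv x z)"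
proof
  fix s
  have dist: "x t \<diamondop> splus y z (- t + s) = x t \<diamondop> y (- t + s) \<oplus>\<^bsub>F s\<^esub> x t \<diamondop> z (- t + s)" for t
    using mult_add_right[OF sec_closed[OF assms(1)] sec_closed[OF assms(2)] sec_closed[OF assms(3)], of t "- t + s"]
    by (simp add: splus_def)
  show "conv x (splus y z) s = splus (conv x y) (conv x z) s"
    unfolding splus_def[of "conv x y"] conv_def dist
    by (rule fb.M.finsum_addf) (use assms in auto)
qed

lemma finsum_scale:
  assumes "finite A" "\<And>i. i \<in> A \<Longrightarrow> f i \<in> carrier (F s)"
  shows "c \<odot>\<^bsub>F s\<^esub> finsum (F s) f A = (\<Oplus>\<^bsub>F s\<^esub>i\<in>A. c \<odot>\<^bsub>F s\<^esub> f i)"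
  using assms by (intro finsum_hom) (auto simp: fb.scale_right_distrib fb.M.abelian_monoid_axioms)

lemma conv_sscale_left:
  assumes "x \<in> sec" "y \<in> sec"
  shows "conv (sscale c x) y = sscale c (conv x y)"
proof
  fix s
  have sub: "supp B (sscale c x) \<subseteq> supp B x" by (auto simp: supp_def sscale_def)
  have dist: "sscale c x t \<diamondop> y (- t + s) = c \<odot>\<^bsub>F s\<^esub> (x t \<diamondop> y (- t + s))" for t
    using mult_smult_left[OF sec_closed[OF assms(1)] sec_closed[OF assms(2)], where z = c]
    by (simp add: sscale_def)
  show "conv (sscale c x) y s = sscale c (conv x y) s"
    using conv_superset[OF sscale_closed[OF assms(1)] assms(2) sec_finite[OF assms(1)] sub, of s] assms
    by (simp add: dist finsum_scale[symmetric]) (simp add: sscale_def conv_def)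
qed

lemma conv_sscale_right:
  assumes "x \<in> sec" "y \<in> sec"
  shows "conv x (sscale c y) = sscale c (conv x y)"
proof
  fix s
  have dist: "x t \<diamondop> sscale c y (- t + s) = c \<odot>\<^bsub>F s\<^esub> (x t \<diamondop> y (- t + s))" for t
    using mult_smult_right[OF sec_closed[OF assms(1)] sec_closed[OF assms(2)], where z = c]
    by (simp add: sscale_def)
  show "conv x (sscale c y) s = sscale c (conv x y) s"
    unfolding sscale_def[of c "conv x y"] conv_def dist
    using assms by (intro finsum_scale[symmetric]) auto
qed

lemma conv_szero_left [simp]: "conv szero y = szero"
  by (simp add: fun_eq_iff conv_def szero_def supp_def)

lemma sscale_0 [simp]:
  assumes "x \<in> sec"
  shows "sscale 0 x = szero"
  using fb.scale_zero_left[OF sec_closed[OF assms]] by (simp add: fun_eq_iff sscale_def szero_def)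

lemma conv_single:
  assumes "b \<in> carrier (F t)" "y \<in> sec"
  shows "conv (single t b) y s = b \<diamondop> y (- t + s)"
proof -
  have "b \<diamondop> y (- t + s) \<in> carrier (F s)"
    using assms sec_closed by (intro mult_closed'[of _ t _ "- t + s"]) auto
  moreover have "conv (single t b) y s = (\<Oplus>\<^bsub>F s\<^esub>r\<in>{t}. single t b r \<diamondop> y (- r + s))"
    using assms by (intro conv_superset supp_single) auto
  ultimately show ?thesis by (simp add: single_def)
qed

lemma conv_single_single:
  assumes "a \<in> carrier (F s)" "b \<in> carrier (F t)"
  shows "conv (single s a) (single t b) = single (s + t) (a \<diamondop> b)"
proof
  fix r
  have "- s + r = t \<longleftrightarrow> r = s + t" by (metis add_minus_cancel minus_add_cancel)
  moreover have "a \<diamondop> \<zero>\<^bsub>F (- s + r)\<^esub> = \<zero>\<^bsub>F r\<^esub>"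
    using mult_zero_right[OF assms(1), of "- s + r"] by simp
  ultimately show "conv (single s a) (single t b) r = single (s + t) (a \<diamondop> b) r"
    using assms by (auto simp: conv_single) (auto simp: single_def)
qed

lemma conv_single_closed:
  assumes "b \<in> carrier (F t)" "y \<in> sec"
  shows "conv (single t b) y \<in> sec"
proof -
  have "supp B (conv (single t b) y) \<subseteq> (+) t ` supp B y"
  proof
    fix s assume "s \<in> supp B (conv (single t b) y)"
    then have "y (- t + s) \<noteq> \<zero>\<^bsub>F (- t + s)\<^esub>"
      using assms mult_zero_right[OF assms(1), of "- t + s"]
      by (auto simp: supp_def conv_single)
    then show "s \<in> (+) t ` supp B y" by (auto simp: supp_def intro!: image_eqI[of _ _ "- t + s"])
  qed
  then have "finite (supp B (conv (single t b) y))" by (rule finite_subset) (simp add: assms)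
  then show ?thesis using assms by (intro secI) auto
qed

lemma conv_closed [simp]:
  assumes "x \<in> sec" "y \<in> sec"
  shows "conv x y \<in> sec"
  using assms
  by (induction rule: sec_induct) (simp_all add: conv_splus_left conv_single_closed)

lemma conv_szero_right [simp]: "x \<in> sec \<Longrightarrow> conv x szero = szero"
  using conv_sscale_right[of x szero 0] by simp

text \<open>Only x and y are reduced to one-point sections. Left convolution by
  \<open>single\<close> translates and multiplies values, so z can stay arbitrary and associativity
  of the bundle applies pointwise.\<close>

lemma conv_assoc:
  assumes "x \<in> sec" "y \<in> sec" "z \<in> sec"
  shows "conv (conv x y) z = conv x (conv y z)"
proof -
  have 1: "conv (conv (single s a) (single t b)) z = conv (single s a) (conv (single t b) z)"
    if "a \<in> carrier (F s)" "b \<in> carrier (F t)" for s a t b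
  proof
    fix r
    have r: "- (s + t) + r = - t + (- s + r)" by (simp only: minus_add add.assoc)
    show "conv (conv (single s a) (single t b)) z r = conv (single s a) (conv (single t b) z) r"
      using that assms mult_closed[OF that] conv_single_closed[OF that(2) assms(3)]
        assoc[OF that sec_closed[OF assms(3), of "- t + (- s + r)"]]
      by (simp only: conv_single_single conv_single r)
  qed
  have 2: "conv (conv (single s a) y) z = conv (single s a) (conv y z)"
    if "a \<in> carrier (F s)" for s a
    using assms(2)
    by (induction rule: sec_induct) (simp_all add: 1 that assms conv_splus_left conv_splus_right)
  show ?thesis
    using assms(1)
    by (induction rule: sec_induct) (simp_all add: 2 assms conv_splus_left)
qed

lemma sstar_splus:
  assumes "x \<in> sec" "y \<in> sec"
  shows "sstar (splus x y) = splus (sstar x) (sstar y)"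
proof
  fix t
  show "sstar (splus x y) t = splus (sstar x) (sstar y) t"
    using star_add[OF sec_closed[OF assms(1)] sec_closed[OF assms(2)], of "- t"]
    by (simp add: sstar_def splus_def)
qed

lemma sstar_sscale:
  assumes "x \<in> sec"
  shows "sstar (sscale c x) = sscale (cnj c) (sstar x)"
proof
  fix t
  show "sstar (sscale c x) t = sscale (cnj c) (sstar x) t"
    using star_smult[OF sec_closed[OF assms, of "- t"], of c] by (simp add: sstar_def sscale_def)
qed

lemma sstar_szero [simp]: "sstar szero = szero"
proof
  fix t
  show "sstar szero t = szero t" using star_zero[of "- t"] by (simp add: sstar_def szero_def)
qed

lemma sstar_sstar [simp]:
  assumes "x \<in> sec"
  shows "sstar (sstar x) = x"
proof
  fix t
  show "sstar (sstar x) t = x t" using star_star'[OF sec_closed[OF assms], of t] by (simp add: sstar_def)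
qed

lemma sstar_single:
  assumes "b \<in> carrier (F t)"
  shows "sstar (single t b) = single (- t) (adj b)"
proof
  fix s
  show "sstar (single t b) s = single (- t) (adj b) s"
    using star_zero[of "- s"] by (auto simp: sstar_def single_def)
qed

lemma sstar_conv:
  assumes "x \<in> sec" "y \<in> sec"
  shows "sstar (conv x y) = conv (sstar y) (sstar x)"
proof -
  have 1: "sstar (conv (single s a) (single t b)) = conv (sstar (single t b)) (sstar (single s a))"
    if "a \<in> carrier (F s)" "b \<in> carrier (F t)" for s a t b
    using that mult_closed[OF that] star_closed[of a s] star_closed[of b t]
    by (simp add: conv_single_single sstar_single minus_add star_mult'[of _ s _ t])
  have 2: "sstar (conv (single s a) y) = conv (sstar y) (sstar (single s a))"
    if "a \<in> carrier (F s)" for s a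
    using assms(2)
    by (induction rule: sec_induct) (simp_all add: 1 that conv_splus_left conv_splus_right sstar_splus)
  show ?thesis
    using assms(1)
    by (induction rule: sec_induct)
      (simp_all add: 2 assms conv_splus_left conv_splus_right sstar_splus)
qed

text \<open>Right convolution by \<open>single 0 a\<close> stands for the right module action of a;
  its value at 0 is all the inner product sees.\<close>

lemma conv_single_unit:
  assumes "x \<in> sec" "a \<in> carrier (F 0)"
  shows "conv x (single 0 a) 0 = x 0 \<diamondop> a"
  using assms(1)
proof (induction rule: sec_induct)
  case zero
  then show ?case using assms mult_zero_left[of a 0 0] by (simp add: szero_def[of 0])
next
  case (add t b x)
  have "conv (single t b) (single 0 a) 0 = single t b 0 \<diamondop> a"
    using add assms mult_zero_left[of a 0 0] by (auto simp: conv_single_single single_def)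
  then show ?case
    using add assms single_closed[OF add(1)] sec_closed[OF single_closed[OF add(1)], of 0] sec_closed[OF add(2), of 0]
      mult0_add_left[of "single t b 0" "x 0" a 0]
    by (simp add: conv_splus_left) (simp add: splus_def)
qed

end

text \<open>The Cauchy-Schwarz inequality and the bound for left convolution rest on approximate
  square roots and so are first shown for norms strictly below 1. Dividing by any r > a and letting
  r tend to a yields the general case.\<close>

lemma le_mult_limit:
  fixes v a c :: real
  assumes "\<And>r. a < r \<Longrightarrow> v \<le> r * c" "0 \<le> c"
  shows "v \<le> a * c"
proof (rule field_le_epsilon)
  fix e :: real assume e: "0 < e"
  have "v \<le> (a + e / (c + 1)) * c" using e assms by (intro assms(1)) simp
  also have "\<dots> \<le> a * c + e" using e assms(2) by (simp add: field_simps)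
  finally show "v \<le> a * c + e" .
qed

context fell_bundle
begin

subsection \<open>The inner product of sections\<close>

text \<open>Taken as the value of x*y at 0, so that sesquilinearity, symmetry and the adjoint
  relation \<open>ip_conv\<close> follow from the *-algebra of sections.\<close>

definition ip :: "('g \<Rightarrow> 'b) \<Rightarrow> ('g \<Rightarrow> 'b) \<Rightarrow> 'b" where
  "ip x y = conv (sstar x) y 0"

lemma ip_closed [simp]: "\<lbrakk>x \<in> sec; y \<in> sec\<rbrakk> \<Longrightarrow> ip x y \<in> carrier (F 0)"
  by (simp add: ip_def)

lemma adj_mult_closed: "\<lbrakk>x \<in> carrier (F t); y \<in> carrier (F t)\<rbrakk> \<Longrightarrow> adj x \<diamondop> y \<in> carrier (F 0)"
  by (rule mult_closed'[of _ "- t" _ t]) (auto intro: star_closed)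

lemma ip_superset:
  assumes "x \<in> sec" "y \<in> sec" "finite A" "supp B x \<subseteq> A"
  shows "ip x y = (\<Oplus>\<^bsub>F 0\<^esub>t\<in>A. adj (x t) \<diamondop> y t)"
proof -
  have "supp B (sstar x) \<subseteq> uminus ` A" using supp_sstar[of x] assms(4) by blast
  then have "ip x y = (\<Oplus>\<^bsub>F 0\<^esub>t\<in>uminus ` A. sstar x t \<diamondop> y (- t + 0))"
    unfolding ip_def using assms by (intro conv_superset) auto
  also have "\<dots> = (\<Oplus>\<^bsub>F 0\<^esub>t\<in>A. sstar x (- t) \<diamondop> y (- (- t) + 0))"
  proof (rule fb.M.finsum_reindex)
    show "(\<lambda>t. sstar x t \<diamondop> y (- t + 0)) \<in> uminus ` A \<rightarrow> carrier (F 0)"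
      using conv_summand[OF sstar_closed[OF assms(1)] assms(2)] by blast
  qed (auto intro: inj_onI)
  finally show ?thesis by (simp add: sstar_def)
qed

lemma section_inner_eq: "\<lbrakk>x \<in> sec; y \<in> sec\<rbrakk> \<Longrightarrow> section_inner B x y = ip x y"
  by (simp add: section_inner_def ip_superset[of x y "supp B x"])

lemma splus_0: "splus x y 0 = x 0 \<oplus>\<^bsub>F 0\<^esub> y 0"
  by (simp add: splus_def)

lemma sscale_at_0: "sscale c x 0 = c \<odot>\<^bsub>F 0\<^esub> x 0"
  by (simp add: sscale_def)

lemma ip_splus_left:
  "\<lbrakk>x \<in> sec; y \<in> sec; z \<in> sec\<rbrakk> \<Longrightarrow> ip (splus x y) z = ip x z \<oplus>\<^bsub>F 0\<^esub> ip y z"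
  by (simp add: ip_def sstar_splus conv_splus_left splus_0)

lemma ip_splus_right:
  "\<lbrakk>x \<in> sec; y \<in> sec; z \<in> sec\<rbrakk> \<Longrightarrow> ip x (splus y z) = ip x y \<oplus>\<^bsub>F 0\<^esub> ip x z"
  by (simp add: ip_def conv_splus_right splus_0)

lemma ip_sscale_left: "\<lbrakk>x \<in> sec; y \<in> sec\<rbrakk> \<Longrightarrow> ip (sscale c x) y = cnj c \<odot>\<^bsub>F 0\<^esub> ip x y"
  by (simp add: ip_def sstar_sscale conv_sscale_left sscale_at_0)

lemma ip_sscale_right: "\<lbrakk>x \<in> sec; y \<in> sec\<rbrakk> \<Longrightarrow> ip x (sscale c y) = c \<odot>\<^bsub>F 0\<^esub> ip x y"
  by (simp add: ip_def conv_sscale_right sscale_at_0)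

lemma adj_ip:
  assumes "x \<in> sec" "y \<in> sec"
  shows "adj (ip x y) = ip y x"
proof -
  have "adj (ip x y) = sstar (conv (sstar x) y) 0" by (simp add: ip_def sstar_def[of "conv _ _"])
  then show ?thesis using assms by (simp add: sstar_conv ip_def)
qed

lemma ip_conv:
  assumes "x \<in> sec" "y \<in> sec" "z \<in> sec"
  shows "ip (conv x y) z = ip y (conv (sstar x) z)"
  using assms by (simp add: ip_def sstar_conv conv_assoc)

lemma ip_unit_right:
  assumes "x \<in> sec" "y \<in> sec" "a \<in> carrier (F 0)"
  shows "ip x (conv y (single 0 a)) = ip x y \<diamondop> a"
  using assms conv_single_unit[of "conv (sstar x) y" a]
  by (simp add: ip_def flip: conv_assoc)

lemma ip_unit_left:
  assumes "x \<in> sec" "y \<in> sec" "a \<in> carrier (F 0)"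
  shows "ip (conv x (single 0 a)) y = adj a \<diamondop> ip x y"
proof -
  have "ip (conv x (single 0 a)) y = adj (ip y (conv x (single 0 a)))"
    using assms by (simp add: adj_ip)
  then show ?thesis using assms by (simp add: ip_unit_right star_mult'[of _ 0 _ 0] adj_ip)
qed

lemma pos_finsum: "(\<And>i. i \<in> A \<Longrightarrow> pos (f i)) \<Longrightarrow> pos (finsum (F 0) f A)"
proof (induction A rule: infinite_finite_induct)
  case (insert i A)
  then have "f \<in> A \<rightarrow> carrier (F 0)" "f i \<in> carrier (F 0)" by auto
  then show ?case using insert by (simp add: fb.M.finsum_insert pos_add)
qed (auto simp: fb.M.finsum_infinite pos_0)

lemma pos_ip:
  assumes "x \<in> sec"
  shows "pos (ip x x)"
  using ip_superset[OF assms assms _ order_refl] assms pos_star_mult[OF sec_closed[OF assms]]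
  by (simp add: pos_finsum)

lemma approx_sqrt:
  assumes "k \<in> carrier (F 0)" "adj k = k" "nrm (F 0) k < 1" "0 < \<epsilon>"
  obtains w where "opn k (1 - [:0, 1:] - w * w) < \<epsilon>"
  using poly_seminorm.approx_sqrt_one_minus[OF opn_seminorm[OF assms(1,2)], of "[:0, 1:]"]
    opn_le_nrm[OF assms(1)] assms(3,4) by fastforce

lemma ev_sqrt_defect:
  assumes k: "k \<in> carrier (F 0)" "adj k = k" and x: "x \<in> carrier (F t)"
  shows "adj x \<diamondop> ev t k (1 - [:0, 1:] - w * w) x =
    adj x \<diamondop> x \<oplus>\<^bsub>F 0\<^esub> (-1) \<odot>\<^bsub>F 0\<^esub> (adj x \<diamondop> (k \<diamondop> x)) \<oplus>\<^bsub>F 0\<^esub>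
      (-1) \<odot>\<^bsub>F 0\<^esub> (adj (ev t k w x) \<diamondop> ev t k w x)"
proof -
  have c: "adj x \<in> carrier (F (- t))" "k \<diamondop> x \<in> carrier (F t)" "ev t k (w * w) x \<in> carrier (F t)"
    using k x by (auto intro: star_closed)
  then show ?thesis
    unfolding ev_star_ev[OF k x] ev_diff[OF k(1) x] ev_1[OF k(1) x] ev_X[OF k(1) x]
    using x by (simp add: mult_add_right[OF c(1), of _ t, simplified] mult_smult_right[OF c(1), of _ t, simplified])
qed

text \<open>With k = <x,x>, a = <x,y> and z = xa - y, one has <z,z> = a*ka - 2a*a + <y,y>. Adding
  a*a and a*(1 - k)a leaves <y,y>. All summands are positive, so ||a*a|| is at most
  ||<y,y>||.\<close>

lemma cauchy_schwarz_contraction: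
  assumes x: "x \<in> sec" and y: "y \<in> sec" and lt: "nrm (F 0) (ip x x) < 1"
  shows "(nrm (F 0) (ip x y))\<^sup>2 \<le> nrm (F 0) (ip y y)"
proof -
  define k where "k = ip x x"
  define a where "a = ip x y"
  have ka: "k \<in> carrier (F 0)" "adj k = k" "a \<in> carrier (F 0)" "ip y x = adj a" "nrm (F 0) k < 1"
    using x y lt by (auto simp: k_def a_def adj_ip)
  have "(nrm (F 0) a)\<^sup>2 \<le> nrm (F 0) (ip y y) + e * (nrm (F 0) a)\<^sup>2" if e: "0 < e" for e
  proof -
    obtain w where w: "opn k (1 - [:0, 1:] - w * w) < e" using approx_sqrt[OF ka(1,2,5) e] .
    \<comment> \<open>Stands for sqrt(1 - k) a: the element v*v is positive and equals a*(1 - k)a up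
      to \<open>err\<close>.\<close>
    define v where "v = ev 0 k w a"
    define z where "z = splus (conv x (single 0 a)) (sscale (-1) y)"
    define err where "err = adj a \<diamondop> ev 0 k (1 - [:0, 1:] - w * w) a"
    define p q r h where "p = adj a \<diamondop> a" and "q = adj a \<diamondop> (k \<diamondop> a)" and "r = adj v \<diamondop> v" and "h = ip y y"
    have c: "p \<in> carrier (F 0)" "q \<in> carrier (F 0)" "r \<in> carrier (F 0)" "h \<in> carrier (F 0)"
      "err \<in> carrier (F 0)" "z \<in> sec" "v \<in> carrier (F 0)"
      using ka x y by (auto simp: p_def q_def r_def h_def err_def z_def v_def)
    have err: "err = p \<oplus>\<^bsub>F 0\<^esub> (-1) \<odot>\<^bsub>F 0\<^esub> q \<oplus>\<^bsub>F 0\<^esub> (-1) \<odot>\<^bsub>F 0\<^esub> r"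
      unfolding err_def p_def q_def r_def v_def by (rule ev_sqrt_defect) (use ka in auto)
    have "ip z z = (q \<oplus>\<^bsub>F 0\<^esub> (-1) \<odot>\<^bsub>F 0\<^esub> p) \<oplus>\<^bsub>F 0\<^esub> ((-1) \<odot>\<^bsub>F 0\<^esub> p \<oplus>\<^bsub>F 0\<^esub> h)"
      using x y ka
      by (simp add: z_def ip_splus_left ip_splus_right ip_sscale_left ip_sscale_right
          ip_unit_left ip_unit_right assoc[of _ 0 _ 0 _ 0] fb.scale_scale fb.scale_right_distrib
          mult0_add_left[of _ _ _ 0] mult0_scale_left[of _ _ 0] p_def q_def h_def flip: k_def a_def)
    then have "p \<oplus>\<^bsub>F 0\<^esub> (r \<oplus>\<^bsub>F 0\<^esub> ip z z)
        = p \<oplus>\<^bsub>F 0\<^esub> ((-1) \<odot>\<^bsub>F 0\<^esub> p \<oplus>\<^bsub>F 0\<^esub> (r \<oplus>\<^bsub>F 0\<^esub> (q \<oplus>\<^bsub>F 0\<^esub> ((-1) \<odot>\<^bsub>F 0\<^esub> p \<oplus>\<^bsub>F 0\<^esub> h))))"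
      using c by (simp add: fb_ac)
    also have "\<dots> = r \<oplus>\<^bsub>F 0\<^esub> (q \<oplus>\<^bsub>F 0\<^esub> ((-1) \<odot>\<^bsub>F 0\<^esub> p \<oplus>\<^bsub>F 0\<^esub> h))"
      using c by (intro fb.cancel_scale) auto
    also have "\<dots> = h \<oplus>\<^bsub>F 0\<^esub> (-1) \<odot>\<^bsub>F 0\<^esub> err"
      using c by (simp add: err fb.scale_right_distrib fb.scale_scale fb_ac)
    finally have eq: "p \<oplus>\<^bsub>F 0\<^esub> (r \<oplus>\<^bsub>F 0\<^esub> ip z z) = h \<oplus>\<^bsub>F 0\<^esub> (-1) \<odot>\<^bsub>F 0\<^esub> err" .
    have "(nrm (F 0) a)\<^sup>2 = nrm (F 0) p" using norm_star_mult[OF ka(3)] by (simp add: p_def)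
    also have "\<dots> \<le> nrm (F 0) (p \<oplus>\<^bsub>F 0\<^esub> (r \<oplus>\<^bsub>F 0\<^esub> ip z z))"
      unfolding p_def r_def using ka c by (intro pos_nrm_mono pos_add pos_star_mult[of _ 0] pos_ip)
    also have "\<dots> \<le> nrm (F 0) h + nrm (F 0) err"
      unfolding eq using c fb.nrm_triangle[of h 0 "(-1) \<odot>\<^bsub>F 0\<^esub> err"] by (simp add: fb.nrm_smult)
    also have "nrm (F 0) err \<le> nrm (F 0) a * nrm (F 0) (ev 0 k (1 - [:0, 1:] - w * w) a)"
      using nrm_mult0[of "adj a" "ev 0 k (1 - [:0, 1:] - w * w) a" 0] norm_star[OF ka(3)] ka
      by (simp add: err_def)
    also have "\<dots> \<le> nrm (F 0) a * (e * nrm (F 0) a)"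
      using ev_opn[OF ka(1,3), of "1 - [:0, 1:] - w * w"] fb.nrm_nonneg[OF ka(3)]
        mult_right_mono[OF less_imp_le[OF w] fb.nrm_nonneg[OF ka(3)]]
      by (intro mult_left_mono) linarith+
    finally show ?thesis by (simp add: h_def power2_eq_square algebra_simps)
  qed note * = this
  have "(nrm (F 0) a)\<^sup>2 \<le> nrm (F 0) (ip y y) + e" if e: "0 < e" for e
  proof -
    have "0 < e / ((nrm (F 0) a)\<^sup>2 + 1)" using e by (simp add: add_nonneg_pos)
    then have "(nrm (F 0) a)\<^sup>2 \<le> nrm (F 0) (ip y y) + e / ((nrm (F 0) a)\<^sup>2 + 1) * (nrm (F 0) a)\<^sup>2"
      by (rule *)
    also have "e / ((nrm (F 0) a)\<^sup>2 + 1) * (nrm (F 0) a)\<^sup>2 \<le> e"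
    proof -
      have "e / (c + 1) * c \<le> e" if "0 \<le> c" for c using that e by (simp add: field_simps)
      then show ?thesis by simp
    qed
    finally show ?thesis by simp
  qed
  then show ?thesis unfolding a_def by (rule field_le_epsilon)
qed

section \<open>The l_2 norm of sections and the bound for the left regular representation\<close>

definition nrm2 :: "('g \<Rightarrow> 'b) \<Rightarrow> real" where
  "nrm2 x = sqrt (nrm (F 0) (ip x x))"

lemma nrm2_nonneg: "x \<in> sec \<Longrightarrow> 0 \<le> nrm2 x"
  by (simp add: nrm2_def fb.nrm_nonneg)

lemma nrm2_square: "x \<in> sec \<Longrightarrow> (nrm2 x)\<^sup>2 = nrm (F 0) (ip x x)"
  by (simp add: nrm2_def fb.nrm_nonneg)

lemma nrm2_sscale: "x \<in> sec \<Longrightarrow> nrm2 (sscale c x) = cmod c * nrm2 x"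
  by (simp add: nrm2_def ip_sscale_left ip_sscale_right fb.nrm_smult real_sqrt_mult flip: mult.assoc)

lemma nrm2_szero [simp]: "nrm2 szero = 0"
  by (simp add: nrm2_def ip_def) (simp add: szero_def)

lemma scaled_contraction:
  assumes x: "x \<in> sec" and r: "nrm2 x < r"
  shows "nrm2 (sscale (of_real (1 / r)) x) < 1"
  using r nrm2_nonneg[OF x] by (simp add: nrm2_sscale[OF x] norm_divide)

lemma cauchy_schwarz:
  assumes x: "x \<in> sec" and y: "y \<in> sec"
  shows "nrm (F 0) (ip x y) \<le> nrm2 x * nrm2 y"
proof -
  have le: "nrm (F 0) (ip x y) \<le> r * nrm2 y" if r: "nrm2 x < r" for r
  proof -
    let ?x = "sscale (of_real (1 / r)) x"
    have r0: "0 < r" using r nrm2_nonneg[OF x] by simp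
    have "(nrm2 ?x)\<^sup>2 < 1"
      using scaled_contraction[OF x r] nrm2_nonneg[of ?x] x by (simp add: power_less_one_iff)
    then have "(nrm (F 0) (ip ?x y))\<^sup>2 \<le> (nrm2 y)\<^sup>2"
      using cauchy_schwarz_contraction[of ?x y] x y by (simp add: nrm2_square)
    then have "nrm (F 0) (ip ?x y) \<le> nrm2 y" using nrm2_nonneg[OF y] by (rule power2_le_imp_le)
    then show ?thesis
      using x y r0 by (simp add: ip_sscale_left fb.nrm_smult norm_divide field_simps)
  qed
  then show ?thesis by (rule le_mult_limit[OF _ nrm2_nonneg[OF y]])
qed

lemma nrm2_triangle:
  assumes x: "x \<in> sec" and y: "y \<in> sec"
  shows "nrm2 (splus x y) \<le> nrm2 x + nrm2 y"
proof -
  have "(nrm2 (splus x y))\<^sup>2 = nrm (F 0) ((ip x x \<oplus>\<^bsub>F 0\<^esub> ip x y) \<oplus>\<^bsub>F 0\<^esub> (ip y x \<oplus>\<^bsub>F 0\<^esub> ip y y))"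
    using x y by (simp add: nrm2_square ip_splus_left ip_splus_right fb_ac)
  also have "\<dots> \<le> (nrm (F 0) (ip x x) + nrm (F 0) (ip x y)) + (nrm (F 0) (ip y x) + nrm (F 0) (ip y y))"
    using x y by (intro order_trans[OF fb.nrm_triangle] add_mono fb.nrm_triangle) auto
  also have "\<dots> \<le> ((nrm2 x)\<^sup>2 + nrm2 x * nrm2 y) + (nrm2 y * nrm2 x + (nrm2 y)\<^sup>2)"
    using x y by (intro add_mono cauchy_schwarz) (auto simp: nrm2_square)
  also have "\<dots> = (nrm2 x + nrm2 y)\<^sup>2" by (simp add: power2_eq_square algebra_simps)
  finally show ?thesis using nrm2_nonneg x y by (auto intro: power2_le_imp_le)
qed

lemma nrm2_single: "b \<in> carrier (F t) \<Longrightarrow> nrm2 (single t b) = nrm (F t) b"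
  using star_closed[of b t] adj_mult_closed[of b t b]
  by (simp add: nrm2_def ip_def sstar_single conv_single_single single_def norm_star_mult fb.nrm_nonneg)

text \<open>With k = b*b, the inner square of bx is <x,kx>, and <x,x> = <x,kx> + <x,(1 - k)x>. The
  last term is positive up to a small error, because 1 - k has an approximate root w(k) that acts on
  each value of x.\<close>

lemma nrm2_conv_single_contraction:
  assumes b: "b \<in> carrier (F s)" "nrm (F s) b < 1" and x: "x \<in> sec"
  shows "nrm2 (conv (single s b) x) \<le> nrm2 x"
proof -
  define k where "k = adj b \<diamondop> b"
  have k: "k \<in> carrier (F 0)" "adj k = k" "nrm (F 0) k < 1"
    using adj_mult_closed[OF b(1) b(1)] pos_adj[OF pos_star_mult[OF b(1)]] norm_star_mult[OF b(1)]
      b(2) fb.nrm_nonneg[OF b(1)] by (auto simp: k_def power_less_one_iff)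
  define kx where "kx = conv (single 0 k) x"
  have kx: "kx \<in> sec" "kx t = k \<diamondop> x t" for t
    using k x by (auto simp: kx_def conv_single)
  have ip_kx: "ip (conv (single s b) x) (conv (single s b) x) = ip x kx"
    using b x k star_closed[OF b(1)]
    by (simp add: ip_conv sstar_single conv_single_single kx_def k_def flip: conv_assoc)
  \<comment> \<open>Polynomials of k are bounded fibre by fibre, so the error is measured by the
    squared norms of the values of x. What matters is that M does not depend on e.\<close>
  define M where "M = (\<Sum>t\<in>supp B x. nrm (F t) (x t) * nrm (F t) (x t))"
  have M: "0 \<le> M" unfolding M_def by (intro sum_nonneg) auto
  have "nrm (F 0) (ip x kx) \<le> nrm (F 0) (ip x x) + e * M" if e: "0 < e" for e
  proof -
    obtain w where w: "opn k (1 - [:0, 1:] - w * w) < e" using approx_sqrt[OF k e] .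
    define wx where "wx = (\<lambda>t. ev t k w (x t))"
    define px where "px = (\<lambda>t. ev t k (1 - [:0, 1:] - w * w) (x t))"
    have ev_zero: "ev t k p \<zero>\<^bsub>F t\<^esub> = \<zero>\<^bsub>F t\<^esub>" for t p
      using ev_scale_arg[OF k(1), of "\<zero>\<^bsub>F t\<^esub>" t p 0] k by simp
    have ev_sec: "(\<lambda>t. ev t k p (x t)) \<in> sec" for p
    proof (rule secI)
      show "ev t k p (x t) \<in> carrier (F t)" for t using k sec_closed[OF x] by simp
      have "supp B (\<lambda>t. ev t k p (x t)) \<subseteq> supp B x" by (auto simp: supp_def ev_zero)
      then show "finite (supp B (\<lambda>t. ev t k p (x t)))" by (rule finite_subset) (simp add: x)
    qed
    have wp: "wx \<in> sec" "px \<in> sec" using ev_sec by (simp_all add: wx_def px_def)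
    have supp_wx: "supp B wx \<subseteq> supp B x" by (auto simp: supp_def wx_def ev_zero)
    define err where "err = ip x px"
    have sum: "ip u v = (\<Oplus>\<^bsub>F 0\<^esub>t\<in>supp B x. adj (u t) \<diamondop> v t)"
      if "u \<in> sec" "v \<in> sec" "supp B u \<subseteq> supp B x" for u v
      using that x by (intro ip_superset) auto
    have summand: "(\<lambda>t. adj (u t) \<diamondop> v t) \<in> supp B x \<rightarrow> carrier (F 0)" if "u \<in> sec" "v \<in> sec" for u v
      using adj_mult_closed[OF sec_closed[OF that(1)] sec_closed[OF that(2)]] by blast
    have "err \<oplus>\<^bsub>F 0\<^esub> (ip x kx \<oplus>\<^bsub>F 0\<^esub> ip wx wx)
       = (\<Oplus>\<^bsub>F 0\<^esub>t\<in>supp B x. adj (x t) \<diamondop> px t \<oplus>\<^bsub>F 0\<^esub> (adj (x t) \<diamondop> kx t \<oplus>\<^bsub>F 0\<^esub> adj (wx t) \<diamondop> wx t))"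
      (is "_ = ?rhs")
      unfolding err_def sum[OF x wp(2) order_refl] sum[OF x kx(1) order_refl] sum[OF wp(1) wp(1) supp_wx]
    proof -
      have "(\<lambda>t. adj (x t) \<diamondop> kx t \<oplus>\<^bsub>F 0\<^esub> adj (wx t) \<diamondop> wx t) \<in> supp B x \<rightarrow> carrier (F 0)"
        using summand[OF x kx(1)] summand[OF wp(1) wp(1)] by (auto simp: Pi_iff)
      then show "(\<Oplus>\<^bsub>F 0\<^esub>t\<in>supp B x. adj (x t) \<diamondop> px t) \<oplus>\<^bsub>F 0\<^esub>
          ((\<Oplus>\<^bsub>F 0\<^esub>t\<in>supp B x. adj (x t) \<diamondop> kx t) \<oplus>\<^bsub>F 0\<^esub> (\<Oplus>\<^bsub>F 0\<^esub>t\<in>supp B x. adj (wx t) \<diamondop> wx t)) = ?rhs"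
        by (simp only: fb.M.finsum_addf[OF summand[OF x wp(2)]]
            fb.M.finsum_addf[OF summand[OF x kx(1)] summand[OF wp(1) wp(1)]])
    qed
    also have "\<dots> = (\<Oplus>\<^bsub>F 0\<^esub>t\<in>supp B x. adj (x t) \<diamondop> x t)"
    proof (rule fb.M.finsum_cong'[OF refl summand[OF x x]])
      fix t
      let ?p = "adj (x t) \<diamondop> x t" and ?q = "adj (x t) \<diamondop> kx t" and ?r = "adj (wx t) \<diamondop> wx t"
      have c: "?p \<in> carrier (F 0)" "?q \<in> carrier (F 0)" "?r \<in> carrier (F 0)"
        by (rule adj_mult_closed[OF sec_closed sec_closed]; rule x kx(1) wp(1))+
      have "adj (x t) \<diamondop> px t = ?p \<oplus>\<^bsub>F 0\<^esub> (-1) \<odot>\<^bsub>F 0\<^esub> ?q \<oplus>\<^bsub>F 0\<^esub> (-1) \<odot>\<^bsub>F 0\<^esub> ?r"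
        unfolding px_def kx wx_def by (rule ev_sqrt_defect[OF k(1,2) sec_closed[OF x]])
      then have "adj (x t) \<diamondop> px t \<oplus>\<^bsub>F 0\<^esub> (?q \<oplus>\<^bsub>F 0\<^esub> ?r)
         = ?q \<oplus>\<^bsub>F 0\<^esub> ((-1) \<odot>\<^bsub>F 0\<^esub> ?q \<oplus>\<^bsub>F 0\<^esub> (?r \<oplus>\<^bsub>F 0\<^esub> ((-1) \<odot>\<^bsub>F 0\<^esub> ?r \<oplus>\<^bsub>F 0\<^esub> ?p)))"
        using c by (simp add: fb_ac)
      then show "adj (x t) \<diamondop> px t \<oplus>\<^bsub>F 0\<^esub> (?q \<oplus>\<^bsub>F 0\<^esub> ?r) = ?p"
        by (simp only: fb.cancel_scale[OF c(2)] fb.cancel_scale[OF c(3)] fb.M.a_closed fb.scale_closed c)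
    qed
    also have "\<dots> = ip x x" using sum[OF x x order_refl] by simp
    finally have eq: "err \<oplus>\<^bsub>F 0\<^esub> (ip x kx \<oplus>\<^bsub>F 0\<^esub> ip wx wx) = ip x x" .
    have err_closed: "err \<in> carrier (F 0)" using x wp by (simp add: err_def)
    have "nrm (F 0) err \<le> (\<Sum>t\<in>supp B x. nrm (F 0) (adj (x t) \<diamondop> px t))"
      unfolding err_def sum[OF x wp(2) order_refl]
      using summand[OF x wp(2)] by (intro fb.nrm_finsum_le) auto
    also have "\<dots> \<le> (\<Sum>t\<in>supp B x. e * (nrm (F t) (x t) * nrm (F t) (x t)))"
    proof (rule sum_mono)
      fix t
      have xt: "x t \<in> carrier (F t)" using x by (rule sec_closed)
      have "nrm (F 0) (adj (x t) \<diamondop> px t) \<le> nrm (F t) (x t) * nrm (F t) (px t)"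
        using norm_mult[OF star_closed[OF xt] sec_closed[OF wp(2), of t]] norm_star[OF xt] by simp
      also have "\<dots> \<le> nrm (F t) (x t) * (e * nrm (F t) (x t))"
      proof (rule mult_left_mono)
        show "nrm (F t) (px t) \<le> e * nrm (F t) (x t)"
        using ev_opn[OF k(1) xt, of "1 - [:0, 1:] - w * w"] w fb.nrm_nonneg[OF xt]
          unfolding px_def by (meson less_imp_le mult_right_mono order_trans)
      qed (rule fb.nrm_nonneg[OF xt])
      finally show "nrm (F 0) (adj (x t) \<diamondop> px t) \<le> e * (nrm (F t) (x t) * nrm (F t) (x t))"
        by (simp only: ac_simps)
    qed
    also have "\<dots> = e * M" by (simp add: M_def sum_distrib_left)
    finally have err_le: "nrm (F 0) err \<le> e * M" .
    have "nrm (F 0) (ip x kx) \<le> nrm (F 0) (ip x kx \<oplus>\<^bsub>F 0\<^esub> ip wx wx)"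
      using pos_ip[of "conv (single s b) x"] pos_ip[OF wp(1)] b x
      by (intro pos_nrm_mono) (simp_all add: ip_kx)
    also have "ip x kx \<oplus>\<^bsub>F 0\<^esub> ip wx wx = ip x x \<oplus>\<^bsub>F 0\<^esub> (-1) \<odot>\<^bsub>F 0\<^esub> err"
      unfolding eq[symmetric]
      using x wp kx err_closed fb.cancel_scale[of err 0 "ip x kx \<oplus>\<^bsub>F 0\<^esub> ip wx wx"]
      by (simp add: fb_ac)
    also have "nrm (F 0) \<dots> \<le> nrm (F 0) (ip x x) + nrm (F 0) err"
      using fb.nrm_triangle[of "ip x x" 0 "(-1) \<odot>\<^bsub>F 0\<^esub> err"] x err_closed by (simp add: fb.nrm_smult)
    finally show ?thesis using err_le by simp
  qed note * = this
  have "nrm (F 0) (ip x kx) \<le> nrm (F 0) (ip x x)"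
  proof (rule field_le_epsilon)
    fix e :: real assume e: "0 < e"
    have "nrm (F 0) (ip x kx) \<le> nrm (F 0) (ip x x) + e / (M + 1) * M" using e M by (intro *) simp
    also have "e / (M + 1) * M \<le> e" using e M by (simp add: field_simps)
    finally show "nrm (F 0) (ip x kx) \<le> nrm (F 0) (ip x x) + e" by simp
  qed
  then show ?thesis by (simp add: nrm2_def ip_kx)
qed

lemma nrm2_conv_single:
  assumes b: "b \<in> carrier (F s)" and x: "x \<in> sec"
  shows "nrm2 (conv (single s b) x) \<le> nrm (F s) b * nrm2 x"
proof -
  have le: "nrm2 (conv (single s b) x) \<le> r * nrm2 x" if r: "nrm (F s) b < r" for r
  proof -
    let ?b = "of_real (1 / r) \<odot>\<^bsub>F s\<^esub> b"
    have r0: "0 < r" using r fb.nrm_nonneg[OF b] by simp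
    have "nrm (F s) ?b < 1" using r r0 b by (simp add: fb.nrm_smult norm_divide)
    then have "nrm2 (conv (single s ?b) x) \<le> nrm2 x"
      using b x by (intro nrm2_conv_single_contraction) auto
    moreover have "single s ?b = sscale (of_real (1 / r)) (single s b)"
      by (auto simp: fun_eq_iff single_def sscale_def)
    ultimately show ?thesis
      using b x r0 by (simp add: conv_sscale_left nrm2_sscale norm_divide field_simps)
  qed
  then show ?thesis by (rule le_mult_limit[OF _ nrm2_nonneg[OF x]])
qed

text \<open>A crude constant, the sum of the fibre norms. It is needed before the reduced norm can
  be used: it bounds the set whose \<open>Sup\<close> that norm is.\<close>

lemma nrm2_conv_bounded:
  assumes "x \<in> sec"
  shows "\<exists>C\<ge>0. \<forall>y\<in>sec. nrm2 (conv x y) \<le> C * nrm2 y"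
  using assms
proof (induction rule: sec_induct)
  case zero
  then show ?case by (intro exI[of _ 0]) auto
next
  case (add t b x)
  then obtain C where C: "0 \<le> C" "\<And>y. y \<in> sec \<Longrightarrow> nrm2 (conv x y) \<le> C * nrm2 y" by auto
  have "nrm2 (conv (splus (single t b) x) y) \<le> (nrm (F t) b + C) * nrm2 y" if y: "y \<in> sec" for y
    using nrm2_triangle[of "conv (single t b) y" "conv x y"] nrm2_conv_single[OF add(1) y] C(2)[OF y] add y
    by (simp add: conv_splus_left algebra_simps)
  then show ?case using C fb.nrm_nonneg[OF add(1)] by (intro exI[of _ "nrm (F t) b + C"]) auto
qed

end

section \<open>Completions and the reduced norm\<close>

subsection \<open>Completions of seminormed modules\<close>

context seminormed_module
begin

lemma diff_closed [simp]: "\<lbrakk>x \<in> carrier V; y \<in> carrier V\<rbrakk> \<Longrightarrow> x \<ominus> y \<in> carrier V"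
  by (simp add: diff_eq_scale)

lemma diff_zero [simp]: "x \<in> carrier V \<Longrightarrow> x \<ominus> \<zero> = x"
  by (simp add: diff_eq_scale)

lemma nrm_diff_self [simp]: "x \<in> carrier V \<Longrightarrow> nrm V (x \<ominus> x) = 0"
  by (simp add: M.minus_eq M.r_neg)

lemma nrm_diff_commute:
  assumes "x \<in> carrier V" "y \<in> carrier V"
  shows "nrm V (x \<ominus> y) = nrm V (y \<ominus> x)"
proof -
  have "y \<ominus> x = (-1) \<odot>\<^bsub>V\<^esub> (x \<ominus> y)"
    using assms by (simp add: diff_eq_scale scale_right_distrib scale_scale M.a_comm)
  then show ?thesis using assms by (simp add: seminorm_smult)
qed

lemma diff_add_diff:
  assumes "x \<in> carrier V" "y \<in> carrier V" "z \<in> carrier V"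
  shows "(x \<ominus> y) \<oplus> (y \<ominus> z) = x \<ominus> z"
proof -
  have "(x \<ominus> y) \<oplus> (y \<ominus> z) = y \<oplus> ((-1) \<odot>\<^bsub>V\<^esub> y \<oplus> (x \<oplus> (-1) \<odot>\<^bsub>V\<^esub> z))"
    using assms by (simp add: diff_eq_scale M.a_ac)
  then show ?thesis using assms by (simp add: cancel_scale diff_eq_scale)
qed

lemma nrm_diff_triangle:
  "\<lbrakk>x \<in> carrier V; y \<in> carrier V; z \<in> carrier V\<rbrakk> \<Longrightarrow> nrm V (x \<ominus> z) \<le> nrm V (x \<ominus> y) + nrm V (y \<ominus> z)"
  using seminorm_triangle[of "x \<ominus> y" "y \<ominus> z"] by (simp add: diff_add_diff)

lemma nrm_abs_diff_le:
  assumes "x \<in> carrier V" "y \<in> carrier V"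
  shows "\<bar>nrm V x - nrm V y\<bar> \<le> nrm V (x \<ominus> y)"
proof -
  have le: "nrm V x \<le> nrm V (x \<ominus> y) + nrm V y" if "x \<in> carrier V" "y \<in> carrier V" for x y
    using nrm_diff_triangle[of x y "\<zero>"] that by simp
  show ?thesis using le[of x y] le[of y x] assms nrm_diff_commute[of x y] by simp
qed

lemma nrm_add_diff_le:
  assumes "x \<in> carrier V" "y \<in> carrier V" "x' \<in> carrier V" "y' \<in> carrier V"
  shows "nrm V ((x \<oplus> y) \<ominus> (x' \<oplus> y')) \<le> nrm V (x \<ominus> x') + nrm V (y \<ominus> y')"
proof -
  have "(x \<oplus> y) \<ominus> (x' \<oplus> y') = (x \<ominus> x') \<oplus> (y \<ominus> y')"
    using assms by (simp add: diff_eq_scale scale_right_distrib M.a_ac)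
  then show ?thesis using assms by (simp add: seminorm_triangle)
qed

lemma cauchy_seqs_closed: "X \<in> cauchy_seqs V \<Longrightarrow> X n \<in> carrier V"
  by (simp add: cauchy_seqs_def)

lemma cauchy_seqsD:
  "\<lbrakk>X \<in> cauchy_seqs V; 0 < \<epsilon>\<rbrakk> \<Longrightarrow> \<exists>N. \<forall>m\<ge>N. \<forall>n\<ge>N. nrm V (X m \<ominus> X n) < \<epsilon>"
  by (simp add: cauchy_seqs_def)

lemma const_cauchy [simp]: "x \<in> carrier V \<Longrightarrow> (\<lambda>_. x) \<in> cauchy_seqs V"
  by (simp add: cauchy_seqs_def)

text \<open>Two controlling sequences serve unary and binary operations at once; for a unary one the
  second is the constant zero sequence.\<close>

lemma cauchy_seqs_lipschitz:
  assumes X: "X \<in> cauchy_seqs V" and Y: "Y \<in> cauchy_seqs V" and Z: "\<And>n. Z n \<in> carrier V"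
    and le: "\<And>m n. nrm V (Z m \<ominus> Z n) \<le> K * nrm V (X m \<ominus> X n) + K * nrm V (Y m \<ominus> Y n)"
  shows "Z \<in> cauchy_seqs V"
  unfolding cauchy_seqs_def
proof (intro CollectI conjI allI impI)
  fix \<epsilon> :: real assume \<epsilon>: "0 < \<epsilon>"
  define \<delta> where "\<delta> = \<epsilon> / (2 * (\<bar>K\<bar> + 1))"
  have \<delta>: "0 < \<delta>" using \<epsilon> by (simp add: \<delta>_def)
  obtain M where M: "\<And>m n. \<lbrakk>m \<ge> M; n \<ge> M\<rbrakk> \<Longrightarrow> nrm V (X m \<ominus> X n) < \<delta>"
    using cauchy_seqsD[OF X \<delta>] by blast
  obtain N where N: "\<And>m n. \<lbrakk>m \<ge> N; n \<ge> N\<rbrakk> \<Longrightarrow> nrm V (Y m \<ominus> Y n) < \<delta>"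
    using cauchy_seqsD[OF Y \<delta>] by blast
  have "nrm V (Z m \<ominus> Z n) < \<epsilon>" if "m \<ge> max M N" "n \<ge> max M N" for m n
  proof -
    have K: "K * r < (\<bar>K\<bar> + 1) * \<delta>" if "0 \<le> r" "r < \<delta>" for r
    proof -
      have "K * r \<le> (\<bar>K\<bar> + 1) * r" using that by (intro mult_right_mono) auto
      also have "\<dots> < (\<bar>K\<bar> + 1) * \<delta>" using that by (intro mult_strict_left_mono) auto
      finally show ?thesis .
    qed
    have "K * nrm V (X m \<ominus> X n) + K * nrm V (Y m \<ominus> Y n) < (\<bar>K\<bar> + 1) * \<delta> + (\<bar>K\<bar> + 1) * \<delta>"
      using that cauchy_seqs_closed[OF X] cauchy_seqs_closed[OF Y]
      by (intro add_strict_mono K M N seminorm_nonneg) auto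
    also have "\<dots> = \<epsilon>"
    proof -
      have "\<epsilon> / (2 * c) * c = \<epsilon> / 2" if "0 < c" for c using that by simp
      from this[of "\<bar>K\<bar> + 1"] show ?thesis by (simp add: \<delta>_def mult.commute)
    qed
    finally show ?thesis using le[of m n] by simp
  qed
  then show "\<exists>N. \<forall>m\<ge>N. \<forall>n\<ge>N. nrm V (Z m \<ominus> Z n) < \<epsilon>" by blast
qed (rule Z)

lemma null_relI:
  "\<lbrakk>X \<in> cauchy_seqs V; Y \<in> cauchy_seqs V; (\<lambda>n. nrm V (X n \<ominus> Y n)) \<longlonglongrightarrow> 0\<rbrakk> \<Longrightarrow> (X, Y) \<in> null_rel V"
  by (simp add: null_rel_def)

lemma null_relD:
  assumes "(X, Y) \<in> null_rel V"
  shows "X \<in> cauchy_seqs V" "Y \<in> cauchy_seqs V" "(\<lambda>n. nrm V (X n \<ominus> Y n)) \<longlonglongrightarrow> 0"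
  using assms by (simp_all add: null_rel_def)

lemma null_rel_lipschitz:
  assumes X: "(X, X') \<in> null_rel V" and Y: "(Y, Y') \<in> null_rel V"
    and Z: "Z \<in> cauchy_seqs V" "Z' \<in> cauchy_seqs V"
    and le: "\<And>n. nrm V (Z n \<ominus> Z' n) \<le> K * nrm V (X n \<ominus> X' n) + K * nrm V (Y n \<ominus> Y' n)"
  shows "(Z, Z') \<in> null_rel V"
proof (rule null_relI[OF Z])
  have "(\<lambda>n. K * nrm V (X n \<ominus> X' n) + K * nrm V (Y n \<ominus> Y' n)) \<longlonglongrightarrow> K * 0 + K * 0"
    by (intro tendsto_intros null_relD X Y)
  then have lim: "(\<lambda>n. K * nrm V (X n \<ominus> X' n) + K * nrm V (Y n \<ominus> Y' n)) \<longlonglongrightarrow> 0" by simp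
  show "(\<lambda>n. nrm V (Z n \<ominus> Z' n)) \<longlonglongrightarrow> 0"
    using le cauchy_seqs_closed[OF Z(1)] cauchy_seqs_closed[OF Z(2)]
    by (intro tendsto_sandwich[OF _ _ tendsto_const lim]) (auto intro!: always_eventually seminorm_nonneg)
qed

lemma null_rel_refl: "X \<in> cauchy_seqs V \<Longrightarrow> (X, X) \<in> null_rel V"
  by (intro null_relI) (simp_all add: nrm_diff_self[OF cauchy_seqs_closed])

lemma equiv_null_rel: "equiv (cauchy_seqs V) (null_rel V)"
proof (rule equivI)
  show "null_rel V \<subseteq> cauchy_seqs V \<times> cauchy_seqs V" by (auto dest: null_relD)
  show "refl_on (cauchy_seqs V) (null_rel V)"
    by (auto intro!: refl_onI null_rel_refl dest: null_relD)
  show "sym (null_rel V)"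
  proof (rule symI)
    fix X Y assume XY: "(X, Y) \<in> null_rel V"
    note c = cauchy_seqs_closed[OF null_relD(1)[OF XY]] cauchy_seqs_closed[OF null_relD(2)[OF XY]]
    show "(Y, X) \<in> null_rel V"
      using null_relD[OF XY] by (intro null_relI) (simp_all add: nrm_diff_commute[OF c(2) c(1)])
  qed
  show "trans (null_rel V)"
  proof (rule transI)
    fix X Y Z assume XY: "(X, Y) \<in> null_rel V" and YZ: "(Y, Z) \<in> null_rel V"
    show "(X, Z) \<in> null_rel V"
      using nrm_diff_triangle[OF cauchy_seqs_closed[OF null_relD(1)[OF XY]]
          cauchy_seqs_closed[OF null_relD(2)[OF XY]] cauchy_seqs_closed[OF null_relD(2)[OF YZ]]]
      by (intro null_rel_lipschitz[OF XY YZ null_relD(1)[OF XY] null_relD(2)[OF YZ], where K = 1]) simp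
  qed
qed

lemma cclass_eqI: "(X, Y) \<in> null_rel V \<Longrightarrow> cclass V X = cclass V Y"
  unfolding cclass_def by (rule equiv_class_eq[OF equiv_null_rel])

lemma carrier_completion: "carrier (completion V) = cauchy_seqs V // null_rel V"
  by (simp add: completion_def)

lemma cclass_closed [simp]: "X \<in> cauchy_seqs V \<Longrightarrow> cclass V X \<in> carrier (completion V)"
  unfolding carrier_completion cclass_def by (rule quotientI)

lemma completion_cases:
  assumes "P \<in> carrier (completion V)"
  obtains X where "X \<in> cauchy_seqs V" "P = cclass V X"
  using assms unfolding carrier_completion cclass_def by (auto elim: quotientE)

text \<open>The only access to the representative picked by \<open>SOME\<close>: operations on the
  completion are computed on it and then moved to a given sequence by this relation.\<close>

lemma rep_cclass:
  assumes "X \<in> cauchy_seqs V"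
  shows "(X, rep (cclass V X)) \<in> null_rel V"
proof -
  have "X \<in> cclass V X" using null_rel_refl[OF assms] by (simp add: cclass_def)
  then have "rep (cclass V X) \<in> cclass V X" unfolding rep_def by (rule someI[of "\<lambda>Y. Y \<in> cclass V X"])
  then show ?thesis by (simp add: cclass_def)
qed

lemma lift1_cclass:
  assumes X: "X \<in> cauchy_seqs V"
    and f: "\<And>x. x \<in> carrier V \<Longrightarrow> f x \<in> carrier V"
    and lip: "\<And>x y. \<lbrakk>x \<in> carrier V; y \<in> carrier V\<rbrakk> \<Longrightarrow> nrm V (f x \<ominus> f y) \<le> K * nrm V (x \<ominus> y)"
  shows "lift1 V f (cclass V X) = cclass V (\<lambda>n. f (X n))" "(\<lambda>n. f (X n)) \<in> cauchy_seqs V"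
proof -
  have cauchy: "(\<lambda>n. f (Y n)) \<in> cauchy_seqs V" if "Y \<in> cauchy_seqs V" for Y
    using f lip cauchy_seqs_closed[OF that]
    by (intro cauchy_seqs_lipschitz[OF that const_cauchy[OF M.zero_closed], where K = K]) auto
  then show "(\<lambda>n. f (X n)) \<in> cauchy_seqs V" using X .
  have rel: "(X, rep (cclass V X)) \<in> null_rel V" using rep_cclass X .
  then have "((\<lambda>n. f (X n)), (\<lambda>n. f (rep (cclass V X) n))) \<in> null_rel V"
    using lip[OF cauchy_seqs_closed[OF null_relD(1)[OF rel]] cauchy_seqs_closed[OF null_relD(2)[OF rel]]]
    by (intro null_rel_lipschitz[OF rel null_rel_refl[OF const_cauchy[OF M.zero_closed]], where K = K])
      (auto intro: cauchy null_relD)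
  then show "lift1 V f (cclass V X) = cclass V (\<lambda>n. f (X n))"
    unfolding lift1_def by (rule cclass_eqI[symmetric])
qed

lemma nrm_cclass:
  assumes X: "X \<in> cauchy_seqs V"
  shows "(\<lambda>n. nrm V (X n)) \<longlonglongrightarrow> nrm (completion V) (cclass V X)"
proof -
  have rel: "(X, rep (cclass V X)) \<in> null_rel V" using rep_cclass X .
  let ?R = "rep (cclass V X)"
  note c = cauchy_seqs_closed[OF X] cauchy_seqs_closed[OF null_relD(2)[OF rel]]
  have "Cauchy (\<lambda>n. nrm V (?R n))"
  proof (rule CauchyI)
    fix e :: real assume "0 < e"
    then obtain N where "\<forall>m\<ge>N. \<forall>n\<ge>N. nrm V (?R m \<ominus> ?R n) < e"
      using cauchy_seqsD[OF null_relD(2)[OF rel]] by blast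
    then show "\<exists>N. \<forall>m\<ge>N. \<forall>n\<ge>N. norm (nrm V (?R m) - nrm V (?R n)) < e"
      unfolding real_norm_def using le_less_trans[OF nrm_abs_diff_le[OF c(2) c(2)]] by blast
  qed
  then have lim: "(\<lambda>n. nrm V (?R n)) \<longlonglongrightarrow> nrm (completion V) (cclass V X)"
    by (simp add: completion_def Cauchy_convergent_iff convergent_LIMSEQ_iff)
  have "(\<lambda>n. nrm V (X n) - nrm V (?R n)) \<longlonglongrightarrow> 0"
    using nrm_abs_diff_le[OF c] by (intro tendsto_0_le[OF null_relD(3)[OF rel], where K = 1])
      (auto intro!: always_eventually simp: seminorm_nonneg c)
  from tendsto_add[OF this lim] show ?thesis by simp
qed

lemma nrm_cclass_const: "x \<in> carrier V \<Longrightarrow> nrm (completion V) (cclass V (\<lambda>_. x)) = nrm V x"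
  using nrm_cclass[of "\<lambda>_. x"] by (simp add: LIMSEQ_const_iff)

text \<open>The premise asks for compatibility with null sequences instead of a global Lipschitz
  bound, because convolution is Lipschitz only on bounded sequences.\<close>

lemma lift2_cclass:
  assumes X: "X \<in> cauchy_seqs V" and Y: "Y \<in> cauchy_seqs V"
    and f: "\<And>X X' Y Y'. \<lbrakk>(X, X') \<in> null_rel V; (Y, Y') \<in> null_rel V\<rbrakk>
      \<Longrightarrow> ((\<lambda>n. f (X n) (Y n)), (\<lambda>n. f (X' n) (Y' n))) \<in> null_rel V"
  shows "lift2 V f (cclass V X) (cclass V Y) = cclass V (\<lambda>n. f (X n) (Y n))"
  unfolding lift2_def by (rule cclass_eqI[symmetric]) (rule f[OF rep_cclass[OF X] rep_cclass[OF Y]])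

lemma cauchy_add: "\<lbrakk>X \<in> cauchy_seqs V; Y \<in> cauchy_seqs V\<rbrakk> \<Longrightarrow> (\<lambda>n. X n \<oplus> Y n) \<in> cauchy_seqs V"
  by (rule cauchy_seqs_lipschitz[where K = 1 and X = X and Y = Y]) (auto simp: cauchy_seqs_closed nrm_add_diff_le)

lemma add_cclass:
  assumes "X \<in> cauchy_seqs V" "Y \<in> cauchy_seqs V"
  shows "cclass V X \<oplus>\<^bsub>completion V\<^esub> cclass V Y = cclass V (\<lambda>n. X n \<oplus> Y n)"
proof -
  have "((\<lambda>n. X n \<oplus> Y n), (\<lambda>n. X' n \<oplus> Y' n)) \<in> null_rel V"
    if "(X, X') \<in> null_rel V" "(Y, Y') \<in> null_rel V" for X X' Y Y'
    using that
    by (intro null_rel_lipschitz[OF that, where K = 1] cauchy_add)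
      (auto simp: nrm_add_diff_le cauchy_seqs_closed null_relD)
  then show ?thesis using assms by (simp add: completion_def lift2_cclass)
qed

lemma smult_cclass:
  assumes "X \<in> cauchy_seqs V"
  shows "c \<odot>\<^bsub>completion V\<^esub> cclass V X = cclass V (\<lambda>n. c \<odot>\<^bsub>V\<^esub> X n)"
proof -
  have "nrm V (c \<odot>\<^bsub>V\<^esub> x \<ominus> c \<odot>\<^bsub>V\<^esub> y) \<le> cmod c * nrm V (x \<ominus> y)"
    if "x \<in> carrier V" "y \<in> carrier V" for x y
  proof -
    have "c \<odot>\<^bsub>V\<^esub> x \<ominus> c \<odot>\<^bsub>V\<^esub> y = c \<odot>\<^bsub>V\<^esub> (x \<ominus> y)"
      using that by (simp add: diff_eq_scale scale_right_distrib scale_scale)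
    then show ?thesis using that by (simp add: seminorm_smult)
  qed
  then show ?thesis using lift1_cclass(1)[OF assms, of "\<lambda>x. c \<odot>\<^bsub>V\<^esub> x" "cmod c"] by (simp add: completion_def)
qed

lemma zero_completion: "\<zero>\<^bsub>completion V\<^esub> = cclass V (\<lambda>_. \<zero>)"
  by (simp add: completion_def)

text \<open>Structure enough for \<open>finsum\<close>, which occurs in \<open>reduced_norm\<close>
  and in \<open>matrix_positive\<close> for the reduced algebra.\<close>

lemma abelian_monoid_completion: "abelian_monoid (completion V)"
proof (rule abelian_monoidI)
  show "\<zero>\<^bsub>completion V\<^esub> \<in> carrier (completion V)" by (simp add: zero_completion)
  fix P Q assume "P \<in> carrier (completion V)" "Q \<in> carrier (completion V)"
  then obtain X Y where XY: "X \<in> cauchy_seqs V" "P = cclass V X" "Y \<in> cauchy_seqs V" "Q = cclass V Y"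
    by (metis completion_cases)
  note c = cauchy_seqs_closed[OF XY(1)] cauchy_seqs_closed[OF XY(3)]
  show "P \<oplus>\<^bsub>completion V\<^esub> Q \<in> carrier (completion V)" using XY by (simp add: add_cclass cauchy_add)
  show "\<zero>\<^bsub>completion V\<^esub> \<oplus>\<^bsub>completion V\<^esub> P = P"
    using XY c by (simp add: zero_completion add_cclass)
  show "P \<oplus>\<^bsub>completion V\<^esub> Q = Q \<oplus>\<^bsub>completion V\<^esub> P"
    using XY M.a_comm[OF c] by (simp add: add_cclass)
  fix R assume "R \<in> carrier (completion V)"
  then obtain Z where Z: "Z \<in> cauchy_seqs V" "R = cclass V Z" by (metis completion_cases)
  show "P \<oplus>\<^bsub>completion V\<^esub> Q \<oplus>\<^bsub>completion V\<^esub> R = P \<oplus>\<^bsub>completion V\<^esub> (Q \<oplus>\<^bsub>completion V\<^esub> R)"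
    using XY Z M.a_assoc[OF c cauchy_seqs_closed[OF Z(1)]] by (simp add: add_cclass cauchy_add)
qed

lemma finsum_cclass:
  assumes "finite A" "\<And>i. i \<in> A \<Longrightarrow> X i \<in> cauchy_seqs V"
  shows "finsum (completion V) (\<lambda>i. cclass V (X i)) A = cclass V (\<lambda>n. finsum V (\<lambda>i. X i n) A)"
    and "(\<lambda>n. finsum V (\<lambda>i. X i n) A) \<in> cauchy_seqs V"
proof -
  interpret C: abelian_monoid "completion V" by (rule abelian_monoid_completion)
  have "finsum (completion V) (\<lambda>i. cclass V (X i)) A = cclass V (\<lambda>n. finsum V (\<lambda>i. X i n) A)
     \<and> (\<lambda>n. finsum V (\<lambda>i. X i n) A) \<in> cauchy_seqs V"
    using assms
  proof (induction A rule: finite_induct)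
    case empty
    then show ?case by (simp add: zero_completion)
  next
    case (insert i A)
    have "finsum V (\<lambda>i. X i n) (insert i A) = X i n \<oplus> finsum V (\<lambda>i. X i n) A" for n
      using insert by (intro M.finsum_insert) (auto intro: cauchy_seqs_closed)
    moreover have "finsum (completion V) (\<lambda>i. cclass V (X i)) (insert i A)
       = cclass V (X i) \<oplus>\<^bsub>completion V\<^esub> finsum (completion V) (\<lambda>i. cclass V (X i)) A"
      using insert by (intro C.finsum_insert) auto
    ultimately show ?case using insert by (simp add: add_cclass cauchy_add)
  qed
  then show "finsum (completion V) (\<lambda>i. cclass V (X i)) A = cclass V (\<lambda>n. finsum V (\<lambda>i. X i n) A)"
    "(\<lambda>n. finsum V (\<lambda>i. X i n) A) \<in> cauchy_seqs V" by auto
qed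

end

subsection \<open>The reduced cross-sectional algebra\<close>

context fell_bundle
begin

lemma pre_l2_simps:
  "carrier (pre_l2 B) = sec" "zero (pre_l2 B) = szero" "add (pre_l2 B) = splus"
  "module.smult (pre_l2 B) = sscale"
  by (simp_all only: pre_l2_def sections_simps)

lemma nrm_pre_l2: "x \<in> sec \<Longrightarrow> nrm (pre_l2 B) x = nrm2 x"
  by (simp add: pre_l2_def sections_simps section_inner_eq nrm2_def)

sublocale L2: seminormed_module "pre_l2 B"
proof (intro seminormed_module.intro seminormed_module_axioms.intro)
  show "Module.module class_ring (pre_l2 B)" unfolding pre_l2_def by (rule sections_module)
qed (simp_all add: pre_l2_simps nrm_pre_l2 nrm2_nonneg nrm2_triangle nrm2_sscale)

lemma diff_pre_l2: "\<lbrakk>x \<in> sec; y \<in> sec\<rbrakk> \<Longrightarrow> x \<ominus>\<^bsub>pre_l2 B\<^esub> y = splus x (sscale (-1) y)"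
  unfolding pre_l2_def by (rule a_minus_sections)

lemma conv_lipschitz:
  assumes x: "x \<in> sec" and C: "\<And>y. y \<in> sec \<Longrightarrow> nrm2 (conv x y) \<le> C * nrm2 y"
    and yz: "y \<in> sec" "z \<in> sec"
  shows "nrm (pre_l2 B) (conv x y \<ominus>\<^bsub>pre_l2 B\<^esub> conv x z) \<le> C * nrm (pre_l2 B) (y \<ominus>\<^bsub>pre_l2 B\<^esub> z)"
proof -
  have "conv x y \<ominus>\<^bsub>pre_l2 B\<^esub> conv x z = conv x (y \<ominus>\<^bsub>pre_l2 B\<^esub> z)"
    using x yz by (simp add: diff_pre_l2 conv_splus_right conv_sscale_right)
  then show ?thesis using C[of "y \<ominus>\<^bsub>pre_l2 B\<^esub> z"] x yz by (simp add: diff_pre_l2 nrm_pre_l2)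
qed

lemma conv_cauchy:
  assumes "x \<in> sec" "X \<in> cauchy_seqs (pre_l2 B)"
  shows "(\<lambda>n. conv x (X n)) \<in> cauchy_seqs (pre_l2 B)"
proof -
  obtain C where "\<And>y. y \<in> sec \<Longrightarrow> nrm2 (conv x y) \<le> C * nrm2 y" using nrm2_conv_bounded assms(1) by blast
  then show ?thesis using conv_lipschitz assms(1)
    by (intro L2.lift1_cclass(2)[OF assms(2), where K = C]) (simp_all add: pre_l2_simps)
qed

text \<open>On sections the formula of \<open>lam\<close> is convolution by a one-point section, and
  \<open>nrm2_conv_single\<close> supplies the Lipschitz bound that makes it independent of the
  representative.\<close>

lemma lam_cclass:
  assumes b: "b \<in> carrier (F s)" and X: "X \<in> cauchy_seqs (pre_l2 B)"
  shows "lam B s b (cclass (pre_l2 B) X) = cclass (pre_l2 B) (\<lambda>n. conv (single s b) (X n))"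
proof -
  have rep: "rep (cclass (pre_l2 B) X) n \<in> sec" for n
    using L2.cauchy_seqs_closed[OF L2.null_relD(2)[OF L2.rep_cclass[OF X]]] by (simp add: pre_l2_simps)
  have "lam B s b (cclass (pre_l2 B) X) = lift1 (pre_l2 B) (conv (single s b)) (cclass (pre_l2 B) X)"
  proof -
    have "(\<lambda>t. b \<diamondop> rep (cclass (pre_l2 B) X) n (- s + t)) = conv (single s b) (rep (cclass (pre_l2 B) X) n)" for n
      using conv_single[OF b rep] by (simp add: fun_eq_iff)
    then show ?thesis by (simp add: lam_def lift1_def)
  qed
  also have "\<dots> = cclass (pre_l2 B) (\<lambda>n. conv (single s b) (X n))"
    using conv_lipschitz[OF single_closed[OF b] nrm2_conv_single[OF b]] b
    by (intro L2.lift1_cclass(1)[OF X, where K = "nrm (F s) b"]) (simp_all add: pre_l2_simps)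
  finally show ?thesis .
qed

lemma finsum_sections_value:
  assumes "finite A" "\<And>i. i \<in> A \<Longrightarrow> f i \<in> sec"
  shows "finsum (pre_l2 B) f A s = finsum (F s) (\<lambda>i. f i s) A"
  by (rule finsum_hom[OF L2.M.abelian_monoid_axioms fb.M.abelian_monoid_axioms, where h = "\<lambda>x. x s"])
    (simp_all only: assms pre_l2_simps sec_closed splus_def szero_def)

lemma conv_eq_finsum:
  assumes "x \<in> sec" "y \<in> sec"
  shows "finsum (pre_l2 B) (\<lambda>t. conv (single t (x t)) y) (supp B x) = conv x y"
proof
  fix s
  have "finsum (pre_l2 B) (\<lambda>t. conv (single t (x t)) y) (supp B x) s
    = (\<Oplus>\<^bsub>F s\<^esub>t\<in>supp B x. conv (single t (x t)) y s)"
    using assms by (intro finsum_sections_value) (simp_all add: sec_closed)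
  also have "\<dots> = conv x y s"
    unfolding conv_def[of x] conv_single[OF sec_closed[OF assms(1)] assms(2)] ..
  finally show "finsum (pre_l2 B) (\<lambda>t. conv (single t (x t)) y) (supp B x) s = conv x y s" .
qed

text \<open>The operators lambda_t(x(t)) add up to convolution by x, applied termwise to a Cauchy
  sequence; this turns the reduced norm into a question about sections.\<close>

lemma left_regular_cclass:
  assumes x: "x \<in> sec" and X: "X \<in> cauchy_seqs (pre_l2 B)"
  shows "(\<Oplus>\<^bsub>l2 B\<^esub>t\<in>supp B x. lam B t (x t) (cclass (pre_l2 B) X)) = cclass (pre_l2 B) (\<lambda>n. conv x (X n))"
proof -
  have "(\<Oplus>\<^bsub>l2 B\<^esub>t\<in>supp B x. lam B t (x t) (cclass (pre_l2 B) X))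
      = (\<Oplus>\<^bsub>l2 B\<^esub>t\<in>supp B x. cclass (pre_l2 B) (\<lambda>n. conv (single t (x t)) (X n)))"
    by (simp only: lam_cclass[OF sec_closed[OF x] X])
  also have "\<dots> = cclass (pre_l2 B) (\<lambda>n. finsum (pre_l2 B) (\<lambda>t. conv (single t (x t)) (X n)) (supp B x))"
    unfolding l2_def using x
    by (intro L2.finsum_cclass(1) conv_cauchy X single_closed sec_closed) simp_all
  finally show ?thesis
    using L2.cauchy_seqs_closed[OF X] x by (simp add: conv_eq_finsum pre_l2_simps)
qed

section \<open>The reduced norm as an operator norm on finitely supported sections\<close>

lemma reduced_norm_eq:
  assumes "x \<in> sec"
  shows "reduced_norm B x = Sup {nrm (l2 B) (cclass (pre_l2 B) (\<lambda>n. conv x (X n))) | X.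
    X \<in> cauchy_seqs (pre_l2 B) \<and> nrm (l2 B) (cclass (pre_l2 B) X) \<le> 1}"
  unfolding reduced_norm_def operator_norm_def
proof (rule arg_cong[where f = Sup], rule equalityI; rule subsetI)
  fix r
  assume "r \<in> {nrm (l2 B) (\<Oplus>\<^bsub>l2 B\<^esub>t\<in>supp B x. lam B t (x t) \<xi>) |\<xi>. \<xi> \<in> carrier (l2 B) \<and> nrm (l2 B) \<xi> \<le> 1}"
  then obtain \<xi> where \<xi>: "\<xi> \<in> carrier (l2 B)" "nrm (l2 B) \<xi> \<le> 1"
    "r = nrm (l2 B) (\<Oplus>\<^bsub>l2 B\<^esub>t\<in>supp B x. lam B t (x t) \<xi>)" by blast
  then obtain X where "X \<in> cauchy_seqs (pre_l2 B)" "\<xi> = cclass (pre_l2 B) X"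
    unfolding l2_def by (elim L2.completion_cases)
  with \<xi> assms show "r \<in> {nrm (l2 B) (cclass (pre_l2 B) (\<lambda>n. conv x (X n))) | X.
    X \<in> cauchy_seqs (pre_l2 B) \<and> nrm (l2 B) (cclass (pre_l2 B) X) \<le> 1}"
    by (auto simp: left_regular_cclass)
next
  fix r
  assume "r \<in> {nrm (l2 B) (cclass (pre_l2 B) (\<lambda>n. conv x (X n))) | X.
    X \<in> cauchy_seqs (pre_l2 B) \<and> nrm (l2 B) (cclass (pre_l2 B) X) \<le> 1}"
  then obtain X where X: "X \<in> cauchy_seqs (pre_l2 B)" "nrm (l2 B) (cclass (pre_l2 B) X) \<le> 1"
    "r = nrm (l2 B) (cclass (pre_l2 B) (\<lambda>n. conv x (X n)))" by blast
  moreover have "cclass (pre_l2 B) X \<in> carrier (l2 B)" unfolding l2_def using X by simp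
  ultimately show "r \<in> {nrm (l2 B) (\<Oplus>\<^bsub>l2 B\<^esub>t\<in>supp B x. lam B t (x t) \<xi>) |\<xi>. \<xi> \<in> carrier (l2 B) \<and> nrm (l2 B) \<xi> \<le> 1}"
    using left_regular_cclass[OF assms X(1)] by (intro CollectI exI[of _ "cclass (pre_l2 B) X"]) simp
qed

lemma nrm_l2_conv_le:
  assumes x: "x \<in> sec" and C: "0 \<le> C" "\<And>y. y \<in> sec \<Longrightarrow> nrm2 (conv x y) \<le> C * nrm2 y"
    and X: "X \<in> cauchy_seqs (pre_l2 B)" "nrm (l2 B) (cclass (pre_l2 B) X) \<le> 1"
  shows "nrm (l2 B) (cclass (pre_l2 B) (\<lambda>n. conv x (X n))) \<le> C"
proof -
  have Xs: "X n \<in> sec" for n using L2.cauchy_seqs_closed[OF X(1)] by (simp add: pre_l2_simps)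
  have "nrm (l2 B) (cclass (pre_l2 B) (\<lambda>n. conv x (X n))) \<le> C * nrm (l2 B) (cclass (pre_l2 B) X)"
    unfolding l2_def
  proof (rule LIMSEQ_le[OF L2.nrm_cclass[OF conv_cauchy[OF x X(1)]] tendsto_mult_left[OF L2.nrm_cclass[OF X(1)]]])
    show "\<exists>N. \<forall>n\<ge>N. nrm (pre_l2 B) (conv x (X n)) \<le> C * nrm (pre_l2 B) (X n)"
      using C(2)[OF Xs] x Xs by (simp add: nrm_pre_l2)
  qed
  also have "\<dots> \<le> C * 1" using X C by (intro mult_left_mono)
  finally show ?thesis by simp
qed

lemma reduced_norm_le:
  assumes x: "x \<in> sec" and C: "0 \<le> C" "\<And>y. y \<in> sec \<Longrightarrow> nrm2 (conv x y) \<le> C * nrm2 y"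
  shows "reduced_norm B x \<le> C"
  unfolding reduced_norm_eq[OF x]
proof (rule cSup_least)
  have "nrm (l2 B) (cclass (pre_l2 B) (\<lambda>_. szero)) = 0"
    unfolding l2_def by (subst L2.nrm_cclass_const) (simp_all add: pre_l2_simps nrm_pre_l2)
  then show "{nrm (l2 B) (cclass (pre_l2 B) (\<lambda>n. conv x (X n))) | X.
    X \<in> cauchy_seqs (pre_l2 B) \<and> nrm (l2 B) (cclass (pre_l2 B) X) \<le> 1} \<noteq> {}"
    using L2.const_cauchy[of szero] by (auto simp: pre_l2_simps intro!: exI[of _ "\<lambda>_. szero"])
qed (use nrm_l2_conv_le[OF x C] in blast)

text \<open>Together with \<open>reduced_norm_le\<close> this makes the reduced norm the least C >=
  0 that bounds convolution on sections, so the estimates for sums, products and adjoints can stay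
  there. Vectors of norm 0 cannot be normalised and are covered by the crude bound.\<close>

lemma nrm2_conv_le:
  assumes x: "x \<in> sec" and y: "y \<in> sec"
  shows "nrm2 (conv x y) \<le> reduced_norm B x * nrm2 y"
proof -
  obtain C where C: "0 \<le> C" "\<And>y. y \<in> sec \<Longrightarrow> nrm2 (conv x y) \<le> C * nrm2 y"
    using nrm2_conv_bounded[OF x] by blast
  show ?thesis
  proof (cases "nrm2 y = 0")
    case True
    then show ?thesis using C(2)[OF y] by simp
  next
    case False
    define r where "r = nrm2 y"
    have r: "0 < r" using False nrm2_nonneg[OF y] by (simp add: r_def)
    let ?y = "sscale (of_real (1 / r)) y"
    have y': "?y \<in> sec" "nrm2 ?y = 1" using y r by (simp_all add: nrm2_sscale norm_divide r_def)
    have const: "nrm (l2 B) (cclass (pre_l2 B) (\<lambda>_. z)) = nrm2 z" if "z \<in> sec" for z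
      unfolding l2_def using that by (subst L2.nrm_cclass_const) (simp_all add: pre_l2_simps nrm_pre_l2)
    have "nrm (l2 B) (cclass (pre_l2 B) (\<lambda>_. conv x ?y)) \<le> reduced_norm B x"
      unfolding reduced_norm_eq[OF x]
    proof (rule cSup_upper)
      show "nrm (l2 B) (cclass (pre_l2 B) (\<lambda>_. conv x ?y)) \<in>
        {nrm (l2 B) (cclass (pre_l2 B) (\<lambda>n. conv x (X n))) | X.
          X \<in> cauchy_seqs (pre_l2 B) \<and> nrm (l2 B) (cclass (pre_l2 B) X) \<le> 1}"
        using y' const[OF y'(1)] L2.const_cauchy[of ?y]
        by (intro CollectI exI[of _ "\<lambda>_. ?y"]) (simp add: pre_l2_simps)
      show "bdd_above {nrm (l2 B) (cclass (pre_l2 B) (\<lambda>n. conv x (X n))) | X.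
          X \<in> cauchy_seqs (pre_l2 B) \<and> nrm (l2 B) (cclass (pre_l2 B) X) \<le> 1}"
        using nrm_l2_conv_le[OF x C] by (intro bdd_aboveI[of _ C]) blast
    qed
    then have "nrm2 (conv x ?y) \<le> reduced_norm B x" using const x y' by simp
    then show ?thesis
      using x y r by (simp add: conv_sscale_right nrm2_sscale norm_divide field_simps flip: r_def)
  qed
qed

text \<open>The zero vector contributes the value 0 to a set that is bounded above.\<close>

lemma reduced_norm_nonneg: "x \<in> sec \<Longrightarrow> 0 \<le> reduced_norm B x"
proof -
  assume x: "x \<in> sec"
  obtain C where C: "0 \<le> C" "\<And>y. y \<in> sec \<Longrightarrow> nrm2 (conv x y) \<le> C * nrm2 y"
    using nrm2_conv_bounded[OF x] by blast
  let ?X = "\<lambda>_::nat. szero"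
  have const: "nrm (l2 B) (cclass (pre_l2 B) (\<lambda>_. z)) = nrm2 z" if "z \<in> sec" for z
    unfolding l2_def using that by (subst L2.nrm_cclass_const) (simp_all add: pre_l2_simps nrm_pre_l2)
  have "nrm (l2 B) (cclass (pre_l2 B) (\<lambda>n. conv x (?X n))) \<le> reduced_norm B x"
    unfolding reduced_norm_eq[OF x]
    using nrm_l2_conv_le[OF x C] const[of szero] L2.const_cauchy[of szero]
    by (intro cSup_upper bdd_aboveI[of _ C] CollectI exI[of _ ?X]) (auto simp: pre_l2_simps)
  then show ?thesis using x const[of szero] by simp
qed

lemma reduced_norm_splus:
  assumes "x \<in> sec" "y \<in> sec"
  shows "reduced_norm B (splus x y) \<le> reduced_norm B x + reduced_norm B y"
proof (rule reduced_norm_le)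
  fix z assume z: "z \<in> sec"
  show "nrm2 (conv (splus x y) z) \<le> (reduced_norm B x + reduced_norm B y) * nrm2 z"
    using nrm2_triangle[of "conv x z" "conv y z"] nrm2_conv_le[OF assms(1) z] nrm2_conv_le[OF assms(2) z] assms z
    by (simp add: conv_splus_left algebra_simps)
qed (use assms reduced_norm_nonneg in auto)

lemma reduced_norm_sscale:
  assumes "x \<in> sec"
  shows "reduced_norm B (sscale c x) = cmod c * reduced_norm B x"
proof -
  have le: "reduced_norm B (sscale c x) \<le> cmod c * reduced_norm B x" if "x \<in> sec" for c x
  proof (rule reduced_norm_le)
    fix z assume z: "z \<in> sec"
    show "nrm2 (conv (sscale c x) z) \<le> (cmod c * reduced_norm B x) * nrm2 z"
      using nrm2_conv_le[OF that z] that z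
      by (simp add: conv_sscale_left nrm2_sscale mult.assoc mult_left_mono)
  qed (use that reduced_norm_nonneg in auto)
  show ?thesis
  proof (cases "c = 0")
    case True
    then show ?thesis using le[OF assms, of 0] reduced_norm_nonneg[of szero] assms by simp
  next
    case False
    have "sscale (1 / c) (sscale c x) = x"
      using False fb.scale_scale[OF sec_closed[OF assms]] fb.scale_one[OF sec_closed[OF assms]]
      by (simp add: fun_eq_iff sscale_def)
    then have "cmod c * reduced_norm B x \<le> reduced_norm B (sscale c x)"
      using le[of "sscale c x" "1 / c"] assms False by (simp add: norm_divide field_simps)
    then show ?thesis using le[OF assms, of c] by simp
  qed
qed

lemma reduced_norm_conv:
  assumes "x \<in> sec" "y \<in> sec"
  shows "reduced_norm B (conv x y) \<le> reduced_norm B x * reduced_norm B y"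
proof (rule reduced_norm_le)
  fix z assume z: "z \<in> sec"
  have "nrm2 (conv x (conv y z)) \<le> reduced_norm B x * (reduced_norm B y * nrm2 z)"
    using nrm2_conv_le[OF assms(1), of "conv y z"] nrm2_conv_le[OF assms(2) z] assms z
      mult_left_mono[OF nrm2_conv_le[OF assms(2) z] reduced_norm_nonneg[OF assms(1)]] by simp
  then show "nrm2 (conv (conv x y) z) \<le> (reduced_norm B x * reduced_norm B y) * nrm2 z"
    using assms z by (simp add: conv_assoc mult.assoc)
qed (use assms reduced_norm_nonneg in auto)

text \<open>||x*z||^2 = ||<z, xx*z>|| is at most ||z|| ||x|| ||x*z|| by Cauchy-Schwarz. This is the
  Lipschitz bound that makes the involution of the completion well defined.\<close>

lemma reduced_norm_sstar_le:
  assumes x: "x \<in> sec"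
  shows "reduced_norm B (sstar x) \<le> reduced_norm B x"
proof (rule reduced_norm_le)
  fix z assume z: "z \<in> sec"
  let ?w = "conv (sstar x) z"
  have w: "?w \<in> sec" using x z by simp
  have "nrm2 ?w * nrm2 ?w = nrm (F 0) (ip z (conv x ?w))"
    using nrm2_square[OF w] x z by (simp add: power2_eq_square ip_conv)
  also have "\<dots> \<le> nrm2 z * nrm2 (conv x ?w)"
    using x z by (intro cauchy_schwarz) auto
  also have "\<dots> \<le> nrm2 z * (reduced_norm B x * nrm2 ?w)"
    using x z w by (intro mult_left_mono nrm2_conv_le nrm2_nonneg)
  finally have "nrm2 ?w * nrm2 ?w \<le> (reduced_norm B x * nrm2 z) * nrm2 ?w" by (simp add: ac_simps)
  then show "nrm2 ?w \<le> reduced_norm B x * nrm2 z"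
    using nrm2_nonneg[OF w] nrm2_nonneg[OF z] reduced_norm_nonneg[OF x] by (cases "nrm2 ?w = 0") auto
qed (use x reduced_norm_nonneg in auto)

text \<open>The lower bound comes from the test vector b* placed at - t: it is sent to bb* at 0, and
  ||bb*|| = ||b||^2.\<close>

lemma reduced_norm_single:
  assumes b: "b \<in> carrier (F t)"
  shows "reduced_norm B (single t b) = nrm (F t) b"
proof (rule antisym)
  show "reduced_norm B (single t b) \<le> nrm (F t) b"
    using b by (intro reduced_norm_le nrm2_conv_single) (auto simp: fb.nrm_nonneg)
  have b': "adj b \<in> carrier (F (- t))" "adj (adj b) = b" using star_closed[OF b] star_star'[OF b] by auto
  have c: "b \<diamondop> adj b \<in> carrier (F 0)" using mult_closed[OF b b'(1)] by simp
  have "nrm (F t) b * nrm (F t) b = nrm (F 0) (b \<diamondop> adj b)"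
    using norm_star_mult[OF b'(1)] norm_star[OF b] b' by (simp add: power2_eq_square)
  also have "\<dots> = nrm2 (conv (single t b) (single (- t) (adj b)))"
    using c by (simp add: conv_single_single[OF b b'(1)] nrm2_single)
  also have "\<dots> \<le> reduced_norm B (single t b) * nrm (F t) b"
    using nrm2_conv_le[OF single_closed[OF b] single_closed[OF b'(1)]] norm_star[OF b]
    by (simp add: nrm2_single[OF b'(1)])
  finally show "nrm (F t) b \<le> reduced_norm B (single t b)"
    using fb.nrm_nonneg[OF b] reduced_norm_nonneg[OF single_closed[OF b]] by (cases "nrm (F t) b = 0") auto
qed

section \<open>The reduced algebra as a completion of the *-algebra of sections\<close>

definition S where "S = sections B (reduced_norm B)"

lemma S_simps:
  "carrier S = sec" "zero S = szero" "add S = splus" "module.smult S = sscale"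
  "monoid.mult S = conv" "star S = sstar" "nrm S = reduced_norm B"
  by (simp_all only: S_def sections_simps)

sublocale S: seminormed_module S
proof (intro seminormed_module.intro seminormed_module_axioms.intro)
  show "Module.module class_ring S" unfolding S_def by (rule sections_module)
qed (simp_all add: S_simps reduced_norm_nonneg reduced_norm_splus reduced_norm_sscale)

lemma diff_S: "\<lbrakk>x \<in> sec; y \<in> sec\<rbrakk> \<Longrightarrow> x \<ominus>\<^bsub>S\<^esub> y = splus x (sscale (-1) y)"
  unfolding S_def by (rule a_minus_sections)

text \<open>From xy - x'y' = (x - x')y + x'(y - y'). The factors depend on the arguments, which is
  why boundedness of Cauchy sequences is needed next.\<close>

lemma reduced_norm_conv_diff:
  assumes "x \<in> sec" "y \<in> sec" "x' \<in> sec" "y' \<in> sec"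
  shows "nrm S (conv x y \<ominus>\<^bsub>S\<^esub> conv x' y')
    \<le> nrm S y * nrm S (x \<ominus>\<^bsub>S\<^esub> x') + nrm S x' * nrm S (y \<ominus>\<^bsub>S\<^esub> y')"
proof -
  have "(conv x y \<ominus>\<^bsub>S\<^esub> conv x' y) \<oplus>\<^bsub>S\<^esub> (conv x' y \<ominus>\<^bsub>S\<^esub> conv x' y') = conv x y \<ominus>\<^bsub>S\<^esub> conv x' y'"
    by (rule S.diff_add_diff) (simp_all add: S_simps assms)
  moreover have "conv x y \<ominus>\<^bsub>S\<^esub> conv x' y = conv (x \<ominus>\<^bsub>S\<^esub> x') y"
    "conv x' y \<ominus>\<^bsub>S\<^esub> conv x' y' = conv x' (y \<ominus>\<^bsub>S\<^esub> y')"
    using assms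
    by (simp_all add: diff_S conv_splus_left conv_splus_right conv_sscale_left conv_sscale_right)
  ultimately have "nrm S (conv x y \<ominus>\<^bsub>S\<^esub> conv x' y')
     \<le> nrm S (conv (x \<ominus>\<^bsub>S\<^esub> x') y) + nrm S (conv x' (y \<ominus>\<^bsub>S\<^esub> y'))"
    using S.seminorm_triangle[of "conv (x \<ominus>\<^bsub>S\<^esub> x') y" "conv x' (y \<ominus>\<^bsub>S\<^esub> y')"] assms
    by (simp add: S_simps diff_S)
  then show ?thesis
    using reduced_norm_conv[of "x \<ominus>\<^bsub>S\<^esub> x'" y] reduced_norm_conv[of x' "y \<ominus>\<^bsub>S\<^esub> y'"] assms
    by (simp add: S_simps diff_S mult.commute)
qed

lemma cauchy_bounded:
  assumes "X \<in> cauchy_seqs S"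
  obtains K where "\<And>n. nrm S (X n) \<le> K" "0 \<le> K"
proof -
  have "Bseq (\<lambda>n. nrm S (X n))"
    using S.nrm_cclass[OF assms] by (intro convergent_imp_Bseq convergentI)
  then obtain K where "0 < K" and K: "\<And>n. norm (nrm S (X n)) \<le> K" by (auto elim: BseqE)
  then show ?thesis using order_trans[OF abs_ge_self K[unfolded real_norm_def]] by (intro that[of K]) simp_all
qed

lemma conv_cauchy_S:
  assumes X: "X \<in> cauchy_seqs S" and Y: "Y \<in> cauchy_seqs S"
  shows "(\<lambda>n. conv (X n) (Y n)) \<in> cauchy_seqs S"
proof -
  obtain K where K: "\<And>n. nrm S (X n) \<le> K" "0 \<le> K" using cauchy_bounded[OF X] by blast
  obtain L where L: "\<And>n. nrm S (Y n) \<le> L" "0 \<le> L" using cauchy_bounded[OF Y] by blast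
  note c = S.cauchy_seqs_closed[OF X, unfolded S_simps] S.cauchy_seqs_closed[OF Y, unfolded S_simps]
  have "nrm S (conv (X m) (Y m) \<ominus>\<^bsub>S\<^esub> conv (X n) (Y n))
      \<le> (K + L) * nrm S (X m \<ominus>\<^bsub>S\<^esub> X n) + (K + L) * nrm S (Y m \<ominus>\<^bsub>S\<^esub> Y n)" for m n
  proof -
    have "nrm S (Y m) \<le> K + L" "nrm S (X n) \<le> K + L" using K(1)[of n] L(1)[of m] K(2) L(2) by auto
    then have "nrm S (Y m) * nrm S (X m \<ominus>\<^bsub>S\<^esub> X n) + nrm S (X n) * nrm S (Y m \<ominus>\<^bsub>S\<^esub> Y n)
      \<le> (K + L) * nrm S (X m \<ominus>\<^bsub>S\<^esub> X n) + (K + L) * nrm S (Y m \<ominus>\<^bsub>S\<^esub> Y n)"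
      by (intro add_mono mult_right_mono S.seminorm_nonneg S.diff_closed S.cauchy_seqs_closed X Y)
    then show ?thesis using reduced_norm_conv_diff[OF c(1) c(2) c(1) c(2), of m m n n] by linarith
  qed
  then show ?thesis using c by (intro S.cauchy_seqs_lipschitz[OF X Y, where K = "K + L"]) (simp_all add: S_simps)
qed

lemma conv_null_rel:
  assumes X: "(X, X') \<in> null_rel S" and Y: "(Y, Y') \<in> null_rel S"
  shows "((\<lambda>n. conv (X n) (Y n)), (\<lambda>n. conv (X' n) (Y' n))) \<in> null_rel S"
proof -
  note d = S.null_relD(1,2)[OF X] S.null_relD(1,2)[OF Y]
  obtain K where K: "\<And>n. nrm S (X' n) \<le> K" "0 \<le> K" using cauchy_bounded[OF d(2)] by blast
  obtain L where L: "\<And>n. nrm S (Y n) \<le> L" "0 \<le> L" using cauchy_bounded[OF d(3)] by blast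
  note c = d[THEN S.cauchy_seqs_closed, unfolded S_simps]
  have "nrm S (conv (X n) (Y n) \<ominus>\<^bsub>S\<^esub> conv (X' n) (Y' n))
      \<le> (K + L) * nrm S (X n \<ominus>\<^bsub>S\<^esub> X' n) + (K + L) * nrm S (Y n \<ominus>\<^bsub>S\<^esub> Y' n)" for n
  proof -
    have "nrm S (Y n) \<le> K + L" "nrm S (X' n) \<le> K + L" using K(1)[of n] L(1)[of n] K(2) L(2) by auto
    then have "nrm S (Y n) * nrm S (X n \<ominus>\<^bsub>S\<^esub> X' n) + nrm S (X' n) * nrm S (Y n \<ominus>\<^bsub>S\<^esub> Y' n)
      \<le> (K + L) * nrm S (X n \<ominus>\<^bsub>S\<^esub> X' n) + (K + L) * nrm S (Y n \<ominus>\<^bsub>S\<^esub> Y' n)"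
      by (intro add_mono mult_right_mono S.seminorm_nonneg S.diff_closed S.cauchy_seqs_closed d)
    then show ?thesis using reduced_norm_conv_diff[OF c(1,3,2,4), of n n n n] by linarith
  qed
  then show ?thesis
    by (intro S.null_rel_lipschitz[OF X Y conv_cauchy_S[OF d(1,3)] conv_cauchy_S[OF d(2,4)], where K = "K + L"])
qed

lemma reduced_algebra_simps:
  "carrier (reduced_algebra B) = carrier (completion S)"
  "zero (reduced_algebra B) = zero (completion S)"
  "add (reduced_algebra B) = add (completion S)"
  "module.smult (reduced_algebra B) = module.smult (completion S)"
  "nrm (reduced_algebra B) = nrm (completion S)"
  "monoid.mult (reduced_algebra B) = lift2 S conv"
  "star (reduced_algebra B) = lift1 S sstar"
  by (simp_all add: reduced_algebra_def star_completion_def cnormed.extend_def star_alg.fields_def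
      S_simps flip: S_def)

lemma abelian_monoid_reduced_algebra: "abelian_monoid (reduced_algebra B)"
  by (rule abelian_monoidI; unfold reduced_algebra_simps)
    (rule abelian_monoidE[OF S.abelian_monoid_completion]; assumption)+

section \<open>The isometric embeddings of the fibres\<close>

definition emb :: "'g \<Rightarrow> 'b \<Rightarrow> (nat \<Rightarrow> 'g \<Rightarrow> 'b) set" where
  "emb t b = cclass S (\<lambda>_. single t b)"

lemma const_single_cauchy [simp]: "b \<in> carrier (F t) \<Longrightarrow> (\<lambda>_. single t b) \<in> cauchy_seqs S"
  by (intro S.const_cauchy) (simp add: S_simps)

lemma emb_closed [simp]: "b \<in> carrier (F t) \<Longrightarrow> emb t b \<in> carrier (reduced_algebra B)"
  by (simp add: emb_def reduced_algebra_simps)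

lemma emb_add:
  assumes "a \<in> carrier (F t)" "b \<in> carrier (F t)"
  shows "emb t (a \<oplus>\<^bsub>F t\<^esub> b) = emb t a \<oplus>\<^bsub>reduced_algebra B\<^esub> emb t b"
proof -
  have "single t (a \<oplus>\<^bsub>F t\<^esub> b) = splus (single t a) (single t b)"
    using assms by (auto simp: fun_eq_iff single_def splus_def)
  then show ?thesis using assms by (simp add: emb_def reduced_algebra_simps S.add_cclass S_simps)
qed

lemma emb_zero: "emb t \<zero>\<^bsub>F t\<^esub> = \<zero>\<^bsub>reduced_algebra B\<^esub>"
proof -
  have "single t \<zero>\<^bsub>F t\<^esub> = szero" by (auto simp: fun_eq_iff single_def szero_def)
  then show ?thesis by (simp add: emb_def reduced_algebra_simps S.zero_completion S_simps)
qed

lemma emb_scale: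
  assumes "b \<in> carrier (F t)"
  shows "emb t (c \<odot>\<^bsub>F t\<^esub> b) = c \<odot>\<^bsub>reduced_algebra B\<^esub> emb t b"
proof -
  have "single t (c \<odot>\<^bsub>F t\<^esub> b) = sscale c (single t b)"
    by (auto simp: fun_eq_iff single_def sscale_def)
  then show ?thesis using assms by (simp add: emb_def reduced_algebra_simps S.smult_cclass S_simps)
qed

lemma emb_mult:
  assumes "a \<in> carrier (F s)" "b \<in> carrier (F t)"
  shows "emb (s + t) (a \<diamondop> b) = emb s a \<otimes>\<^bsub>reduced_algebra B\<^esub> emb t b"
  unfolding emb_def reduced_algebra_simps
  using S.lift2_cclass[OF const_single_cauchy[OF assms(1)] const_single_cauchy[OF assms(2)] conv_null_rel]
  by (simp add: conv_single_single[OF assms])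

lemma emb_star:
  assumes "b \<in> carrier (F t)"
  shows "emb (- t) (adj b) = star (reduced_algebra B) (emb t b)"
proof -
  have "nrm S (sstar x \<ominus>\<^bsub>S\<^esub> sstar y) \<le> 1 * nrm S (x \<ominus>\<^bsub>S\<^esub> y)" if "x \<in> carrier S" "y \<in> carrier S" for x y
  proof -
    have "sstar x \<ominus>\<^bsub>S\<^esub> sstar y = sstar (x \<ominus>\<^bsub>S\<^esub> y)"
      using that by (simp add: S_simps diff_S sstar_splus sstar_sscale)
    then show ?thesis using that reduced_norm_sstar_le[of "x \<ominus>\<^bsub>S\<^esub> y"] by (simp add: S_simps diff_S)
  qed
  then have "lift1 S sstar (cclass S (\<lambda>_. single t b)) = cclass S (\<lambda>_. sstar (single t b))"
    using assms by (intro S.lift1_cclass(1)[where K = 1]) (simp_all add: S_simps)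
  then show ?thesis by (simp add: emb_def reduced_algebra_simps sstar_single[OF assms])
qed

lemma nrm_emb: "b \<in> carrier (F t) \<Longrightarrow> nrm (reduced_algebra B) (emb t b) = nrm (F t) b"
  unfolding emb_def reduced_algebra_simps
  by (subst S.nrm_cclass_const) (simp_all add: S_simps reduced_norm_single)

lemma emb_finsum:
  assumes "finite A" "\<And>i. i \<in> A \<Longrightarrow> f i \<in> carrier (F t)"
  shows "emb t (finsum (F t) f A) = (\<Oplus>\<^bsub>reduced_algebra B\<^esub>i\<in>A. emb t (f i))"
  by (rule finsum_hom[OF fb.M.abelian_monoid_axioms abelian_monoid_reduced_algebra])
    (use assms in \<open>auto simp: emb_add emb_zero\<close>)

section \<open>Transfer of approximations from the reduced algebra to the bundle\<close>

lemma unit_fibre_simps: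
  "carrier (unit_fibre B) = carrier (F 0)" "zero (unit_fibre B) = zero (F 0)"
  "add (unit_fibre B) = add (F 0)" "module.smult (unit_fibre B) = module.smult (F 0)"
  "nrm (unit_fibre B) = nrm (F 0)" "monoid.mult (unit_fibre B) = bmult B" "star (unit_fibre B) = adj"
  by (simp_all add: unit_fibre_def cnormed.extend_def star_alg.fields_def)

lemma finsum_unit_fibre: "finsum (unit_fibre B) f A = finsum (F 0) f A"
  by (simp add: finsum_def finprod_def unit_fibre_simps)

text \<open>\<open>matrix_positive\<close> asks for a factorisation with entries in the algebra
  itself, so embedding the entries of the factor C transports it.\<close>

lemma completely_positive_emb:
  assumes "completely_positive (reduced_algebra B) d \<phi>"
  shows "completely_positive (unit_fibre B) d (\<lambda>b. \<phi> (emb 0 b))"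
  unfolding completely_positive_def
proof (intro allI impI)
  fix n X assume "matrix_positive (unit_fibre B) n X"
  then obtain C where C: "\<And>i j. \<lbrakk>i < n; j < n\<rbrakk> \<Longrightarrow> C i j \<in> carrier (F 0)"
    and X: "\<And>i j. \<lbrakk>i < n; j < n\<rbrakk> \<Longrightarrow> X i j = (\<Oplus>\<^bsub>F 0\<^esub>k\<in>{..<n}. adj (C k i) \<diamondop> C k j)"
    unfolding matrix_positive_def unit_fibre_simps finsum_unit_fibre by blast
  have emb: "emb 0 (adj a \<diamondop> b) = star (reduced_algebra B) (emb 0 a) \<otimes>\<^bsub>reduced_algebra B\<^esub> emb 0 b"
    if "a \<in> carrier (F 0)" "b \<in> carrier (F 0)" for a b
    using emb_mult[of "adj a" 0 b 0] emb_star[of a 0] that by simp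
  have "emb 0 (X i j) = (\<Oplus>\<^bsub>reduced_algebra B\<^esub>k\<in>{..<n}.
      star (reduced_algebra B) (emb 0 (C k i)) \<otimes>\<^bsub>reduced_algebra B\<^esub> emb 0 (C k j))"
    if ij: "i < n" "j < n" for i j
  proof -
    interpret R: abelian_monoid "reduced_algebra B" by (rule abelian_monoid_reduced_algebra)
    have "emb 0 (X i j) = (\<Oplus>\<^bsub>reduced_algebra B\<^esub>k\<in>{..<n}. emb 0 (adj (C k i) \<diamondop> C k j))"
      unfolding X[OF ij] using C ij by (intro emb_finsum) auto
    also have "\<dots> = (\<Oplus>\<^bsub>reduced_algebra B\<^esub>k\<in>{..<n}.
      star (reduced_algebra B) (emb 0 (C k i)) \<otimes>\<^bsub>reduced_algebra B\<^esub> emb 0 (C k j))"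
    proof (rule R.finsum_cong'[OF refl])
      fix k assume "k \<in> {..<n}"
      then show "emb 0 (adj (C k i) \<diamondop> C k j)
        = star (reduced_algebra B) (emb 0 (C k i)) \<otimes>\<^bsub>reduced_algebra B\<^esub> emb 0 (C k j)"
        using C ij by (intro emb) auto
    qed (use C ij in \<open>auto simp flip: emb\<close>)
    finally show ?thesis .
  qed
  then have "matrix_positive (reduced_algebra B) n (\<lambda>i j. emb 0 (X i j))"
    unfolding matrix_positive_def using C by (intro exI[of _ "\<lambda>i j. emb 0 (C i j)"]) auto
  then show "matrix_positive (matrix_algebra d) n (\<lambda>i j. \<phi> (emb 0 (X i j)))"
    using assms unfolding completely_positive_def by blast
qed

text \<open>\<open>alg_approx\<close> and \<open>bundle_approx\<close> subtract in opposite orders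
  in the estimate for products.\<close>

lemma mat_norm_minus_commute:
  assumes "M \<in> carrier_mat d d" "N \<in> carrier_mat d d"
  shows "mat_norm (M - N) = mat_norm (N - M)"
proof -
  have "vec_norm2 ((M - N) *\<^sub>v v) = vec_norm2 ((N - M) *\<^sub>v v)" if "v \<in> carrier_vec d" for v
    using assms that
    by (simp add: minus_mult_distrib_mat_vec[OF _ _ that] vec_norm2_def norm_minus_commute)
  moreover have "dim_col (M - N) = d" "dim_col (N - M) = d" using assms by auto
  ultimately show ?thesis
    unfolding mat_norm_def setcompr_eq_image by (intro arg_cong[where f = Sup] image_cong) auto
qed

lemma bundle_approx_emb:
  assumes \<Omega>: "\<Omega> \<subseteq> total_space B"
    and approx: "alg_approx (reduced_algebra B) (\<Union>t. emb t ` (\<Omega> \<inter> carrier (F t))) \<epsilon> d \<phi>"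
  shows "bundle_approx B \<Omega> \<epsilon> d (\<lambda>t b. \<phi> (emb t b))"
proof -
  have linear: "linear_to_mat (reduced_algebra B) d \<phi>"
    using approx by (simp add: alg_approx_def)
  then have mat: "\<phi> (emb t b) \<in> carrier_mat d d" if "b \<in> carrier (F t)" for t b
    using that by (simp add: linear_to_mat_def)
  show ?thesis
    unfolding bundle_approx_def
  proof (intro conjI allI ballI)
    fix t
    show "linear_to_mat (F t) d (\<lambda>b. \<phi> (emb t b))"
      using linear by (simp add: linear_to_mat_def emb_add emb_scale)
    fix b assume b: "b \<in> \<Omega> \<inter> carrier (F t)"
    then show "mat_norm (mat_adjoint (\<phi> (emb t b)) - \<phi> (emb (- t) (adj b))) < \<epsilon>"
      using approx unfolding alg_approx_def by (auto simp: emb_star)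
    show "\<bar>mat_norm (\<phi> (emb t b)) - nrm (F t) b\<bar> < \<epsilon>"
      using approx b unfolding alg_approx_def by (fastforce simp: nrm_emb)
  next
    fix s t a b assume ab: "a \<in> \<Omega> \<inter> carrier (F s)" "b \<in> \<Omega> \<inter> carrier (F t)"
    then have "mat_norm (\<phi> (emb s a \<otimes>\<^bsub>reduced_algebra B\<^esub> emb t b) - \<phi> (emb s a) * \<phi> (emb t b)) < \<epsilon>"
      using approx unfolding alg_approx_def by blast
    then have "mat_norm (\<phi> (emb (s + t) (a \<diamondop> b)) - \<phi> (emb s a) * \<phi> (emb t b)) < \<epsilon>"
      using ab by (simp add: emb_mult)
    also have "mat_norm (\<phi> (emb (s + t) (a \<diamondop> b)) - \<phi> (emb s a) * \<phi> (emb t b))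
        = mat_norm (\<phi> (emb s a) * \<phi> (emb t b) - \<phi> (emb (s + t) (a \<diamondop> b)))"
      using ab mat[of a s] mat[of b t] mat[OF mult_closed[of a s b t]]
      by (intro mat_norm_minus_commute[of _ d]) auto
    finally show "mat_norm (\<phi> (emb s a) * \<phi> (emb t b) - \<phi> (emb (s + t) (a \<diamondop> b))) < \<epsilon>" .
  qed
qed

text \<open>The union runs over the whole group. Disjointness of the fibres gives each b at most one
  degree, so the union lies in the image of \<Omega> under a single map.\<close>

lemma finite_emb_image:
  assumes "finite \<Omega>"
  shows "finite (\<Union>t. emb t ` (\<Omega> \<inter> carrier (F t)))"
proof -
  define deg where "deg b = (THE t. b \<in> carrier (F t))" for b
  have deg: "deg b = t" if "b \<in> carrier (F t)" for b t
    unfolding deg_def using that fibres_disjoint by (intro the_equality) blast+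
  have "(\<Union>t. emb t ` (\<Omega> \<inter> carrier (F t))) \<subseteq> (\<lambda>b. emb (deg b) b) ` \<Omega>"
  proof (intro UN_least image_subsetI)
    fix t b assume "b \<in> \<Omega> \<inter> carrier (F t)"
    then show "emb t b \<in> (\<lambda>b. emb (deg b) b) ` \<Omega>" using deg[of b t] by (intro image_eqI[of _ _ b]) simp_all
  qed
  then show ?thesis by (rule finite_subset) (simp add: assms)
qed

lemma emb_image_closed: "(\<Union>t. emb t ` (\<Omega> \<inter> carrier (F t))) \<subseteq> carrier (reduced_algebra B)"
proof (intro UN_least image_subsetI)
  fix t b assume "b \<in> \<Omega> \<inter> carrier (F t)"
  then show "emb t b \<in> carrier (reduced_algebra B)" using emb_closed[of b t] by blast
qed

lemma MF_bundleI:
  assumes "MF_algebra (reduced_algebra B)"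
  shows "MF_bundle B"
  unfolding MF_bundle_def
proof (intro allI impI)
  fix \<epsilon> :: real and \<Omega> assume \<Omega>: "0 < \<epsilon> \<and> finite \<Omega> \<and> \<Omega> \<subseteq> total_space B"
  then have fin: "finite (\<Union>t. emb t ` (\<Omega> \<inter> carrier (F t)))" and \<epsilon>: "0 < \<epsilon>"
    by (blast intro: finite_emb_image)+
  obtain d \<phi> where "d \<ge> 1" "alg_approx (reduced_algebra B) (\<Union>t. emb t ` (\<Omega> \<inter> carrier (F t))) \<epsilon> d \<phi>"
    using assms[unfolded MF_algebra_def, rule_format, OF conjI[OF fin conjI[OF emb_image_closed \<epsilon>]]]
    by blast
  then show "\<exists>d\<ge>1. \<exists>\<phi>. bundle_approx B \<Omega> \<epsilon> d \<phi>" using bundle_approx_emb \<Omega> by blast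
qed

lemma QD_bundleI:
  assumes "QD_algebra (reduced_algebra B)"
  shows "QD_bundle B"
  unfolding QD_bundle_def
proof (intro allI impI)
  fix \<epsilon> :: real and \<Omega> assume \<Omega>: "0 < \<epsilon> \<and> finite \<Omega> \<and> \<Omega> \<subseteq> total_space B"
  then have fin: "finite (\<Union>t. emb t ` (\<Omega> \<inter> carrier (F t)))" and \<epsilon>: "0 < \<epsilon>"
    by (blast intro: finite_emb_image)+
  obtain d \<phi> where d: "d \<ge> 1"
    and approx: "alg_approx (reduced_algebra B) (\<Union>t. emb t ` (\<Omega> \<inter> carrier (F t))) \<epsilon> d \<phi>"
    and cp: "completely_positive (reduced_algebra B) d \<phi>" and con: "contractive (reduced_algebra B) \<phi>"
    using assms[unfolded QD_algebra_def, rule_format, OF conjI[OF fin conjI[OF emb_image_closed \<epsilon>]]]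
    by (elim exE conjE) (rule that)
  have "contractive (unit_fibre B) (\<lambda>b. \<phi> (emb 0 b))"
    unfolding contractive_def unit_fibre_simps
  proof
    fix b assume b: "b \<in> carrier (F 0)"
    then show "mat_norm (\<phi> (emb 0 b)) \<le> nrm (F 0) b"
      using con[unfolded contractive_def, rule_format, OF emb_closed[OF b]] by (simp only: nrm_emb)
  qed
  then show "\<exists>d\<ge>1. \<exists>\<phi>. bundle_approx B \<Omega> \<epsilon> d \<phi> \<and>
      completely_positive (unit_fibre B) d (\<phi> 0) \<and> contractive (unit_fibre B) (\<phi> 0)"
    using bundle_approx_emb[OF _ approx] completely_positive_emb[OF cp] \<Omega>
    by (intro exI[of _ d] conjI d exI[of _ "\<lambda>t b. \<phi> (emb t b)"]) simp_all
qed

end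

theorem proposition4p12:
  fixes B :: "('g :: group_add, 'b) bundle_data"
  assumes "fell_bundle B"
  shows "(MF_algebra (reduced_algebra B) \<longrightarrow> MF_bundle B) \<and>
         (QD_algebra (reduced_algebra B) \<longrightarrow> QD_bundle B)"
proof -
  interpret fell_bundle B by fact
  show ?thesis using MF_bundleI QD_bundleI by blast
qed

end
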